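(* Fix $D\ge1$ and an integer $k\ge1$, and let $(r_n)$ be a sequence in $[0,1/2]$. Suppose that, as $n\to\infty$, $$n^k r_n^{D(k-1)}\longrightarrow\infty,\qquad n^{k+1}r_n^{Dk}\longrightarrow0.$$ Then $G_D(n;r_n)$ satisfies a first-order zero-one law. More precisely, with high probability every component of $G_D(n;r_n)$ has at most $k$ vertices, every component is isomorphic to a member of $\mathcal H_{D,k}$, and the number of components isomorphic to each $H\in\mathcal H_{D,k}$ tends to infinity in probability. Consequently, $G_D(n;r_n)$ converges first-order to the deterministic theory of the disjoint union containing countably infinitely many copies of every graph in $\mathcal H_{D,k}$; that is, for every first-order graph sentence $\varphi$, $\mathbb P(G_D(n;r_n)\models\varphi)$ tends to $1$ if that disjoint union satisfies $\varphi$ and to $0$ otherwise.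
   Context: Let $\mathbb T^D=(\mathbb R/\mathbb Z)^D$, with torus $L^\infty$ metric $d_\infty(x,y)=\max_{1\le i\le D}\|x_i-y_i\|_{\mathbb T}$, where $\|t\|_{\mathbb T}=\min_{m\in\mathbb Z}|t-m|$. Let $X_1,\dots,X_n$ be independent uniform random points of $\mathbb T^D$. For $0\le r\le1/2$, $G_D(n;r)$ is the simple graph on $[n]=\{1,\dots,n\}$ in which distinct $i,j$ are adjacent iff $d_\infty(X_i,X_j)\le r$. The convention $r_n^0=1$ is used (relevant when $k=1$). A finite connected graph $H$ is strictly $D$-geometric if either $H=K_1$ or, after writing $V(H)=\{1,\dots,s\}$, there are points $z_1,\dots,z_s\in\mathbb R^D$ such that for every $i<j$: $ij\in E(H)\Rightarrow\|z_i-z_j\|_\infty<1$, and $ij\notin E(H)\Rightarrow\|z_i-z_j\|_\infty>1$. For $s\ge1$, $\mathcal H_D^{(s)}$ is a fixed set of representatives of the isomorphism classes of strictly $D$-geometric connected graphs on exactly $s$ vertices, and $\mathcal H_{D,k}=\bigcup_{1\le s\le k}\mathcal H_D^{(s)}$. Graphs are regarded as structures in the first-order language with equality and one binary relation symbol $E$. A sequence of random graphs satisfies a first-order zero-one law if, for every first-order graph sentence, the probability that it holds tends to $0$ or $1$ as $n\to\infty$. "With high probability" means with probability tending to $1$; $Y_n\to\infty$ in probability means $\mathbb P(Y_n\ge M)\to1$ for every $M$. *)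

theory Defs
  imports "HOL-Probability.Probability" "Graph_Theory.Graph_Theory"
begin

section \<open>The random geometric graph on the torus\<close>

text \<open>
  The dimension is \<open>D = CARD('d)\<close>. A point of \<open>(\<real>/\<int>)\<^sup>D\<close> is represented by its unique
  representative in the half-open unit cube, so that the uniform (Haar) distribution on
  the torus is the uniform distribution on that cube; distances are distances on the torus.
\<close>

definition torus_norm :: "real \<Rightarrow> real" where
  "torus_norm t = (INF m::int. \<bar>t - of_int m\<bar>)"

definition torus_dist :: "real ^ 'd \<Rightarrow> real ^ 'd \<Rightarrow> real" where
  "torus_dist x y = (MAX i. torus_norm (x $ i - y $ i))"

definition uniform_torus :: "(real ^ 'd) measure" where
  "uniform_torus = uniform_measure lborel {x. \<forall>i. 0 \<le> x $ i \<and> x $ i < 1}"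

lemma torus_norm_attained: "torus_norm t = \<bar>t - of_int (round t)\<bar>"
  unfolding torus_norm_def by (rule cInf_eq_minimum) (auto intro: round_diff_minimal)

text \<open>Simple graphs are symmetric loop-free digraphs whose arcs are pairs of vertices.\<close>

definition torus_graph :: "nat \<Rightarrow> real \<Rightarrow> (nat \<Rightarrow> real ^ 'd) \<Rightarrow> nat pair_pre_digraph" where
  "torus_graph n \<rho> x = \<lparr> pverts = {1..n},
     parcs = {(i, j). i \<in> {1..n} \<and> j \<in> {1..n} \<and> i \<noteq> j \<and> torus_dist (x i) (x j) \<le> \<rho>} \<rparr>"

lemma pair_graph_torus_graph: "pair_graph (torus_graph n \<rho> x)"
proof -
  have dist_commute: "torus_dist x y = torus_dist y x" for x y :: "real ^ 'd"
  proof -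
    have le: "torus_norm (- t) \<le> torus_norm t" for t
      using round_diff_minimal[of "- t" "- round t"] by (simp add: torus_norm_attained)
    have "torus_norm (- t) = torus_norm t" for t
      using le[of t] le[of "- t"] by simp
    then have "torus_norm (x $ i - y $ i) = torus_norm (y $ i - x $ i)" for i
      by (metis minus_diff_eq)
    then show ?thesis
      by (simp add: torus_dist_def)
  qed
  have "parcs (torus_graph n \<rho> x) \<subseteq> {1..n} \<times> {1..n}"
    by (auto simp: torus_graph_def)
  then have "finite (parcs (torus_graph n \<rho> x))"
    by (rule finite_subset) simp
  then show ?thesis
    by unfold_locales
      (auto simp: torus_graph_def symmetric_def sym_def intro: ord_eq_le_trans[OF dist_commute])
qed

definition random_torus_graph ::
  "(nat \<Rightarrow> real) \<Rightarrow> (nat \<Rightarrow> nat \<Rightarrow> 'w \<Rightarrow> real ^ 'd) \<Rightarrow> nat \<Rightarrow> 'w \<Rightarrow> nat pair_pre_digraph" where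
  "random_torus_graph r X n \<omega> = torus_graph n (r n) (\<lambda>i. X n i \<omega>)"


section \<open>Components and strictly geometric graphs\<close>

definition graph_components :: "'v pair_pre_digraph \<Rightarrow> ('v, 'v \<times> 'v) pre_digraph set" where
  "graph_components G = {C. pre_digraph.max_subgraph (with_proj G) Digraph_Component.connected C}"

definition num_components_iso :: "'v pair_pre_digraph \<Rightarrow> 'u pair_pre_digraph \<Rightarrow> nat" where
  "num_components_iso G H = card {C \<in> graph_components G. digraph_iso C (with_proj H)}"

text \<open>
  On \<^typ>\<open>real ^ 'd\<close> the library's \<^const>\<open>infnorm\<close> is the maximum norm. The points are
  indexed by the vertices themselves, which amounts to labelling them by \<open>1, \<dots>, s\<close>.
\<close>

definition strictly_geometric :: "'d::finite itself \<Rightarrow> 'v pair_pre_digraph \<Rightarrow> bool" where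
  "strictly_geometric _ H \<longleftrightarrow>
     pair_graph H \<and> Digraph_Component.connected (with_proj H) \<and>
     (card (pverts H) = 1 \<or>
      (\<exists>z :: 'v \<Rightarrow> real ^ 'd. \<forall>u \<in> pverts H. \<forall>v \<in> pverts H. u \<noteq> v \<longrightarrow>
         ((u, v) \<in> parcs H \<longrightarrow> infnorm (z u - z v) < 1) \<and>
         ((u, v) \<notin> parcs H \<longrightarrow> infnorm (z u - z v) > 1)))"

text \<open>
  \<open>R\<close> contains exactly one member of each isomorphism class of strictly geometric graphs
  on \<open>s\<close> vertices. Since these graphs are finite, vertices in \<^typ>\<open>nat\<close> lose no class.
\<close>

definition geometric_representatives ::
  "'d::finite itself \<Rightarrow> nat \<Rightarrow> nat pair_pre_digraph set \<Rightarrow> bool" where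
  "geometric_representatives d s R \<longleftrightarrow>
     (\<forall>H \<in> R. strictly_geometric d H \<and> card (pverts H) = s) \<and>
     (\<forall>K :: nat pair_pre_digraph. strictly_geometric d K \<and> card (pverts K) = s \<longrightarrow>
        (\<exists>!H. H \<in> R \<and> digraph_iso (with_proj K) (with_proj H)))"

text \<open>A vertex \<open>(H, m, v)\<close> is the vertex \<open>v\<close> in the \<open>m\<close>-th copy of the graph \<open>H\<close>.\<close>

definition infinite_copies ::
  "'v pair_pre_digraph set \<Rightarrow> ('v pair_pre_digraph \<times> nat \<times> 'v) pair_pre_digraph" where
  "infinite_copies \<H> = \<lparr> pverts = {(H, m, v). H \<in> \<H> \<and> v \<in> pverts H},
     parcs = {((H, m, u), (H', m', v)). H \<in> \<H> \<and> H' = H \<and> m' = m \<and> (u, v) \<in> parcs H} \<rparr>"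


section \<open>First-order logic of graphs\<close>

datatype fo_formula =
    Eq nat nat
  | Edge nat nat
  | Neg fo_formula
  | Conj fo_formula fo_formula
  | Exists nat fo_formula

primrec free_vars :: "fo_formula \<Rightarrow> nat set" where
  "free_vars (Eq x y) = {x, y}"
| "free_vars (Edge x y) = {x, y}"
| "free_vars (Neg \<phi>) = free_vars \<phi>"
| "free_vars (Conj \<phi> \<psi>) = free_vars \<phi> \<union> free_vars \<psi>"
| "free_vars (Exists x \<phi>) = free_vars \<phi> - {x}"

definition sentence :: "fo_formula \<Rightarrow> bool" where
  "sentence \<phi> \<longleftrightarrow> free_vars \<phi> = {}"

primrec sat :: "'v pair_pre_digraph \<Rightarrow> (nat \<Rightarrow> 'v) \<Rightarrow> fo_formula \<Rightarrow> bool" where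
  "sat G e (Eq x y) \<longleftrightarrow> e x = e y"
| "sat G e (Edge x y) \<longleftrightarrow> (e x, e y) \<in> parcs G"
| "sat G e (Neg \<phi>) \<longleftrightarrow> \<not> sat G e \<phi>"
| "sat G e (Conj \<phi> \<psi>) \<longleftrightarrow> sat G e \<phi> \<and> sat G e \<psi>"
| "sat G e (Exists x \<phi>) \<longleftrightarrow> (\<exists>v \<in> pverts G. sat G (e(x := v)) \<phi>)"

text \<open>Only used for sentences, whose truth value does not depend on the assignment.\<close>

definition models :: "'v pair_pre_digraph \<Rightarrow> fo_formula \<Rightarrow> bool" where
  "models G \<phi> \<longleftrightarrow> (\<forall>e. sat G e \<phi>)"


section \<open>Asymptotic notions for sequences of random objects\<close>

definition prob_seq :: "(nat \<Rightarrow> 'w measure) \<Rightarrow> (nat \<Rightarrow> 'w \<Rightarrow> bool) \<Rightarrow> nat \<Rightarrow> real" where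
  "prob_seq M P n = measure (M n) {\<omega> \<in> space (M n). P n \<omega>}"

definition whp :: "(nat \<Rightarrow> 'w measure) \<Rightarrow> (nat \<Rightarrow> 'w \<Rightarrow> bool) \<Rightarrow> bool" where
  "whp M P \<longleftrightarrow> prob_seq M P \<longlonglongrightarrow> 1"

definition tends_to_infinity_in_probability ::
  "(nat \<Rightarrow> 'w measure) \<Rightarrow> (nat \<Rightarrow> 'w \<Rightarrow> nat) \<Rightarrow> bool" where
  "tends_to_infinity_in_probability M Y \<longleftrightarrow> (\<forall>B. whp M (\<lambda>n \<omega>. Y n \<omega> \<ge> B))"

definition fo_zero_one_law ::
  "(nat \<Rightarrow> 'w measure) \<Rightarrow> (nat \<Rightarrow> 'w \<Rightarrow> 'v pair_pre_digraph) \<Rightarrow> bool" where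
  "fo_zero_one_law M G \<longleftrightarrow> (\<forall>\<phi>. sentence \<phi> \<longrightarrow>
     prob_seq M (\<lambda>n \<omega>. models (G n \<omega>) \<phi>) \<longlonglongrightarrow> 0 \<or>
     prob_seq M (\<lambda>n \<omega>. models (G n \<omega>) \<phi>) \<longlonglongrightarrow> 1)"

definition fo_converges_to_theory_of ::
  "(nat \<Rightarrow> 'w measure) \<Rightarrow> (nat \<Rightarrow> 'w \<Rightarrow> 'v pair_pre_digraph) \<Rightarrow> 'u pair_pre_digraph \<Rightarrow> bool" where
  "fo_converges_to_theory_of M G U \<longleftrightarrow> (\<forall>\<phi>. sentence \<phi> \<longrightarrow>
     prob_seq M (\<lambda>n \<omega>. models (G n \<omega>) \<phi>) \<longlonglongrightarrow> (if models U \<phi> then 1 else 0))"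

end

theory Submission
  imports Defs
begin

text \<open>
  Since \<open>n\<^sup>k\<^sup>+\<^sup>1 r\<^sub>n\<^sup>D\<^sup>k\<close> tends to \<open>0\<close>, a union bound excludes components with more than \<open>k\<close> vertices.
  A component of bounded size has diameter less than \<open>1/2\<close>, so it lifts isometrically to \<open>\<real>\<^sup>D\<close>;
  rescaling the lift by a factor slightly smaller than \<open>1 / r\<^sub>n\<close> makes all inequalities strict.

  For the abundance of a strictly geometric \<open>H\<close> on \<open>s\<close> vertices, the unit cube is tiled by cubes with side
  a large multiple of \<open>r\<^sub>n\<close>. If a tile contains exactly \<open>s\<close> points and these lie in small boxes around a
  rescaled realization of \<open>H\<close>, away from the boundary of the tile, they form a component isomorphic
  to \<open>H\<close>. The indicators of these events have explicit product probabilities and are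
  asymptotically pairwise uncorrelated, with expected count of order \<open>n\<^sup>s r\<^sub>n\<^sup>D\<^sup>(\<^sup>s\<^sup>-\<^sup>1\<^sup>)\<close>, so Chebyshev's
  inequality applies.

  Finally, two graphs whose components have the same isomorphism types, each occurring at least
  \<open>q\<close> times, satisfy the same sentences of quantifier rank \<open>q\<close>, because in an Ehrenfeucht--Fraisse
  game a fresh component can always be answered by an isomorphic fresh one.
\<close>


section \<open>Components and isomorphisms of graphs\<close>

text \<open>The two growth conditions are tied together by \<open>n * r n ^ D\<close> with
  \<open>D = CARD('d)\<close>, the order of the mean degree. Its \<open>k\<close>-th power is
  \<open>1 / n\<close> times the quantity in the upper condition, so it tends to 0. Hence
  \<open>r n\<close> tends to 0 and bounded components do not wrap around the torus; a tile is
  likely to contain no further points; and since passing from size \<open>s\<close> to size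
  \<open>k\<close> multiplies the order of the expected count by the \<open>(k - s)\<close>-th power
  of it, divergence at size \<open>k\<close> gives divergence at every size
  \<open>s \<le> k\<close>.

  The pairwise correlations can be bounded explicitly: two different pattern events either exclude
  each other or concern disjoint tiles and disjoint index sets, and then their joint probability is
  at most \<open>(1 / (1 - p)) ^ (2 * s)\<close> times the product, where \<open>p\<close> is the
  volume of a tile.

  A sentence only sees as many copies of a component as its quantifier rank, and only finitely many
  types occur, so its truth value is settled by finitely many events of probability tending to
  1.\<close>

text \<open>The vertex sets of the components, characterized by cuts.\<close>

definition block :: "'v pair_pre_digraph \<Rightarrow> 'v set \<Rightarrow> bool" where
  "block G S \<longleftrightarrow> S \<noteq> {} \<and> S \<subseteq> pverts G \<and>
     (\<forall>u v. (u, v) \<in> parcs G \<longrightarrow> (u \<in> S \<longleftrightarrow> v \<in> S)) \<and>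
     (\<forall>A. A \<subset> S \<longrightarrow> A \<noteq> {} \<longrightarrow> (\<exists>u\<in>A. \<exists>v\<in>S - A. (u, v) \<in> parcs G))"

definition induced :: "'v pair_pre_digraph \<Rightarrow> 'v set \<Rightarrow> 'v pair_pre_digraph" where
  "induced G S = \<lparr> pverts = S, parcs = {(u, v). (u, v) \<in> parcs G \<and> u \<in> S \<and> v \<in> S} \<rparr>"

definition graph_iso :: "('v \<Rightarrow> 'u) \<Rightarrow> 'v pair_pre_digraph \<Rightarrow> 'u pair_pre_digraph \<Rightarrow> bool" where
  "graph_iso f K H \<longleftrightarrow> bij_betw f (pverts K) (pverts H) \<and>
     (\<forall>u\<in>pverts K. \<forall>v\<in>pverts K. (u, v) \<in> parcs K \<longleftrightarrow> (f u, f v) \<in> parcs H)"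

lemma block_cut:
  assumes "block G S" "A \<subset> S" "A \<noteq> {}"
  obtains u v where "u \<in> A" "v \<in> S" "v \<notin> A" "(u, v) \<in> parcs G"
proof -
  have "\<exists>u\<in>A. \<exists>v\<in>S - A. (u, v) \<in> parcs G"
    using assms unfolding block_def by (elim conjE allE[of _ A]) simp
  then show ?thesis using that by blast
qed

lemma block_closed: "block G S \<Longrightarrow> (u, v) \<in> parcs G \<Longrightarrow> u \<in> S \<longleftrightarrow> v \<in> S"
  by (simp add: block_def)

lemma block_nonempty: "block G S \<Longrightarrow> S \<noteq> {}"
  and block_subset: "block G S \<Longrightarrow> S \<subseteq> pverts G"
  by (simp_all add: block_def)

lemma induced_simps [simp]:
  "pverts (induced G S) = S"
  "parcs (induced G S) = {(u, v). (u, v) \<in> parcs G \<and> u \<in> S \<and> v \<in> S}"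
  by (simp_all add: induced_def)

lemma pair_wf_induced: "pair_wf_digraph (induced G S)"
  by unfold_locales auto

lemma pair_graph_induced:
  assumes "pair_graph G" "S \<subseteq> pverts G"
  shows "pair_graph (induced G S)"
proof -
  interpret pair_graph G by fact
  have "finite (pverts G)" "finite (parcs G)"
    by (simp_all add: pair_finite_verts pair_finite_arcs)
  moreover have "parcs (induced G S) \<subseteq> parcs G" by auto
  moreover have "(u, v) \<in> parcs G \<Longrightarrow> (v, u) \<in> parcs G" for u v
    using graph_symmetric by auto
  moreover have "(u, u) \<notin> parcs G" for u
    using pair_no_loops[of "(u, u)"] by auto
  ultimately show ?thesis
    using assms(2)
    by unfold_locales (auto simp: symmetric_def sym_def dest: finite_subset)
qed

lemma pair_graph_sym: "pair_graph G \<Longrightarrow> (u, v) \<in> parcs G \<Longrightarrow> (v, u) \<in> parcs G"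
proof -
  assume "pair_graph G" "(u, v) \<in> parcs G"
  then interpret pair_graph G by simp
  show ?thesis using graph_symmetric \<open>(u, v) \<in> parcs G\<close> by auto
qed

lemma pair_graph_arc_verts: "pair_graph G \<Longrightarrow> (u, v) \<in> parcs G \<Longrightarrow> u \<in> pverts G \<and> v \<in> pverts G"
proof -
  assume "pair_graph G" "(u, v) \<in> parcs G"
  then interpret pair_graph G by simp
  show ?thesis using in_arcsD1 in_arcsD2 \<open>(u, v) \<in> parcs G\<close> by auto
qed

lemma pair_graph_imp_pair_wf: "pair_graph G \<Longrightarrow> pair_wf_digraph G"
  by (simp add: pair_graph_def pair_digraph_def pair_fin_digraph_def)

lemma pair_wf_imp_wf: "pair_wf_digraph G \<Longrightarrow> wf_digraph (with_proj G)"
  by (auto simp: wf_digraph_def dest: pair_wf_digraph.arc_fst_in_verts pair_wf_digraph.arc_snd_in_verts)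

text \<open>A path from \<open>A\<close> to its complement has a step that leaves \<open>A\<close>;
  conversely, no arc leaves the set of vertices reachable from \<open>u\<close>, so this set is
  everything. Both orientations of an arc occur because connectedness is reachability in the
  symmetric closure.\<close>

lemma connected_iff_cut:
  assumes "wf_digraph C"
  shows "Digraph_Component.connected C \<longleftrightarrow> verts C \<noteq> {} \<and>
    (\<forall>A. A \<subset> verts C \<longrightarrow> A \<noteq> {} \<longrightarrow>
      (\<exists>u\<in>A. \<exists>v\<in>verts C - A. (u, v) \<in> arcs_ends C \<or> (v, u) \<in> arcs_ends C))"
    (is "_ \<longleftrightarrow> _ \<and> ?cut")
proof -
  let ?E = "(arcs_ends C)\<^sup>s"
  have E: "(u, v) \<in> ?E \<longleftrightarrow> (u, v) \<in> arcs_ends C \<or> (v, u) \<in> arcs_ends C" for u v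
    by (auto simp: symcl_def)
  let ?reach = "\<forall>u \<in> verts C. \<forall>v \<in> verts C. (u, v) \<in> rtrancl_on (verts C) ?E"
  have 1: "?cut" if reach: "\<forall>u \<in> verts C. \<forall>v \<in> verts C. (u, v) \<in> rtrancl_on (verts C) ?E"
  proof (intro allI impI)
    fix A assume A: "A \<subset> verts C" "A \<noteq> {}"
    then obtain a b where ab: "a \<in> A" "b \<in> verts C - A" by auto
    show "\<exists>u\<in>A. \<exists>v\<in>verts C - A. (u, v) \<in> arcs_ends C \<or> (v, u) \<in> arcs_ends C"
    proof (rule ccontr)
      assume no: "\<not> ?thesis"
      have "(a, b) \<in> rtrancl_on (verts C) ?E" using reach ab A by blast
      then have "b \<in> A"
      proof (induct rule: rtrancl_on_induct)
        case base
        then show ?case using ab by simp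
      next
        case (step y z)
        then show ?case using no E by blast
      qed
      then show False using ab by simp
    qed
  qed
  have 2: "(u, v) \<in> rtrancl_on (verts C) ?E"
    if cut: ?cut and uv: "u \<in> verts C" "v \<in> verts C" for u v
  proof -
    let ?A = "{w \<in> verts C. (u, w) \<in> rtrancl_on (verts C) ?E}"
    have "?A = verts C"
    proof (rule ccontr)
      assume "?A \<noteq> verts C"
      then have "?A \<subset> verts C" "?A \<noteq> {}" using uv by auto
      then have "\<exists>a\<in>?A. \<exists>b\<in>verts C - ?A. (a, b) \<in> arcs_ends C \<or> (b, a) \<in> arcs_ends C"
        using cut by blast
      then obtain a b where ab: "a \<in> ?A" "b \<in> verts C - ?A" "(a, b) \<in> ?E"
        using E by blast
      then have "(u, b) \<in> rtrancl_on (verts C) ?E"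
        by (auto intro: rtrancl_on_into_rtrancl_on)
      with ab show False by auto
    qed
    then show ?thesis using uv by blast
  qed
  have "?reach \<longleftrightarrow> ?cut"
  proof
    assume ?reach
    then show ?cut by (rule 1)
  next
    assume ?cut
    then show ?reach using 2 by simp
  qed
  then show ?thesis
    unfolding connected_conv by (rule arg_cong2[where f = conj, OF refl])
qed

lemma connected_with_proj_iff_cut:
  assumes "pair_graph G"
  shows "Digraph_Component.connected (with_proj G) \<longleftrightarrow> pverts G \<noteq> {} \<and>
    (\<forall>A. A \<subset> pverts G \<longrightarrow> A \<noteq> {} \<longrightarrow> (\<exists>u\<in>A. \<exists>v\<in>pverts G - A. (u, v) \<in> parcs G))"
proof -
  have "(u, v) \<in> parcs G \<or> (v, u) \<in> parcs G \<longleftrightarrow> (u, v) \<in> parcs G" for u v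
    using pair_graph_sym[OF assms] by blast
  then show ?thesis
    using connected_iff_cut[OF pair_wf_imp_wf[OF pair_graph_imp_pair_wf[OF assms]]] by simp
qed

lemma subgraph_with_proj:
  assumes "subgraph C (with_proj G)"
  shows "arcs_ends C = arcs C" "wf_digraph C"
  using assms by (auto simp: subgraph_def compatible_def with_proj_def arcs_ends_conv)

text \<open>The library's components are maximal connected subgraphs. A connected subgraph that
  properly extends a block on new vertices needs an arc leaving the block. Conversely, maximality
  makes a component induced, and adding a neighbour keeps it connected, so no arc leaves it.\<close>

lemma graph_components_eq:
  assumes G: "pair_graph G"
  shows "graph_components G = (\<lambda>S. with_proj (induced G S)) ` {S. block G S}"
proof (intro equalityI subsetI)
  note sym = pair_graph_sym[OF G]
  have wfG: "wf_digraph (with_proj G)"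
    by (intro pair_wf_imp_wf pair_graph_imp_pair_wf G)
  have ind: "subgraph (with_proj (induced G S)) (with_proj G)" if "S \<subseteq> pverts G" for S
    using that wfG pair_wf_imp_wf[OF pair_wf_induced[of G S]] by (auto simp: subgraph_def)
  {
    fix C assume "C \<in> (\<lambda>S. with_proj (induced G S)) ` {S. block G S}"
    then obtain S where S: "block G S" and C: "C = with_proj (induced G S)" by auto
    have "S \<subseteq> pverts G" using S by (simp add: block_def)
    then have pg: "pair_graph (induced G S)" by (rule pair_graph_induced[OF G])
    have conn: "Digraph_Component.connected C"
      unfolding C connected_with_proj_iff_cut[OF pg]
    proof (intro conjI allI impI)
      show "pverts (induced G S) \<noteq> {}" using block_nonempty[OF S] by simp
      fix A assume A: "A \<subset> pverts (induced G S)" "A \<noteq> {}"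
      then obtain u v where "u \<in> A" "v \<in> S" "v \<notin> A" "(u, v) \<in> parcs G"
        using block_cut[OF S, of A] by auto
      then show "\<exists>u\<in>A. \<exists>v\<in>pverts (induced G S) - A. (u, v) \<in> parcs (induced G S)"
        using A by (intro bexI[of _ u] bexI[of _ v]) auto
    qed
    have "\<not> (subgraph H' (with_proj G) \<and> Digraph_Component.connected H')"
      if H': "H' \<noteq> C" "subgraph C H'" for H'
    proof
      assume *: "subgraph H' (with_proj G) \<and> Digraph_Component.connected H'"
      have sub: "S \<subseteq> verts H'" "arcs C \<subseteq> arcs H'" using H' by (auto simp: subgraph_def C)
      have arcs: "arcs H' \<subseteq> parcs G" using * by (auto simp: subgraph_def)
      have wf: "wf_digraph H'" and ends: "arcs_ends H' = arcs H'"
        using * subgraph_with_proj by blast+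
      have th: "tail H' = fst" "head H' = snd" using * by (auto simp: subgraph_def compatible_def)
      have wfa: "u \<in> verts H' \<and> v \<in> verts H'" if "(u, v) \<in> arcs H'" for u v
        using wf_digraph.tail_in_verts[OF wf that] wf_digraph.head_in_verts[OF wf that] th by simp
      show False
      proof (cases "verts H' = S")
        case True
        have "arcs H' \<subseteq> arcs C" using arcs wfa True by (auto simp: C)
        then have "H' = C" using sub True th by (intro pre_digraph.equality) (auto simp: C)
        then show False using H' by simp
      next
        case False
        have "S \<subset> verts H'" using sub False by auto
        then have "\<exists>u\<in>S. \<exists>v\<in>verts H' - S. (u, v) \<in> arcs H' \<or> (v, u) \<in> arcs H'"
          using * block_nonempty[OF S] unfolding connected_iff_cut[OF wf] ends by simp
        then obtain u v where "u \<in> S" "v \<notin> S" "(u, v) \<in> arcs H' \<or> (v, u) \<in> arcs H'" by blast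
        then have "u \<in> S" "v \<notin> S" "(u, v) \<in> parcs G" using arcs sym[of v u] by auto
        then show False using block_closed[OF S] by simp
      qed
    qed
    then show "C \<in> graph_components G"
      using conn ind[OF \<open>S \<subseteq> pverts G\<close>]
      by (auto simp: graph_components_def pre_digraph.max_subgraph_def C)
  next
    fix C assume "C \<in> graph_components G"
    then have sub: "subgraph C (with_proj G)" and conn: "Digraph_Component.connected C"
      and mx: "\<And>H'. H' \<noteq> C \<Longrightarrow> subgraph C H' \<Longrightarrow> subgraph H' (with_proj G) \<Longrightarrow>
                  \<not> Digraph_Component.connected H'"
      by (auto simp: graph_components_def pre_digraph.max_subgraph_def)
    define S where "S = verts C"
    note wf = subgraph_with_proj(2)[OF sub] and ends = subgraph_with_proj(1)[OF sub]
    have arcs: "arcs C \<subseteq> parcs G" and SG: "S \<subseteq> pverts G"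
      and th: "tail C = fst" "head C = snd"
      using sub by (auto simp: subgraph_def S_def compatible_def)
    have wfa: "u \<in> S \<and> v \<in> S" if "(u, v) \<in> arcs C" for u v
      using wf_digraph.tail_in_verts[OF wf that] wf_digraph.head_in_verts[OF wf that] th
      by (simp add: S_def)
    have cut: "S \<noteq> {}" "\<And>A. A \<subset> S \<Longrightarrow> A \<noteq> {} \<Longrightarrow> \<exists>u\<in>A. \<exists>v\<in>S - A. (u, v) \<in> parcs G"
    proof -
      note c = conn[unfolded connected_iff_cut[OF wf] ends, folded S_def]
      show "S \<noteq> {}" by (rule conjunct1[OF c])
      show "\<exists>u\<in>A. \<exists>v\<in>S - A. (u, v) \<in> parcs G" if "A \<subset> S" "A \<noteq> {}" for A
      proof -
        have "\<exists>u\<in>A. \<exists>v\<in>S - A. (u, v) \<in> arcs C \<or> (v, u) \<in> arcs C"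
          by (rule conjunct2[OF c, rule_format, OF that])
        then obtain u v where "u \<in> A" "v \<in> S - A" "(u, v) \<in> arcs C \<or> (v, u) \<in> arcs C"
          by blast
        then show ?thesis using arcs sym[of v u] by blast
      qed
    qed
    have subT: "subgraph C (with_proj (induced G T))" if "S \<subseteq> T" for T
      using that wf pair_wf_imp_wf[OF pair_wf_induced[of G T]] arcs wfa th
      by (auto simp: subgraph_def S_def compatible_def)
    \<comment> \<open>Maximality enters only through this fact. With \<open>T = insert v S\<close>
      it shows that no arc leaves \<open>S\<close>, with \<open>T = S\<close> that \<open>C\<close>
      is an induced subgraph.\<close>
    have eq: "with_proj (induced G T) = C"
      if T: "S \<subseteq> T" "T \<subseteq> pverts G"
        "\<And>A. A \<subset> T \<Longrightarrow> A \<noteq> {} \<Longrightarrow> \<exists>u\<in>A. \<exists>v\<in>T - A. (u, v) \<in> parcs G" for T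
    proof (rule ccontr)
      assume "with_proj (induced G T) \<noteq> C"
      then have "\<not> Digraph_Component.connected (with_proj (induced G T))"
        by (rule mx[OF _ subT[OF T(1)] ind[OF T(2)]])
      moreover have "Digraph_Component.connected (with_proj (induced G T))"
        unfolding connected_with_proj_iff_cut[OF pair_graph_induced[OF G T(2)]]
      proof (intro conjI allI impI)
        show "pverts (induced G T) \<noteq> {}" using T cut by auto
        fix A assume A: "A \<subset> pverts (induced G T)" "A \<noteq> {}"
        then obtain u v where "u \<in> A" "v \<in> T - A" "(u, v) \<in> parcs G" using T(3)[of A] by auto
        then show "\<exists>u\<in>A. \<exists>v\<in>pverts (induced G T) - A. (u, v) \<in> parcs (induced G T)"
          using A by (intro bexI[of _ u] bexI[of _ v]) auto
      qed
      ultimately show False by simp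
    qed
    have closed: "v \<in> S" if uv: "(u, v) \<in> parcs G" "u \<in> S" for u v
    proof -
      let ?T = "insert v S"
      have "with_proj (induced G ?T) = C"
      proof (rule eq)
        show "?T \<subseteq> pverts G" using SG pair_graph_arc_verts[OF G uv(1)] by auto
        fix A assume A: "A \<subset> ?T" "A \<noteq> {}"
        show "\<exists>u\<in>A. \<exists>v\<in>?T - A. (u, v) \<in> parcs G"
        proof (cases "A \<inter> S = {}")
          case True
          then have "A = {v}" "v \<notin> S" using A by auto
          then show ?thesis using uv sym by auto
        next
          case False
          show ?thesis
          proof (cases "A \<inter> S = S")
            case True
            then have "u \<in> A" "v \<notin> A" using uv A by auto
            then show ?thesis using uv by auto
          next
            case False
            then have "A \<inter> S \<subset> S" by auto
            then obtain a b where "a \<in> A \<inter> S" "b \<in> S - A \<inter> S" "(a, b) \<in> parcs G"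
              using cut(2) \<open>A \<inter> S \<noteq> {}\<close> by blast
            then show ?thesis by blast
          qed
        qed
      qed auto
      then have "?T = S" unfolding S_def by (metis induced_simps(1) with_proj_simps(1))
      then show ?thesis by auto
    qed
    have "block G S"
      unfolding block_def
    proof (intro conjI allI impI)
      show "S \<noteq> {}" by (rule cut(1))
      show "S \<subseteq> pverts G" by (rule SG)
      show "u \<in> S \<longleftrightarrow> v \<in> S" if "(u, v) \<in> parcs G" for u v
        using closed[OF that] closed[OF sym[OF that]] by (rule iffI)
      show "\<exists>u\<in>A. \<exists>v\<in>S - A. (u, v) \<in> parcs G" if "A \<subset> S" "A \<noteq> {}" for A
        using that by (rule cut(2))
    qed
    moreover have "C = with_proj (induced G S)"
      by (rule eq[OF subset_refl SG cut(2), symmetric])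
    ultimately show "C \<in> (\<lambda>S. with_proj (induced G S)) ` {S. block G S}" by blast
  }
qed

text \<open>If the overlap were a proper part of \<open>S\<close>, an arc inside \<open>S\<close>
  would leave it and hence leave \<open>T\<close>, which is closed under arcs.\<close>

lemma block_disjoint:
  assumes S: "block G S" and T: "block G T" and "S \<inter> T \<noteq> {}"
  shows "S = T"
proof -
  have "S \<subseteq> T" if S: "block G S" and T: "block G T" and ne: "S \<inter> T \<noteq> {}" for S T
  proof (rule ccontr)
    assume "\<not> S \<subseteq> T"
    then have "S \<inter> T \<subset> S" by auto
    then obtain u v where "u \<in> S \<inter> T" "v \<in> S" "v \<notin> S \<inter> T" "(u, v) \<in> parcs G"
      using block_cut[OF S _ ne] by metis
    then show False using block_closed[OF T] by auto
  qed
  from this[of S T] this[of T S] show ?thesis using assms by (simp add: Int_commute subset_antisym)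
qed

text \<open>The block of \<open>v\<close> is its reachability class. By symmetry any two of its
  elements are joined by a walk through \<open>v\<close>, and a walk out of \<open>A\<close> crosses
  the cut.\<close>

lemma block_exists:
  assumes G: "pair_graph G" and v: "v \<in> pverts G"
  shows "\<exists>S. block G S \<and> v \<in> S"
proof -
  let ?S = "{w. (v, w) \<in> (parcs G)\<^sup>*}"
  note sym = pair_graph_sym[OF G]
  have "block G ?S"
    unfolding block_def
  proof (intro conjI allI impI)
    show "?S \<noteq> {}" by auto
    have "w \<in> pverts G" if "(v, w) \<in> (parcs G)\<^sup>*" for w
      using that v by induct (auto dest: pair_graph_arc_verts[OF G])
    then show "?S \<subseteq> pverts G" by auto
    show "u \<in> ?S \<longleftrightarrow> w \<in> ?S" if "(u, w) \<in> parcs G" for u w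
      using that sym by (auto intro: rtrancl_into_rtrancl)
    fix A assume A: "A \<subset> ?S" "A \<noteq> {}"
    then obtain a b where ab: "a \<in> A" "(v, a) \<in> (parcs G)\<^sup>*" "b \<notin> A" "(v, b) \<in> (parcs G)\<^sup>*" by auto
    have "sym ((parcs G)\<^sup>*)" using sym by (intro sym_rtrancl) (auto simp: sym_def)
    then have "(a, v) \<in> (parcs G)\<^sup>*" using ab by (auto dest: symD)
    then have "(a, b) \<in> (parcs G)\<^sup>*" using ab by auto
    then have "b \<in> A \<or> (\<exists>u\<in>A. \<exists>w\<in>?S - A. (u, w) \<in> parcs G)"
    proof induct
      case base
      then show ?case using ab by simp
    next
      case (step y z)
      moreover have "(v, z) \<in> (parcs G)\<^sup>*" using ab step by auto
      ultimately show ?case by blast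
    qed
    then show "\<exists>u\<in>A. \<exists>w\<in>?S - A. (u, w) \<in> parcs G" using ab by simp
  qed
  then show ?thesis by auto
qed

text \<open>A library isomorphism has separate maps for vertices, arcs, tails and heads. Since tail
  and head of the image are again \<open>fst\<close> and \<open>snd\<close>, its arc map is induced
  by its vertex map.\<close>

lemma digraph_iso_with_proj_iff:
  assumes K: "pair_wf_digraph K" and H: "pair_wf_digraph H"
  shows "digraph_iso (with_proj K) (with_proj H) \<longleftrightarrow> (\<exists>f. graph_iso f K H)"
proof
  assume "digraph_iso (with_proj K) (with_proj H)"
  then obtain g where g: "pre_digraph.digraph_isomorphism (with_proj K) g"
    and app: "with_proj H = app_iso g (with_proj K)" by (auto simp: digraph_iso_def)
  let ?f = "iso_verts g"
  have tl: "iso_tail g = fst" and hd: "iso_head g = snd"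
    and pv: "pverts H = ?f ` pverts K" and pa: "parcs H = iso_arcs g ` parcs K"
    using arg_cong[OF app, of tail] arg_cong[OF app, of head]
      arg_cong[OF app, of verts] arg_cong[OF app, of arcs] by simp_all
  have arc: "iso_arcs g (u, v) = (?f u, ?f v)" if "(u, v) \<in> parcs K" for u v
    using g that tl hd by (auto simp: pre_digraph.digraph_isomorphism_def prod_eq_iff)
  have inj: "inj_on ?f (pverts K)"
    using g by (auto simp: pre_digraph.digraph_isomorphism_def)
  have "graph_iso ?f K H"
    unfolding graph_iso_def
  proof (intro conjI ballI)
    show "bij_betw ?f (pverts K) (pverts H)" using inj pv by (simp add: bij_betw_def)
    fix u v assume uv: "u \<in> pverts K" "v \<in> pverts K"
    show "(u, v) \<in> parcs K \<longleftrightarrow> (?f u, ?f v) \<in> parcs H"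
    proof
      assume "(u, v) \<in> parcs K"
      then show "(?f u, ?f v) \<in> parcs H" using arc pa by force
    next
      assume "(?f u, ?f v) \<in> parcs H"
      then obtain a b where ab: "(a, b) \<in> parcs K" "iso_arcs g (a, b) = (?f u, ?f v)"
        unfolding pa by auto
      then have "?f a = ?f u" "?f b = ?f v" using arc by auto
      moreover have "a \<in> pverts K" "b \<in> pverts K"
        using ab K by (auto dest: pair_wf_digraph.in_arcsD1 pair_wf_digraph.in_arcsD2)
      ultimately show "(u, v) \<in> parcs K" using inj uv ab by (auto dest: inj_onD)
    qed
  qed
  then show "\<exists>f. graph_iso f K H" by blast
next
  assume "\<exists>f. graph_iso f K H"
  then obtain f where f: "graph_iso f K H" by blast
  have inj: "inj_on f (pverts K)" and im: "f ` pverts K = pverts H"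
    using f by (auto simp: graph_iso_def bij_betw_def)
  let ?g = "\<lparr> iso_verts = f, iso_arcs = map_prod f f, iso_head = snd, iso_tail = fst \<rparr>"
  have sub: "parcs K \<subseteq> pverts K \<times> pverts K"
    using K by (auto dest: pair_wf_digraph.in_arcsD1 pair_wf_digraph.in_arcsD2)
  have "inj_on (map_prod f f) (parcs K)"
    by (rule inj_on_subset[OF map_prod_inj_on[OF inj inj] sub])
  then have 1: "pre_digraph.digraph_isomorphism (with_proj K) ?g"
    using inj pair_wf_imp_wf[OF K] by (auto simp: pre_digraph.digraph_isomorphism_def)
  have "parcs H = map_prod f f ` parcs K"
  proof (intro equalityI subrelI)
    fix a b assume ab: "(a, b) \<in> parcs H"
    then have "a \<in> f ` pverts K" "b \<in> f ` pverts K"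
      unfolding im using H by (auto dest: pair_wf_digraph.in_arcsD1 pair_wf_digraph.in_arcsD2)
    then obtain u v where "u \<in> pverts K" "v \<in> pverts K" "a = f u" "b = f v" by auto
    then show "(a, b) \<in> map_prod f f ` parcs K" using f ab by (force simp: graph_iso_def)
  next
    fix a b assume "(a, b) \<in> map_prod f f ` parcs K"
    then show "(a, b) \<in> parcs H" using f sub by (auto simp: graph_iso_def)
  qed
  then have "with_proj H = app_iso ?g (with_proj K)"
    using im by (simp add: with_proj_def app_iso_def)
  with 1 show "digraph_iso (with_proj K) (with_proj H)"
    by (auto simp: digraph_iso_def)
qed

section \<open>Elementary equivalence of graphs with many copies of the same components\<close>

lemma graph_iso_inv:
  assumes "graph_iso f K H"
  shows "graph_iso (inv_into (pverts K) f) H K"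
  unfolding graph_iso_def
proof (intro conjI ballI)
  have bij: "bij_betw f (pverts K) (pverts H)" using assms by (simp add: graph_iso_def)
  then show "bij_betw (inv_into (pverts K) f) (pverts H) (pverts K)" by (rule bij_betw_inv_into)
  fix u v assume uv: "u \<in> pverts H" "v \<in> pverts H"
  let ?g = "inv_into (pverts K) f"
  have "?g u \<in> pverts K" "?g v \<in> pverts K" "f (?g u) = u" "f (?g v) = v"
    using uv bij bij_betw_inv_into_right[OF bij] bij_betw_apply[OF bij_betw_inv_into[OF bij]] by auto
  then show "(u, v) \<in> parcs H \<longleftrightarrow> (?g u, ?g v) \<in> parcs K"
    using assms by (simp add: graph_iso_def)
qed

lemma graph_iso_comp:
  assumes "graph_iso f K H" "graph_iso g H L"
  shows "graph_iso (g \<circ> f) K L"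
  using assms bij_betw_apply[of f "pverts K" "pverts H"]
  by (auto simp: graph_iso_def intro: bij_betw_trans)

lemma graph_iso_union:
  assumes f: "graph_iso f (induced G A) (induced U A')"
    and h: "graph_iso h (induced G S) (induced U S')"
    and disj: "A \<inter> S = {}" "A' \<inter> S' = {}"
    and cross: "\<And>u v. (u, v) \<in> parcs G \<Longrightarrow> u \<in> A \<Longrightarrow> v \<notin> S" "\<And>u v. (u, v) \<in> parcs G \<Longrightarrow> u \<in> S \<Longrightarrow> v \<notin> A"
      "\<And>u v. (u, v) \<in> parcs U \<Longrightarrow> u \<in> A' \<Longrightarrow> v \<notin> S'" "\<And>u v. (u, v) \<in> parcs U \<Longrightarrow> u \<in> S' \<Longrightarrow> v \<notin> A'"
  shows "graph_iso (\<lambda>u. if u \<in> A then f u else h u) (induced G (A \<union> S)) (induced U (A' \<union> S'))"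
    (is "graph_iso ?k _ _")
proof -
  have bf: "bij_betw f A A'" and bh: "bij_betw h S S'" using f h by (simp_all add: graph_iso_def)
  have kS: "?k u = h u" if "u \<in> S" for u using that disj by auto
  have "bij_betw ?k A A'" using bf by (simp cong: bij_betw_cong)
  moreover have "bij_betw ?k S S'" using bh kS by (simp cong: bij_betw_cong)
  ultimately have bij: "bij_betw ?k (A \<union> S) (A' \<union> S')" using disj(2) by (rule bij_betw_combine)
  have fA: "f u \<in> A'" if "u \<in> A" for u using bf that by (rule bij_betw_apply)
  have hS: "h u \<in> S'" if "u \<in> S" for u using bh that by (rule bij_betw_apply)
  have "(u, v) \<in> parcs G \<longleftrightarrow> (?k u, ?k v) \<in> parcs U" if uv: "u \<in> A \<union> S" "v \<in> A \<union> S" for u v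
  proof (cases "u \<in> A")
    case True
    show ?thesis
    proof (cases "v \<in> A")
      case True
      then show ?thesis using \<open>u \<in> A\<close> f fA by (auto simp: graph_iso_def)
    next
      case False
      then have "v \<in> S" using uv by simp
      then show ?thesis using \<open>u \<in> A\<close> False fA[of u] hS[of v] cross(1)[of u v] cross(3)[of "f u" "h v"]
        by auto
    qed
  next
    case False
    then have u: "u \<in> S" using uv by simp
    show ?thesis
    proof (cases "v \<in> A")
      case True
      then show ?thesis using u \<open>u \<notin> A\<close> hS[of u] fA[of v] cross(2)[of u v] cross(4)[of "h u" "f v"]
        by auto
    next
      case False
      then have "v \<in> S" using uv by simp
      then show ?thesis using u h hS False \<open>u \<notin> A\<close> by (auto simp: graph_iso_def)
    qed
  qed
  with bij bij_betw_apply[OF bij] show ?thesis by (simp add: graph_iso_def)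
qed

text \<open>Any decomposition into disjoint arc-closed parts may serve as \<open>\<C>\<close>, so
  that the copies in an infinite union can be used directly, without identifying them as components.
  The bound \<open>B\<close> is the number of rounds of the game that the decomposition
  supports.\<close>

definition rich :: "nat \<Rightarrow> 'v pair_pre_digraph \<Rightarrow> 'h pair_pre_digraph set \<Rightarrow> 'v set set \<Rightarrow> bool" where
  "rich B G \<H> \<C> \<longleftrightarrow> \<Union>\<C> = pverts G \<and> (\<forall>S\<in>\<C>. \<forall>T\<in>\<C>. S \<noteq> T \<longrightarrow> S \<inter> T = {}) \<and>
     (\<forall>S\<in>\<C>. \<forall>u v. (u, v) \<in> parcs G \<longrightarrow> (u \<in> S \<longleftrightarrow> v \<in> S)) \<and>
     (\<forall>S\<in>\<C>. \<exists>H\<in>\<H>. \<exists>g. graph_iso g H (induced G S)) \<and>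
     (\<forall>H\<in>\<H>. \<exists>\<D>\<subseteq>\<C>. finite \<D> \<and> card \<D> = B \<and> (\<forall>S\<in>\<D>. \<exists>g. graph_iso g H (induced G S)))"

text \<open>A position of the Ehrenfeucht-Fraisse game after \<open>t\<close> rounds. Whole parts
  are matched, not just the chosen vertices, so that a later choice inside a touched part is
  answered by \<open>f\<close> itself.\<close>

definition matched :: "nat \<Rightarrow> 'v pair_pre_digraph \<Rightarrow> 'v set set \<Rightarrow> 'u pair_pre_digraph \<Rightarrow> 'u set set \<Rightarrow>
    'v set set \<Rightarrow> 'u set set \<Rightarrow> ('v \<Rightarrow> 'u) \<Rightarrow> bool" where
  "matched t G \<C> U \<C>' \<A> \<A>' f \<longleftrightarrow> \<A> \<subseteq> \<C> \<and> finite \<A> \<and> card \<A> \<le> t \<and> \<A>' \<subseteq> \<C>' \<and> finite \<A>' \<and> card \<A>' \<le> t \<and>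
     graph_iso f (induced G (\<Union>\<A>)) (induced U (\<Union>\<A>'))"

lemma matched_inv:
  assumes "matched t G \<C> U \<C>' \<A> \<A>' f"
  shows "matched t U \<C>' G \<C> \<A>' \<A> (inv_into (\<Union>\<A>) f)"
  using assms graph_iso_inv[of f "induced G (\<Union>\<A>)"] by (simp add: matched_def)

text \<open>A vertex outside the matched parts lies in a fresh part of some type \<open>H\<close>.
  By pigeonhole, at most \<open>t < B\<close> parts of the other graph are in use, so one of its
  \<open>B\<close> copies of \<open>H\<close> is fresh too; the isomorphism between the two is glued
  to \<open>f\<close>, as no arcs join different parts.\<close>

lemma matched_extend:
  assumes G: "rich B G \<H> \<C>" and U: "rich B U \<H> \<C>'"
    and m: "matched t G \<C> U \<C>' \<A> \<A>' f" and t: "t < B" and v: "v \<in> pverts G"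
  obtains \<B> \<B>' h where "matched (Suc t) G \<C> U \<C>' \<B> \<B>' h" "v \<in> \<Union>\<B>" "\<Union>\<A> \<subseteq> \<Union>\<B>"
    "\<And>u. u \<in> \<Union>\<A> \<Longrightarrow> h u = f u"
proof (cases "v \<in> \<Union>\<A>")
  case True
  have "matched (Suc t) G \<C> U \<C>' \<A> \<A>' f" using m by (simp add: matched_def)
  then show ?thesis using True by (intro that) auto
next
  case False
  have \<A>: "\<A> \<subseteq> \<C>" "finite \<A>" "card \<A> \<le> t" "\<A>' \<subseteq> \<C>'" "finite \<A>'" "card \<A>' \<le> t"
    and f: "graph_iso f (induced G (\<Union>\<A>)) (induced U (\<Union>\<A>'))" using m by (simp_all add: matched_def)
  have disj: "S \<in> \<C> \<Longrightarrow> T \<in> \<C> \<Longrightarrow> S \<noteq> T \<Longrightarrow> S \<inter> T = {}"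
    and arc: "S \<in> \<C> \<Longrightarrow> (a, b) \<in> parcs G \<Longrightarrow> a \<in> S \<longleftrightarrow> b \<in> S" for S T a b
    using G unfolding rich_def by blast+
  have disj': "S \<in> \<C>' \<Longrightarrow> T \<in> \<C>' \<Longrightarrow> S \<noteq> T \<Longrightarrow> S \<inter> T = {}"
    and arc': "S \<in> \<C>' \<Longrightarrow> (a, b) \<in> parcs U \<Longrightarrow> a \<in> S \<longleftrightarrow> b \<in> S" for S T a b
    using U unfolding rich_def by blast+
  have "v \<in> \<Union>\<C>" using G v by (simp add: rich_def)
  then obtain S where S: "S \<in> \<C>" "v \<in> S" by blast
  then have "\<exists>H\<in>\<H>. \<exists>g. graph_iso g H (induced G S)" using G by (simp add: rich_def)
  then obtain H g where H: "H \<in> \<H>" and g: "graph_iso g H (induced G S)" by blast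
  have "\<exists>\<D>\<subseteq>\<C>'. finite \<D> \<and> card \<D> = B \<and> (\<forall>S\<in>\<D>. \<exists>g. graph_iso g H (induced U S))"
    using U H by (simp add: rich_def)
  then obtain \<D> where \<D>: "\<D> \<subseteq> \<C>'" "finite \<D>" "card \<D> = B"
    "\<And>S. S \<in> \<D> \<Longrightarrow> \<exists>g. graph_iso g H (induced U S)" by blast
  have "\<not> \<D> \<subseteq> \<A>'" using \<D> \<A> t card_mono[of \<A>' \<D>] by linarith
  then obtain S' where S': "S' \<in> \<D>" "S' \<notin> \<A>'" by auto
  then have "\<exists>g. graph_iso g H (induced U S')" using \<D> by blast
  then obtain g' where "graph_iso g' H (induced U S')" by blast
  then have gg: "graph_iso (g' \<circ> inv_into (pverts H) g) (induced G S) (induced U S')"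
    using graph_iso_comp[OF graph_iso_inv[OF g]] by blast
  have SA: "S \<notin> \<A>" using False S by auto
  have 1: "\<Union>\<A> \<inter> S = {}" using disj SA S(1) \<A>(1) by blast
  have 2: "\<Union>\<A>' \<inter> S' = {}" using disj' S' \<D>(1) \<A>(4) by blast
  let ?h = "\<lambda>u. if u \<in> \<Union>\<A> then f u else (g' \<circ> inv_into (pverts H) g) u"
  have "graph_iso ?h (induced G (\<Union>\<A> \<union> S)) (induced U (\<Union>\<A>' \<union> S'))"
  proof (rule graph_iso_union[OF f gg 1 2])
    show "(a, b) \<in> parcs G \<Longrightarrow> a \<in> \<Union>\<A> \<Longrightarrow> b \<notin> S" for a b using arc[OF S(1), of a b] 1 by blast
    show "(a, b) \<in> parcs G \<Longrightarrow> a \<in> S \<Longrightarrow> b \<notin> \<Union>\<A>" for a b using arc[OF S(1), of a b] 1 by blast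
    have "S' \<in> \<C>'" using S' \<D> by auto
    then show "(a, b) \<in> parcs U \<Longrightarrow> a \<in> \<Union>\<A>' \<Longrightarrow> b \<notin> S'"
      and "(a, b) \<in> parcs U \<Longrightarrow> a \<in> S' \<Longrightarrow> b \<notin> \<Union>\<A>'" for a b using arc'[of S' a b] 2 by blast+
  qed
  moreover have "\<Union>\<A> \<union> S = \<Union>(insert S \<A>)" "\<Union>\<A>' \<union> S' = \<Union>(insert S' \<A>')" by auto
  ultimately have "graph_iso ?h (induced G (\<Union>(insert S \<A>))) (induced U (\<Union>(insert S' \<A>')))" by simp
  moreover have "insert S \<A> \<subseteq> \<C>" "insert S' \<A>' \<subseteq> \<C>'" using \<A> S S' \<D> by auto
  ultimately have "matched (Suc t) G \<C> U \<C>' (insert S \<A>) (insert S' \<A>') ?h"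
    using \<A> SA S' by (simp add: matched_def)
  then show ?thesis by (rule that) (use S in auto)
qed

primrec quantifier_rank :: "fo_formula \<Rightarrow> nat" where
  "quantifier_rank (Eq x y) = 0"
| "quantifier_rank (Edge x y) = 0"
| "quantifier_rank (Neg \<phi>) = quantifier_rank \<phi>"
| "quantifier_rank (Conj \<phi> \<psi>) = max (quantifier_rank \<phi>) (quantifier_rank \<psi>)"
| "quantifier_rank (Exists x \<phi>) = Suc (quantifier_rank \<phi>)"

text \<open>Induction on the formula, where each \<open>Exists\<close> is one round. The invariant
  bounds the rounds already played plus the rounds still to come by \<open>B\<close>.\<close>

lemma sat_eq_if_matched:
  assumes G: "rich B G \<H> \<C>" and U: "rich B U \<H> \<C>'"
    and "matched t G \<C> U \<C>' \<A> \<A>' f" "t + quantifier_rank \<phi> \<le> B"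
    and "\<And>x. x \<in> free_vars \<phi> \<Longrightarrow> e x \<in> \<Union>\<A> \<and> e' x = f (e x)"
  shows "sat G e \<phi> \<longleftrightarrow> sat U e' \<phi>"
  using assms(3-5)
proof (induction \<phi> arbitrary: t \<A> \<A>' f e e')
  case (Eq x y)
  then have "bij_betw f (\<Union>\<A>) (\<Union>\<A>')" by (simp add: matched_def graph_iso_def)
  then have "inj_on f (\<Union>\<A>)" by (rule bij_betw_imp_inj_on)
  moreover have "e x \<in> \<Union>\<A>" "e y \<in> \<Union>\<A>" "e' x = f (e x)" "e' y = f (e y)" using Eq(3) by auto
  ultimately show ?case by (simp add: inj_on_eq_iff)
next
  case (Edge x y)
  have xy: "e x \<in> \<Union>\<A>" "e y \<in> \<Union>\<A>" "e' x = f (e x)" "e' y = f (e y)" using Edge(3) by auto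
  have bij: "bij_betw f (\<Union>\<A>) (\<Union>\<A>')" using Edge(1) by (simp add: matched_def graph_iso_def)
  then have "f (e x) \<in> \<Union>\<A>'" "f (e y) \<in> \<Union>\<A>'" using xy bij_betw_apply by metis+
  moreover have "\<forall>u\<in>\<Union>\<A>. \<forall>v\<in>\<Union>\<A>. (u, v) \<in> parcs (induced G (\<Union>\<A>)) \<longleftrightarrow> (f u, f v) \<in> parcs (induced U (\<Union>\<A>'))"
    using Edge(1) unfolding matched_def graph_iso_def induced_simps(1) by blast
  then have "(e x, e y) \<in> parcs (induced G (\<Union>\<A>)) \<longleftrightarrow> (f (e x), f (e y)) \<in> parcs (induced U (\<Union>\<A>'))"
    using xy(1,2) by blast
  ultimately show ?case using xy by simp
next
  case (Neg \<phi>)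
  have "sat G e \<phi> \<longleftrightarrow> sat U e' \<phi>" by (rule Neg.IH[OF Neg.prems(1)]) (use Neg.prems in auto)
  then show ?case by simp
next
  case (Conj \<phi> \<psi>)
  have "sat G e \<phi> \<longleftrightarrow> sat U e' \<phi>" by (rule Conj.IH(1)[OF Conj.prems(1)]) (use Conj.prems in auto)
  moreover have "sat G e \<psi> \<longleftrightarrow> sat U e' \<psi>" by (rule Conj.IH(2)[OF Conj.prems(1)]) (use Conj.prems in auto)
  ultimately show ?case by simp
next
  case (Exists x \<phi>)
  have t: "t < B" "Suc t + quantifier_rank \<phi> \<le> B" using Exists.prems(2) by auto
  have step: "sat G (e(x := v)) \<phi> \<longleftrightarrow> sat U (e'(x := h v)) \<phi>"
    if "matched (Suc t) G \<C> U \<C>' \<B> \<B>' h" "v \<in> \<Union>\<B>" "\<Union>\<A> \<subseteq> \<Union>\<B>" "\<And>u. u \<in> \<Union>\<A> \<Longrightarrow> h u = f u"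
    for v \<B> \<B>' h
  proof (rule Exists.IH[OF that(1) t(2)])
    show "(e(x := v)) y \<in> \<Union>\<B> \<and> (e'(x := h v)) y = h ((e(x := v)) y)" if y: "y \<in> free_vars \<phi>" for y
    proof (cases "y = x")
      case True
      then show ?thesis using \<open>v \<in> \<Union>\<B>\<close> by simp
    next
      case False
      then have "e y \<in> \<Union>\<A>" "e' y = f (e y)" using Exists.prems(3)[of y] y by auto
      then show ?thesis using False \<open>\<Union>\<A> \<subseteq> \<Union>\<B>\<close> \<open>\<And>u. u \<in> \<Union>\<A> \<Longrightarrow> h u = f u\<close>[of "e y"] by auto
    qed
  qed
  have vertsU: "\<Union>\<C>' = pverts U" and vertsG: "\<Union>\<C> = pverts G" using G U by (simp_all add: rich_def)
  have img: "h v \<in> pverts U" if "matched n G \<C> U \<C>' \<B> \<B>' h" "v \<in> \<Union>\<B>" for n \<B> \<B>' h v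
  proof -
    have "bij_betw h (\<Union>\<B>) (\<Union>\<B>')" "\<B>' \<subseteq> \<C>'" using that(1) by (simp_all add: matched_def graph_iso_def)
    then show ?thesis using that(2) vertsU bij_betw_apply by fastforce
  qed
  show ?case
  proof
    assume "sat G e (Exists x \<phi>)"
    then obtain v where v: "v \<in> pverts G" "sat G (e(x := v)) \<phi>" by auto
    obtain \<B> \<B>' h where h: "matched (Suc t) G \<C> U \<C>' \<B> \<B>' h" "v \<in> \<Union>\<B>" "\<Union>\<A> \<subseteq> \<Union>\<B>"
        "\<And>u. u \<in> \<Union>\<A> \<Longrightarrow> h u = f u"
      using matched_extend[OF G U Exists.prems(1) t(1) v(1)] by blast
    then have "sat U (e'(x := h v)) \<phi>" using step[OF h] v by simp
    then show "sat U e' (Exists x \<phi>)" using img[OF h(1,2)] by auto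
  next
    assume "sat U e' (Exists x \<phi>)"
    then obtain w where w: "w \<in> pverts U" "sat U (e'(x := w)) \<phi>" by auto
    let ?f' = "inv_into (\<Union>\<A>) f"
    obtain \<B>' \<B> h' where h': "matched (Suc t) U \<C>' G \<C> \<B>' \<B> h'" "w \<in> \<Union>\<B>'" "\<Union>\<A>' \<subseteq> \<Union>\<B>'"
        "\<And>u. u \<in> \<Union>\<A>' \<Longrightarrow> h' u = ?f' u"
      using matched_extend[OF U G matched_inv[OF Exists.prems(1)] t(1) w(1)] by blast
    \<comment> \<open>The answer to a move in \<open>U\<close> is found by playing the inverse
      position with the roles exchanged. Its inverse \<open>h\<close> again extends
      \<open>f\<close>, because \<open>h'\<close> extends the inverse of \<open>f\<close>.\<close>
    define h where "h = inv_into (\<Union>\<B>') h'"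
    have m: "matched (Suc t) G \<C> U \<C>' \<B> \<B>' h" unfolding h_def by (rule matched_inv[OF h'(1)])
    have bh': "bij_betw h' (\<Union>\<B>') (\<Union>\<B>)" using h'(1) by (simp add: matched_def graph_iso_def)
    have bf: "bij_betw f (\<Union>\<A>) (\<Union>\<A>')" using Exists.prems(1) by (simp add: matched_def graph_iso_def)
    have hh': "h (h' u) = u" if "u \<in> \<Union>\<B>'" for u
      unfolding h_def using bh' that by (rule bij_betw_inv_into_left)
    have agree: "u \<in> \<Union>\<B> \<and> h u = f u" if u: "u \<in> \<Union>\<A>" for u
    proof -
      have fu: "f u \<in> \<Union>\<A>'" using bf u by (rule bij_betw_apply)
      then have *: "h' (f u) = u" using h'(4)[OF fu] bij_betw_inv_into_left[OF bf u] by simp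
      have fuB: "f u \<in> \<Union>\<B>'" using fu h'(3) by blast
      show ?thesis using hh'[OF fuB] bij_betw_apply[OF bh' fuB] * by simp
    qed
    let ?v = "h' w"
    have v: "?v \<in> \<Union>\<B>" "h ?v = w" using bij_betw_apply[OF bh' h'(2)] hh'[OF h'(2)] by auto
    have "sat G (e(x := ?v)) \<phi>"
      using step[OF m v(1)] agree v(2) w(2) by auto
    moreover have "?v \<in> pverts G" using v(1) h'(1) vertsG unfolding matched_def by blast
    ultimately show "sat G e (Exists x \<phi>)" by auto
  qed
qed

lemma models_eq_if_rich:
  assumes "rich B G \<H> \<C>" "rich B U \<H> \<C>'" "sentence \<phi>" "quantifier_rank \<phi> \<le> B"
  shows "models G \<phi> \<longleftrightarrow> models U \<phi>"
proof -
  have "matched 0 G \<C> U \<C>' {} {} (\<lambda>_. undefined)"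
    by (simp add: matched_def graph_iso_def bij_betw_def)
  then have "sat G e \<phi> \<longleftrightarrow> sat U e' \<phi>" for e e'
    by (rule sat_eq_if_matched[OF assms(1,2)]) (use assms(3,4) in \<open>auto simp: sentence_def\<close>)
  then show ?thesis unfolding models_def by blast
qed

lemma rich_infinite_copies:
  assumes "\<And>H. H \<in> \<H> \<Longrightarrow> pair_wf_digraph H \<and> pverts H \<noteq> {}"
  shows "\<exists>\<C>. rich B (infinite_copies \<H>) \<H> \<C>"
proof -
  let ?U = "infinite_copies \<H>"
  let ?S = "\<lambda>H (m::nat). {(H', m', v). H' = H \<and> m' = m \<and> v \<in> pverts H}"
  define \<C> where "\<C> = {?S H m | H m. H \<in> \<H>}"
  have wf: "u \<in> pverts H" "v \<in> pverts H" if "H \<in> \<H>" "(u, v) \<in> parcs H" for H u v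
    using assms[OF that(1)] that(2) by (auto dest: pair_wf_digraph.in_arcsD1 pair_wf_digraph.in_arcsD2)
  have iso: "graph_iso (\<lambda>v. (H, m, v)) H (induced ?U (?S H m))" if "H \<in> \<H>" for H m
    using that by (auto simp: graph_iso_def bij_betw_def inj_on_def infinite_copies_def)
  have "rich B ?U \<H> \<C>"
    unfolding rich_def
  proof (intro conjI ballI allI impI)
    show "\<Union>\<C> = pverts ?U" by (auto simp: \<C>_def infinite_copies_def)
    show "S \<inter> T = {}" if "S \<in> \<C>" "T \<in> \<C>" "S \<noteq> T" for S T
      using that by (auto simp: \<C>_def)
    show "u \<in> S \<longleftrightarrow> v \<in> S" if "S \<in> \<C>" "(u, v) \<in> parcs ?U" for S u v
      using that by (auto simp: \<C>_def infinite_copies_def dest: wf)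
    show "\<exists>H\<in>\<H>. \<exists>g. graph_iso g H (induced ?U S)" if "S \<in> \<C>" for S
      using that iso by (auto simp: \<C>_def)
    fix H assume H: "H \<in> \<H>"
    obtain v where v: "v \<in> pverts H" using assms[OF H] by auto
    have "inj_on (?S H) {..<B}" using v by (auto simp: inj_on_def)
    then have "card (?S H ` {..<B}) = B" by (simp add: card_image)
    then show "\<exists>\<D>\<subseteq>\<C>. finite \<D> \<and> card \<D> = B \<and> (\<forall>S\<in>\<D>. \<exists>g. graph_iso g H (induced ?U S))"
      using H iso by (intro exI[of _ "?S H ` {..<B}"]) (auto simp: \<C>_def)
  qed
  then show ?thesis ..
qed

text \<open>An induced subgraph determines its vertex set, so counting components of a given type
  amounts to counting blocks.\<close>

lemma rich_pair_graph:
  assumes G: "pair_graph G" and \<H>: "\<And>H. H \<in> \<H> \<Longrightarrow> pair_graph H"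
    and types: "\<And>C. C \<in> graph_components G \<Longrightarrow> \<exists>H\<in>\<H>. digraph_iso C (with_proj H)"
    and many: "\<And>H. H \<in> \<H> \<Longrightarrow> num_components_iso G H \<ge> B"
  shows "rich B G \<H> {S. block G S}"
  unfolding rich_def
proof (intro conjI ballI allI impI)
  have iso: "digraph_iso (with_proj (induced G S)) (with_proj H) \<longleftrightarrow> (\<exists>f. graph_iso f (induced G S) H)"
    if "H \<in> \<H>" for S H
    by (rule digraph_iso_with_proj_iff[OF pair_wf_induced pair_graph_imp_pair_wf[OF \<H>[OF that]]])
  show "\<Union>{S. block G S} = pverts G"
    using block_exists[OF G] block_subset by blast
  show "S \<inter> T = {}" if "S \<in> {S. block G S}" "T \<in> {S. block G S}" "S \<noteq> T" for S T
    using that block_disjoint by blast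
  show "u \<in> S \<longleftrightarrow> v \<in> S" if "S \<in> {S. block G S}" "(u, v) \<in> parcs G" for S u v
    using that by (auto dest: block_closed)
  show "\<exists>H\<in>\<H>. \<exists>g. graph_iso g H (induced G S)" if "S \<in> {S. block G S}" for S
  proof -
    have "with_proj (induced G S) \<in> graph_components G"
      using that by (simp add: graph_components_eq[OF G])
    then show ?thesis using types iso graph_iso_inv by blast
  qed
  fix H assume H: "H \<in> \<H>"
  let ?D = "{S. block G S \<and> (\<exists>f. graph_iso f (induced G S) H)}"
  have eq: "{C \<in> graph_components G. digraph_iso C (with_proj H)} = (\<lambda>S. with_proj (induced G S)) ` ?D"
    using iso[OF H] by (auto simp: graph_components_eq[OF G])
  have "inj (\<lambda>S. with_proj (induced G S))"
    by (rule injI) (metis induced_simps(1) with_proj_simps(1))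
  then have inj: "inj_on (\<lambda>S. with_proj (induced G S)) ?D" by (rule inj_on_subset) simp
  have "B \<le> card ?D"
    using many[OF H] unfolding num_components_iso_def eq card_image[OF inj] .
  then obtain \<D> where \<D>: "\<D> \<subseteq> ?D" "card \<D> = B" "finite \<D>"
    by (rule obtain_subset_with_card_n)
  have "\<exists>g. graph_iso g H (induced G S)" if "S \<in> \<D>" for S
    using subsetD[OF \<D>(1) that] graph_iso_inv by fastforce
  with \<D> show "\<exists>\<D>\<subseteq>{S. block G S}. finite \<D> \<and> card \<D> = B \<and> (\<forall>S\<in>\<D>. \<exists>g. graph_iso g H (induced G S))"
    by (intro exI[of _ \<D>]) auto
qed

section \<open>Measurability and box probabilities\<close>

lemma measurable_torus_norm [measurable]: "torus_norm \<in> borel_measurable borel"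
proof -
  have "(\<lambda>t. torus_norm t) \<in> borel_measurable borel"
    unfolding torus_norm_attained round_def by measurable
  then show ?thesis by simp
qed

lemma torus_dist_le_iff: "torus_dist x y \<le> \<rho> \<longleftrightarrow> (\<forall>i. torus_norm (x $ i - y $ i) \<le> \<rho>)"
  unfolding torus_dist_def by (subst Max_le_iff) auto

text \<open>For fixed \<open>n\<close> there are only finitely many arc sets, each cut out by
  finitely many distance conditions. Thus an arbitrary property \<open>P\<close> of the graph is a
  finite union of events; this covers component counts and first-order truth alike.\<close>

lemma sets_torus_graph:
  fixes Y :: "nat \<Rightarrow> 'w \<Rightarrow> real ^ 'd"
  assumes [measurable]: "\<And>i. i \<in> {1..n} \<Longrightarrow> Y i \<in> borel_measurable M"
  shows "{\<omega> \<in> space M. P (torus_graph n \<rho> (\<lambda>i. Y i \<omega>))} \<in> sets M"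
proof -
  let ?E = "\<lambda>\<omega>. parcs (torus_graph n \<rho> (\<lambda>i. Y i \<omega>))"
  let ?V = "{1..n} \<times> {1..n}"
  define Q where "Q = {E \<in> Pow ?V. P \<lparr>pverts = {1..n}, parcs = E\<rparr>}"
  have sub: "?E \<omega> \<subseteq> ?V" for \<omega> by (auto simp: torus_graph_def)
  have G: "torus_graph n \<rho> (\<lambda>i. Y i \<omega>) = \<lparr>pverts = {1..n}, parcs = ?E \<omega>\<rparr>" for \<omega>
    by (simp add: torus_graph_def)
  have edge: "{\<omega> \<in> space M. (i, j) \<in> ?E \<omega>} \<in> sets M" for i j
  proof (cases "i \<in> {1..n} \<and> j \<in> {1..n} \<and> i \<noteq> j")
    case True
    then have [measurable]: "Y i \<in> borel_measurable M" "Y j \<in> borel_measurable M" by auto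
    have "(i, j) \<in> ?E \<omega> \<longleftrightarrow> (\<forall>c. torus_norm (Y i \<omega> $ c - Y j \<omega> $ c) \<le> \<rho>)" for \<omega>
      using True by (simp add: torus_graph_def torus_dist_le_iff)
    then have "{\<omega> \<in> space M. (i, j) \<in> ?E \<omega>} =
        {\<omega> \<in> space M. \<forall>c\<in>UNIV. torus_norm (Y i \<omega> $ c - Y j \<omega> $ c) \<le> \<rho>}" by simp
    also have "\<dots> \<in> sets M" 
    proof (rule sets.sets_Collect_finite_All)
      have [measurable]: "(\<lambda>\<omega>. Y i \<omega> $ c) \<in> borel_measurable M" "(\<lambda>\<omega>. Y j \<omega> $ c) \<in> borel_measurable M" for c
        by (rule measurable_compose[OF _ borel_measurable_nth], fact)+
      show "{\<omega> \<in> space M. torus_norm (Y i \<omega> $ c - Y j \<omega> $ c) \<le> \<rho>} \<in> sets M" for c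
        by measurable
    qed simp
    finally show ?thesis .
  next
    case False
    then have "{\<omega> \<in> space M. (i, j) \<in> ?E \<omega>} = {}" by (auto simp: torus_graph_def)
    then show ?thesis by (simp only: sets.empty_sets)
  qed
  have eqE: "{\<omega> \<in> space M. ?E \<omega> = E} \<in> sets M" if "E \<subseteq> ?V" for E
  proof -
    have "{\<omega> \<in> space M. ?E \<omega> = E} = {\<omega> \<in> space M. \<forall>e\<in>?V. e \<in> ?E \<omega> \<longleftrightarrow> e \<in> E}"
      using sub that by blast
    also have "\<dots> \<in> sets M"
    proof (intro sets.sets_Collect_finite_All)
      show "{\<omega> \<in> space M. e \<in> ?E \<omega> \<longleftrightarrow> e \<in> E} \<in> sets M" for e
      proof (cases "e \<in> E")
        case True
        then show ?thesis using edge[of "fst e" "snd e"] by simp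
      next
        case False
        then show ?thesis using edge[of "fst e" "snd e"] by (simp add: sets.sets_Collect_neg)
      qed
    qed auto
    finally show ?thesis .
  qed
  have "{\<omega> \<in> space M. P (torus_graph n \<rho> (\<lambda>i. Y i \<omega>))} = (\<Union>E\<in>Q. {\<omega> \<in> space M. ?E \<omega> = E})"
    unfolding Q_def using sub by (subst G) auto
  also have "\<dots> \<in> sets M"
    by (rule sets.finite_UN) (auto simp: Q_def intro!: eqE)
  finally show ?thesis .
qed

section \<open>Calculus of events that hold with high probability\<close>

lemma prob_seq_le_1: "prob_space (M n) \<Longrightarrow> prob_seq M P n \<le> 1"
  by (simp add: prob_seq_def prob_space.prob_le_1)

lemma prob_seq_not:
  assumes "prob_space (M n)" "{\<omega> \<in> space (M n). P n \<omega>} \<in> sets (M n)"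
  shows "prob_seq M (\<lambda>n \<omega>. \<not> P n \<omega>) n = 1 - prob_seq M P n"
  unfolding prob_seq_def using prob_space.prob_neg[OF assms] .

lemma whpI_bad:
  assumes M: "\<And>n. prob_space (M n)" and meas: "\<And>n. {\<omega> \<in> space (M n). P n \<omega>} \<in> sets (M n)"
    and bound: "\<forall>\<^sub>F n in sequentially. prob_seq M (\<lambda>n \<omega>. \<not> P n \<omega>) n \<le> b n"
    and b: "b \<longlonglongrightarrow> 0"
  shows "whp M P"
  unfolding whp_def
proof (rule tendsto_sandwich)
  show "\<forall>\<^sub>F n in sequentially. 1 - b n \<le> prob_seq M P n"
    using bound
  proof eventually_elim
    case (elim n)
    then show ?case using prob_seq_not[of M n P, OF M meas] by linarith
  qed
  show "\<forall>\<^sub>F n in sequentially. prob_seq M P n \<le> 1"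
    by (simp add: prob_seq_le_1 M)
  show "(\<lambda>n. 1 - b n) \<longlonglongrightarrow> 1" using tendsto_diff[OF tendsto_const b, of 1] by simp
qed simp

lemma whp_mono:
  assumes M: "\<And>n. prob_space (M n)" and meas: "\<And>n. {\<omega> \<in> space (M n). Q n \<omega>} \<in> sets (M n)"
    and "whp M P" and "\<forall>\<^sub>F n in sequentially. \<forall>\<omega>\<in>space (M n). P n \<omega> \<longrightarrow> Q n \<omega>"
  shows "whp M Q"
  unfolding whp_def
proof (rule tendsto_sandwich)
  show "\<forall>\<^sub>F n in sequentially. prob_seq M P n \<le> prob_seq M Q n"
    using assms(4)
  proof eventually_elim
    case (elim n)
    interpret prob_space "M n" by (rule M)
    show ?case unfolding prob_seq_def
      by (rule finite_measure_mono) (use elim meas in auto)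
  qed
  show "\<forall>\<^sub>F n in sequentially. prob_seq M Q n \<le> 1"
    by (simp add: prob_seq_le_1 M)
qed (use assms(3) in \<open>simp_all add: whp_def\<close>)

lemma whp_conj:
  assumes M: "\<And>n. prob_space (M n)"
    and P: "\<And>n. {\<omega> \<in> space (M n). P n \<omega>} \<in> sets (M n)" "whp M P"
    and Q: "\<And>n. {\<omega> \<in> space (M n). Q n \<omega>} \<in> sets (M n)" "whp M Q"
  shows "whp M (\<lambda>n \<omega>. P n \<omega> \<and> Q n \<omega>)"
proof (rule whpI_bad)
  show "{\<omega> \<in> space (M n). P n \<omega> \<and> Q n \<omega>} \<in> sets (M n)" for n
  proof -
    have "{\<omega> \<in> space (M n). P n \<omega> \<and> Q n \<omega>} =
        {\<omega> \<in> space (M n). P n \<omega>} \<inter> {\<omega> \<in> space (M n). Q n \<omega>}" by auto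
    then show ?thesis using P(1)[of n] Q(1)[of n] by auto
  qed
  show "(\<lambda>n. (1 - prob_seq M P n) + (1 - prob_seq M Q n)) \<longlonglongrightarrow> 0"
  proof -
    have "(\<lambda>n. (1 - prob_seq M P n) + (1 - prob_seq M Q n)) \<longlonglongrightarrow> (1 - 1) + (1 - 1)"
      using P(2) Q(2) unfolding whp_def by (intro tendsto_intros)
    then show ?thesis by simp
  qed
  show "\<forall>\<^sub>F n in sequentially. prob_seq M (\<lambda>n \<omega>. \<not> (P n \<omega> \<and> Q n \<omega>)) n
      \<le> (1 - prob_seq M P n) + (1 - prob_seq M Q n)"
  proof (intro always_eventually allI)
    fix n
    interpret prob_space "M n" by (rule M)
    have [measurable]: "{\<omega> \<in> space (M n). \<not> P n \<omega>} \<in> sets (M n)" "{\<omega> \<in> space (M n). \<not> Q n \<omega>} \<in> sets (M n)"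
      using P(1) Q(1) by (auto intro: sets.sets_Collect_neg)
    have "prob_seq M (\<lambda>n \<omega>. \<not> (P n \<omega> \<and> Q n \<omega>)) n
        \<le> prob_seq M (\<lambda>n \<omega>. \<not> P n \<omega>) n + prob_seq M (\<lambda>n \<omega>. \<not> Q n \<omega>) n"
      unfolding prob_seq_def
      by (rule order_trans[OF finite_measure_mono measure_Un_le]) auto
    then show "prob_seq M (\<lambda>n \<omega>. \<not> (P n \<omega> \<and> Q n \<omega>)) n \<le> (1 - prob_seq M P n) + (1 - prob_seq M Q n)"
      using prob_seq_not[of M n P, OF M P(1)] prob_seq_not[of M n Q, OF M Q(1)] by linarith
  qed
qed (rule M)

lemma whp_finite_all:
  assumes M: "\<And>n. prob_space (M n)" and "finite A"
    and "\<And>a n. a \<in> A \<Longrightarrow> {\<omega> \<in> space (M n). P a n \<omega>} \<in> sets (M n)" "\<And>a. a \<in> A \<Longrightarrow> whp M (P a)"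
  shows "whp M (\<lambda>n \<omega>. \<forall>a\<in>A. P a n \<omega>)"
  using \<open>finite A\<close> assms(3,4)
proof (induction A)
  case empty
  show ?case unfolding whp_def prob_seq_def by (simp add: prob_space.prob_space M)
next
  case (insert a A)
  have "whp M (\<lambda>n \<omega>. P a n \<omega> \<and> (\<forall>a\<in>A. P a n \<omega>))"
    using insert by (intro whp_conj M sets.sets_Collect_finite_All) auto
  then show ?case by simp
qed

section \<open>Half-open boxes and the uniform law on the torus\<close>

definition hbox :: "real ^ 'd \<Rightarrow> real ^ 'd \<Rightarrow> (real ^ 'd) set" where
  "hbox a b = {x. \<forall>i. a $ i \<le> x $ i \<and> x $ i < b $ i}"

lemma sets_hbox [measurable]: "hbox a b \<in> sets borel"
  unfolding hbox_def by measurable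

text \<open>Squeezed between \<open>box\<close> and \<open>cbox\<close>, which have equal volume.
  Half-open boxes are used because neighbouring cells and tiles are then disjoint and the unit cube
  is itself of this form.\<close>

lemma measure_hbox:
  fixes a b :: "real ^ 'd"
  assumes "\<And>i. a $ i \<le> b $ i"
  shows "measure lborel (hbox a b) = (\<Prod>i\<in>UNIV. b $ i - a $ i)"
proof -
  have sub: "box a b \<subseteq> hbox a b" "hbox a b \<subseteq> cbox a b"
    by (auto simp: hbox_def box_def cbox_def Basis_vec_def inner_axis less_imp_le)
  have ne: "a \<bullet> e \<le> b \<bullet> e" if "e \<in> Basis" for e
    using that assms by (auto simp: Basis_vec_def inner_axis)
  have fin: "emeasure lborel (cbox a b) < \<infinity>" by (simp add: emeasure_lborel_cbox_eq)
  have fin': "hbox a b \<in> fmeasurable lborel" "cbox a b \<in> fmeasurable lborel"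
    using fin order.strict_trans1[OF emeasure_mono[OF sub(2)] fin] by (auto intro: fmeasurableI)
  have "measure lborel (box a b) \<le> measure lborel (hbox a b)"
    using sub fin' by (intro measure_mono_fmeasurable) auto
  moreover have "measure lborel (hbox a b) \<le> measure lborel (cbox a b)"
    using sub fin' by (intro measure_mono_fmeasurable) auto
  moreover have "measure lborel (box a b) = (\<Prod>e\<in>Basis. (b - a) \<bullet> e)"
    "measure lborel (cbox a b) = (\<Prod>e\<in>Basis. (b - a) \<bullet> e)"
    using ne by (simp_all add: measure_lborel_box measure_lborel_cbox)
  moreover have "(\<Prod>e\<in>Basis. (b - a) \<bullet> e) = (\<Prod>i\<in>UNIV. b $ i - a $ i)"
  proof -
    have B: "(Basis :: (real ^ 'd) set) = (\<lambda>i. axis i 1) ` UNIV" by (auto simp: Basis_vec_def)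
    have "inj (\<lambda>i::'d. axis i (1::real))" by (auto simp: inj_on_def axis_eq_axis)
    then show ?thesis unfolding B by (subst prod.reindex) (simp_all add: inner_axis)
  qed
  ultimately show ?thesis by linarith
qed

abbreviation unit_cube :: "(real ^ 'd) set" where "unit_cube \<equiv> hbox 0 1"

lemma emeasure_unit_cube: "emeasure lborel (unit_cube :: (real ^ 'd) set) = 1"
proof -
  have "measure lborel (unit_cube :: (real ^ 'd) set) = 1" by (subst measure_hbox) auto
  then show ?thesis
    by (metis emeasure_eq_ennreal_measure ennreal_1 measure_zero_top zero_neq_one)
qed

lemma uniform_torus_eq: "uniform_torus = uniform_measure lborel unit_cube"
  by (simp add: uniform_torus_def hbox_def)

lemma prob_space_uniform_torus: "prob_space (uniform_torus :: (real ^ 'd) measure)"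
  unfolding uniform_torus_eq by (rule prob_space_uniform_measure) (simp_all add: emeasure_unit_cube)

lemma measure_uniform_torus:
  fixes A :: "(real ^ 'd) set"
  assumes "A \<in> sets borel"
  shows "measure uniform_torus A = measure lborel (unit_cube \<inter> A)"
  using assms unfolding uniform_torus_eq
  by (subst measure_uniform_measure) (simp_all add: emeasure_unit_cube measure_def)

lemma hbox_subset_unit_cube:
  "(\<And>i. 0 \<le> a $ i) \<Longrightarrow> (\<And>i. b $ i \<le> 1) \<Longrightarrow> hbox a b \<subseteq> unit_cube"
  unfolding hbox_def by (auto intro: order_trans order.strict_trans2)

lemma measure_uniform_torus_hbox:
  fixes a b :: "real ^ 'd"
  assumes "\<And>i. 0 \<le> a $ i" "\<And>i. b $ i \<le> 1" "\<And>i. a $ i \<le> b $ i"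
  shows "measure uniform_torus (hbox a b) = (\<Prod>i\<in>UNIV. b $ i - a $ i)"
proof -
  have "unit_cube \<inter> hbox a b = hbox a b" using hbox_subset_unit_cube[OF assms(1,2)] by blast
  then show ?thesis by (simp add: measure_uniform_torus measure_hbox assms)
qed

lemma measure_uniform_torus_unit_cube: "measure uniform_torus (unit_cube :: (real ^ 'd) set) = 1"
  by (subst measure_uniform_torus_hbox) auto

lemma (in prob_space) prob_indep_all:
  fixes Y :: "'i \<Rightarrow> 'a \<Rightarrow> real ^ 'd"
  assumes indep: "indep_vars (\<lambda>_. borel) Y I" and J: "J \<subseteq> I" "finite J"
    and uniform: "\<And>i. i \<in> J \<Longrightarrow> distr M borel (Y i) = uniform_torus"
    and F: "\<And>i. i \<in> J \<Longrightarrow> F i \<in> sets borel"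
  shows "prob {\<omega> \<in> space M. \<forall>i\<in>J. Y i \<omega> \<in> F i} = (\<Prod>i\<in>J. measure uniform_torus (F i))"
    and "{\<omega> \<in> space M. \<forall>i\<in>J. Y i \<omega> \<in> F i} \<in> events"
proof -
  have rv: "Y i \<in> borel_measurable M" if "i \<in> J" for i
    using indep J that by (auto simp: indep_vars_def)
  show "{\<omega> \<in> space M. \<forall>i\<in>J. Y i \<omega> \<in> F i} \<in> events"
  proof (intro sets.sets_Collect_finite_All)
    show "{\<omega> \<in> space M. Y i \<omega> \<in> F i} \<in> events" if "i \<in> J" for i
      using measurable_sets[OF rv[OF that] F[OF that]] by (simp add: vimage_def Int_def conj_commute)
  qed (use J in auto)
  show "prob {\<omega> \<in> space M. \<forall>i\<in>J. Y i \<omega> \<in> F i} = (\<Prod>i\<in>J. measure uniform_torus (F i))"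
  proof (cases "J = {}")
    case True
    then show ?thesis by (simp add: prob_space)
  next
    case False
    have "prob {\<omega> \<in> space M. \<forall>i\<in>J. Y i \<omega> \<in> F i} = prob (\<Inter>i\<in>J. Y i -` F i \<inter> space M)"
      using False by (intro arg_cong[where f = prob]) auto
    also have "\<dots> = (\<Prod>i\<in>J. prob (Y i -` F i \<inter> space M))"
      using indep False J F by (intro indep_varsD) auto
    also have "\<dots> = (\<Prod>i\<in>J. measure uniform_torus (F i))"
    proof (rule prod.cong[OF refl])
      fix i assume i: "i \<in> J"
      show "prob (Y i -` F i \<inter> space M) = measure uniform_torus (F i)"
        using measure_distr[OF rv[OF i] F[OF i]] uniform[OF i] by simp
    qed
    finally show ?thesis .
  qed
qed

section \<open>Clusters on the torus\<close>

lemma torus_norm_le: "torus_norm t \<le> \<bar>t - of_int m\<bar>"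
  using round_diff_minimal[of t m] by (simp add: torus_norm_attained)

lemma torus_norm_triangle: "torus_norm (s + t) \<le> torus_norm s + torus_norm t"
  using torus_norm_le[of "s + t" "round s + round t"] by (simp add: torus_norm_attained)

lemma torus_norm_le_dist: "torus_norm (x $ i - y $ i) \<le> torus_dist x y"
  using torus_dist_le_iff by blast

lemma torus_dist_triangle: "torus_dist x z \<le> torus_dist x y + torus_dist y z"
  unfolding torus_dist_le_iff[of x z]
proof
  fix i
  show "torus_norm (x $ i - z $ i) \<le> torus_dist x y + torus_dist y z"
    using torus_norm_triangle[of "x $ i - y $ i" "y $ i - z $ i"]
      torus_norm_le_dist[of x i y] torus_norm_le_dist[of y i z] by simp
qed

lemma torus_dist_refl: "torus_dist x x \<le> 0"
  using torus_norm_le[of 0 0] by (simp add: torus_dist_le_iff)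

lemma torus_graph_arc_iff:
  "(u, v) \<in> parcs (torus_graph n \<rho> x) \<longleftrightarrow>
    u \<in> {1..n} \<and> v \<in> {1..n} \<and> u \<noteq> v \<and> torus_dist (x u) (x v) \<le> \<rho>"
  by (simp add: torus_graph_def)

lemma pverts_torus_graph [simp]: "pverts (torus_graph n \<rho> x) = {1..n}"
  by (simp add: torus_graph_def)

text \<open>The block is explored from \<open>v\<close> along arcs leaving the current set, each
  adding at most \<open>\<rho>\<close> to the distance. With \<open>j = k\<close> this extracts
  \<open>k + 1\<close> clustered points from a component that is too large; with
  \<open>j = card S - 1\<close> it bounds all distances from \<open>v\<close> in a
  component.\<close>

lemma block_enumeration:
  assumes S: "block (torus_graph n \<rho> x) S" and v: "v \<in> S" and "j < card S" and \<rho>: "0 \<le> \<rho>"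
  shows "\<exists>T. inj_on T {..j} \<and> T ` {..j} \<subseteq> S \<and> T 0 = v \<and>
    (\<forall>i\<le>j. torus_dist (x v) (x (T i)) \<le> real j * \<rho>)"
  using \<open>j < card S\<close>
proof (induction j)
  case 0
  show ?case using v torus_dist_refl[of "x v"] by (intro exI[of _ "\<lambda>_. v"]) auto
next
  case (Suc j)
  then obtain T where T: "inj_on T {..j}" "T ` {..j} \<subseteq> S" "T 0 = v"
    "\<And>i. i \<le> j \<Longrightarrow> torus_dist (x v) (x (T i)) \<le> real j * \<rho>" by auto
  have "card (T ` {..j}) = Suc j" using T(1) by (simp add: card_image)
  then have "T ` {..j} \<subset> S" using T(2) Suc.prems by auto
  then obtain u w where uw: "u \<in> T ` {..j}" "w \<in> S" "w \<notin> T ` {..j}"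
    "(u, w) \<in> parcs (torus_graph n \<rho> x)"
    using block_cut[OF S, of "T ` {..j}"] by blast
  then obtain i where i: "i \<le> j" "u = T i" by auto
  let ?T = "T(Suc j := w)"
  have "torus_dist (x v) (x w) \<le> torus_dist (x v) (x u) + torus_dist (x u) (x w)"
    by (rule torus_dist_triangle)
  also have "\<dots> \<le> real j * \<rho> + \<rho>"
    using T(4)[OF i(1)] i(2) uw(4) by (intro add_mono) (auto simp: torus_graph_arc_iff)
  finally have w: "torus_dist (x v) (x w) \<le> real (Suc j) * \<rho>" by (simp add: algebra_simps)
  have ext: "{..Suc j} = insert (Suc j) {..j}" by auto
  have im: "?T ` {..j} = T ` {..j}" by (rule image_cong) auto
  have "inj_on ?T {..j}" using T(1) by (subst inj_on_cong[of _ _ T]) auto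
  then have "inj_on ?T {..Suc j}" unfolding ext using im uw(3) by auto
  moreover have "?T ` {..Suc j} \<subseteq> S" unfolding ext image_insert im using uw T by auto
  moreover have "torus_dist (x v) (x (?T i)) \<le> real (Suc j) * \<rho>" if "i \<le> Suc j" for i
  proof (cases "i = Suc j")
    case True
    then show ?thesis using w by simp
  next
    case False
    then have "torus_dist (x v) (x (T i)) \<le> real j * \<rho>" using T(4) that by simp
    also have "\<dots> \<le> real (Suc j) * \<rho>" using \<rho> by (intro mult_right_mono) auto
    finally show ?thesis using False by simp
  qed
  moreover have "?T 0 = v" using T(3) by simp
  ultimately show ?case by blast
qed

section \<open>The grid of cells and a union bound for clusters\<close>

definition grid_cell :: "nat \<Rightarrow> ('d \<Rightarrow> int) \<Rightarrow> (real ^ 'd) set" where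
  "grid_cell L c = hbox (\<chi> i. c i / L) (\<chi> i. (c i + 1) / L)"

lemma mem_grid_cell:
  assumes "L > 0"
  shows "x \<in> grid_cell L c \<longleftrightarrow> (\<forall>i. \<lfloor>L * x $ i\<rfloor> = c i)"
proof -
  have "\<lfloor>L * t\<rfloor> = a \<longleftrightarrow> a / L \<le> t \<and> t < (a + 1) / L" for t :: real and a :: int
    using assms by (auto simp: floor_eq_iff field_simps)
  then show ?thesis by (simp add: grid_cell_def hbox_def)
qed

lemma measure_grid_cell:
  fixes c :: "'d::finite \<Rightarrow> int"
  assumes L: "L > 0" and c: "\<And>i. c i \<in> {0..<int L}"
  shows "measure uniform_torus (grid_cell L c) = (1 / L) ^ CARD('d)"
proof -
  have "0 \<le> c i / L" "(c i + 1) / L \<le> 1" "c i / L \<le> (c i + 1) / L" for i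
    using c[of i] L by (auto simp: field_simps)
  then have "measure uniform_torus (grid_cell L c) = (\<Prod>i\<in>UNIV. (c i + 1) / L - c i / L)"
    unfolding grid_cell_def by (subst measure_uniform_torus_hbox) auto
  also have "\<dots> = (\<Prod>i::'d\<in>UNIV. 1 / L)"
    by (rule prod.cong) (auto simp: add_divide_distrib)
  finally show ?thesis by simp
qed

text \<open>After multiplication by \<open>L\<close> the two points differ by at most 1 up to a
  multiple of \<open>L\<close>, so their floors differ by less than 2 up to the same multiple. This
  yields three candidates per coordinate; the remainder modulo \<open>L\<close> is the
  wrap-around.\<close>

lemma grid_neighbour:
  fixes s t :: real
  assumes L: "L > 0" and t: "0 \<le> t" "t < 1" and st: "torus_norm (s - t) \<le> 1 / L"
  shows "\<exists>\<delta>\<in>{-1, 0, 1}. \<lfloor>L * t\<rfloor> = (\<lfloor>L * s\<rfloor> + \<delta>) mod int L"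
proof -
  define m where "m = round (s - t)"
  have "\<bar>s - t - m\<bar> \<le> 1 / L" using st by (simp add: torus_norm_attained m_def)
  then have "L * \<bar>s - t - m\<bar> \<le> 1" using L by (simp add: field_simps)
  then have "\<bar>L * (s - t - m)\<bar> \<le> 1" by (simp add: abs_mult)
  then have bd: "\<bar>L * s - L * t - real_of_int (int L * m)\<bar> \<le> 1" by (simp add: algebra_simps)
  define \<delta> where "\<delta> = \<lfloor>L * t\<rfloor> + int L * m - \<lfloor>L * s\<rfloor>"
  have "real_of_int \<delta> < 2" "- 2 < real_of_int \<delta>"
    unfolding \<delta>_def of_int_diff of_int_add using bd by linarith+
  then have \<delta>: "\<delta> \<in> {-1, 0, 1}" by auto
  have "0 \<le> \<lfloor>L * t\<rfloor>" "\<lfloor>L * t\<rfloor> < int L" using t L by (auto simp: floor_less_iff)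
  then have "\<lfloor>L * t\<rfloor> = \<lfloor>L * t\<rfloor> mod int L" by simp
  also have "\<dots> = (\<lfloor>L * t\<rfloor> + int L * m) mod int L" by simp
  also have "\<lfloor>L * t\<rfloor> + int L * m = \<lfloor>L * s\<rfloor> + \<delta>" by (simp add: \<delta>_def)
  finally show ?thesis using \<delta> by blast
qed

text \<open>
  Discretizing the torus into \<open>L\<^sup>D\<close> cells turns closeness to a random centre, which would need
  conditioning, into a union of product events: the centre lies in some cell and
  every other point in one of its \<open>3\<^sup>D\<close> neighbours.
\<close>

lemma (in prob_space) prob_cluster_le:
  fixes Y :: "nat \<Rightarrow> 'a \<Rightarrow> real ^ 'd"
  assumes indep: "indep_vars (\<lambda>_. borel) Y {1..n}"
    and uniform: "\<And>i. i \<in> {1..n} \<Longrightarrow> distr M borel (Y i) = uniform_torus"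
    and L: "L > 0"
  obtains A where "A \<in> events" "prob A \<le> real n ^ (k + 1) * (3 / real L) ^ (CARD('d) * k)"
    "{\<omega> \<in> space M. \<exists>T. inj_on T {..k} \<and> T ` {..k} \<subseteq> {1..n} \<and>
        (\<forall>j\<le>k. torus_dist (Y (T 0) \<omega>) (Y (T j) \<omega>) \<le> 1 / L)} \<subseteq> A"
proof -
  let ?cells = "PiE UNIV (\<lambda>_::'d. {0..<int L})"
  define shifts where "shifts = PiE {1..k} (\<lambda>_. PiE UNIV (\<lambda>_::'d. {-1, 0, 1::int}))"
  define Ts where "Ts = {T \<in> {..k} \<rightarrow>\<^sub>E {1..n}. inj_on T {..k}}"
  define C where "C c \<Delta> j = (if j = 0 then c else (\<lambda>i. (c i + \<Delta> j i) mod int L))"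
    for c and \<Delta> :: "nat \<Rightarrow> 'd \<Rightarrow> int" and j :: nat
  define E where "E = (\<lambda>(T, c, \<Delta>). {\<omega> \<in> space M. \<forall>j\<in>{..k}. Y (T j) \<omega> \<in> grid_cell L (C c \<Delta> j)})"
  \<comment> \<open>The points lie in the unit cube only almost surely. These null events collect
    the outcomes for which the floor of a coordinate may not be a legitimate cell index.\<close>
  define N where "N i = {\<omega> \<in> space M. \<forall>j\<in>{i}. Y j \<omega> \<in> - unit_cube}" for i
  have cells: "C c \<Delta> j i \<in> {0..<int L}" if "c \<in> ?cells" for c \<Delta> j i
    using that L by (auto simp: C_def PiE_iff)
  have sets_cell: "grid_cell L c \<in> sets borel" for c :: "'d \<Rightarrow> int"
    by (simp add: grid_cell_def sets_hbox)
  have E: "E (T, c, \<Delta>) \<in> events \<and> prob (E (T, c, \<Delta>)) = (1 / L) ^ (CARD('d) * (k + 1))"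
    if T: "T \<in> Ts" and c: "c \<in> ?cells" for T c \<Delta>
  proof -
    have inj: "inj_on T {..k}" and sub: "T ` {..k} \<subseteq> {1..n}" using T by (auto simp: Ts_def)
    define T' where "T' = inv_into {..k} T"
    have T': "T' (T j) = j" if "j \<le> k" for j using inj that by (simp add: T'_def)
    have eq: "E (T, c, \<Delta>) = {\<omega> \<in> space M. \<forall>i\<in>T ` {..k}. Y i \<omega> \<in> grid_cell L (C c \<Delta> (T' i))}"
      unfolding E_def using T' by auto
    note p = prob_indep_all[OF indep sub _ uniform sets_cell, of "\<lambda>i. C c \<Delta> (T' i)"]
    have "prob (E (T, c, \<Delta>)) = (\<Prod>i\<in>T ` {..k}. measure uniform_torus (grid_cell L (C c \<Delta> (T' i))))"
      unfolding eq using sub by (intro p) auto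
    also have "\<dots> = (\<Prod>i\<in>T ` {..k}. (1 / L) ^ CARD('d))"
      by (intro prod.cong measure_grid_cell[OF L] cells[OF c]) auto
    also have "\<dots> = (1 / L) ^ (CARD('d) * (k + 1))"
      using inj by (simp only: prod_constant card_image card_atMost power_mult) simp
    finally have "prob (E (T, c, \<Delta>)) = (1 / L) ^ (CARD('d) * (k + 1))" .
    moreover have "E (T, c, \<Delta>) \<in> events"
      unfolding eq by (rule p(2)) (use sub in auto)
    ultimately show ?thesis by blast
  qed
  have N: "N i \<in> events \<and> prob (N i) = 0" if "i \<in> {1..n}" for i
  proof -
    interpret U: prob_space "uniform_torus :: (real ^ 'd) measure" by (rule prob_space_uniform_torus)
    have sp: "space uniform_torus = (UNIV :: (real ^ 'd) set)" and st: "sets uniform_torus = sets (borel :: (real^'d) measure)"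
      by (simp_all add: uniform_torus_def)
    have "measure uniform_torus (- unit_cube :: (real ^ 'd) set) = 1 - 1"
      using U.prob_compl[of unit_cube] by (simp add: sp st sets_hbox measure_uniform_torus_unit_cube Compl_eq_Diff_UNIV)
    moreover have "{i} \<subseteq> {1..n}" using that by simp
    ultimately show ?thesis
      unfolding N_def using prob_indep_all[OF indep _ _ uniform, of "{i}" "\<lambda>_. - unit_cube"]
      by (simp add: sets_hbox borel_comp)
  qed
  define J where "J = Ts \<times> ?cells \<times> shifts"
  have fin: "finite ?cells" "finite shifts" "finite Ts" unfolding shifts_def Ts_def
    by (auto intro!: finite_PiE)
  have finJ: "finite J" using fin by (simp add: J_def)
  have cardT: "card Ts \<le> n ^ (k + 1)"
  proof -
    have "card Ts \<le> card ({..k} \<rightarrow>\<^sub>E {1..n})"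
      unfolding Ts_def by (intro card_mono finite_PiE) auto
    then show ?thesis by (simp add: card_PiE)
  qed
  have cardT': "real (card Ts) \<le> real n ^ (k + 1)"
    using cardT by (metis of_nat_le_iff of_nat_power)
  have cardJ: "card J = card Ts * (L ^ CARD('d) * (3 ^ CARD('d)) ^ k)"
    unfolding J_def shifts_def by (simp add: card_cartesian_product card_PiE numeral_3_eq_3)
  let ?A = "(\<Union>i\<in>{1..n}. N i) \<union> (\<Union>p\<in>J. E p)"
  have EJ: "E p \<in> events" "prob (E p) = (1 / L) ^ (CARD('d) * (k + 1))" if "p \<in> J" for p
    using E that by (auto simp: J_def)
  show thesis
  proof
    have 1: "(\<Union>i\<in>{1..n}. N i) \<in> events" "(\<Union>p\<in>J. E p) \<in> events"
      using N EJ finJ by (auto intro!: sets.finite_UN)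
    then show "?A \<in> events" by (rule sets.Un)
    have "prob ?A \<le> prob (\<Union>i\<in>{1..n}. N i) + prob (\<Union>p\<in>J. E p)"
      by (rule measure_Un_le[OF 1])
    also have "prob (\<Union>i\<in>{1..n}. N i) \<le> (\<Sum>i\<in>{1..n}. prob (N i))"
      using N by (intro measure_UNION_le) auto
    also have "\<dots> = 0" using N by simp
    also have "prob (\<Union>p\<in>J. E p) \<le> (\<Sum>p\<in>J. prob (E p))"
      using EJ finJ by (intro measure_UNION_le) auto
    also have "\<dots> = real (card J) * (1 / L) ^ (CARD('d) * (k + 1))" using EJ by simp
    \<comment> \<open>The \<open>L ^ CARD('d)\<close> choices of the cell of the centre cancel the
      probability of one of the \<open>k + 1\<close> prescribed cells. Each of the other
      \<open>k\<close> points keeps a factor \<open>(3 / L) ^ CARD('d)\<close>.\<close>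
    also have "\<dots> = real (card Ts) * ((3 ^ CARD('d)) ^ k * ((real L ^ CARD('d)) * (1 / L) ^ CARD('d)) * (1 / L) ^ (CARD('d) * k))"
      unfolding cardJ by (simp add: power_add)
    also have "(real L ^ CARD('d)) * (1 / L) ^ CARD('d) = 1"
      using L by (simp flip: power_mult_distrib)
    also have "(3 ^ CARD('d)) ^ k * 1 * (1 / real L) ^ (CARD('d) * k) = (3 / real L) ^ (CARD('d) * k)"
      by (simp add: power_divide flip: power_mult)
    also have "real (card Ts) * (3 / real L) ^ (CARD('d) * k) \<le> real n ^ (k + 1) * (3 / real L) ^ (CARD('d) * k)"
      by (intro mult_right_mono cardT') simp
    finally show "prob ?A \<le> real n ^ (k + 1) * (3 / real L) ^ (CARD('d) * k)" by simp
    show "{\<omega> \<in> space M. \<exists>T. inj_on T {..k} \<and> T ` {..k} \<subseteq> {1..n} \<and>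
        (\<forall>j\<le>k. torus_dist (Y (T 0) \<omega>) (Y (T j) \<omega>) \<le> 1 / L)} \<subseteq> ?A"
    proof clarify
      fix \<omega> T assume \<omega>: "\<omega> \<in> space M" and no: "\<omega> \<notin> (\<Union>p\<in>J. E p)"
        and T0: "inj_on T {..k}" "T ` {..k} \<subseteq> {1..n}"
        and dist: "\<forall>j\<le>k. torus_dist (Y (T 0) \<omega>) (Y (T j) \<omega>) \<le> 1 / L"
      show "\<omega> \<in> (\<Union>i\<in>{1..n}. N i)"
      proof (rule ccontr)
        assume no': "\<omega> \<notin> (\<Union>i\<in>{1..n}. N i)"
        have cube: "Y (T j) \<omega> \<in> unit_cube" if "j \<le> k" for j
        proof -
          have "T j \<in> {1..n}" using T0(2) that by auto
          then show ?thesis using no' \<omega> by (auto simp: N_def)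
        qed
        define c where "c i = \<lfloor>L * Y (T 0) \<omega> $ i\<rfloor>" for i
        have c: "c \<in> ?cells"
          using cube[of 0] L by (auto simp: c_def hbox_def floor_less_iff)
        have "\<exists>\<delta>\<in>{-1, 0, 1}. \<lfloor>L * Y (T j) \<omega> $ i\<rfloor> = (c i + \<delta>) mod int L" if "j \<le> k" for j i
          unfolding c_def
        proof (rule grid_neighbour[OF L])
          show "0 \<le> Y (T j) \<omega> $ i" "Y (T j) \<omega> $ i < 1" using cube[OF that] by (auto simp: hbox_def)
          show "torus_norm (Y (T 0) \<omega> $ i - Y (T j) \<omega> $ i) \<le> 1 / L"
            using dist that torus_norm_le_dist order_trans by blast
        qed
        then obtain \<delta> where \<delta>: "\<And>j i. j \<le> k \<Longrightarrow> \<delta> j i \<in> {-1, 0, 1}"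
          "\<And>j i. j \<le> k \<Longrightarrow> \<lfloor>L * Y (T j) \<omega> $ i\<rfloor> = (c i + \<delta> j i) mod int L" by metis
        define \<Delta> where "\<Delta> = restrict \<delta> {1..k}"
        have "\<Delta> \<in> shifts" unfolding shifts_def \<Delta>_def PiE_UNIV_domain using \<delta>(1)
          by (intro restrict_PiE_iff[THEN iffD2] ballI Pi_I) simp
        moreover have "restrict T {..k} \<in> Ts" using T0 by (auto simp: Ts_def inj_on_def)
        ultimately have J: "(restrict T {..k}, c, \<Delta>) \<in> J" using c by (simp add: J_def)
        have "Y (T j) \<omega> \<in> grid_cell L (C c \<Delta> j)" if "j \<le> k" for j
        proof (cases "j = 0")
          case True
          then show ?thesis by (simp add: mem_grid_cell[OF L] C_def c_def)
        next
          case False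
          then show ?thesis using \<delta>(2)[OF that] that by (simp add: mem_grid_cell[OF L] C_def \<Delta>_def)
        qed
        then have "\<omega> \<in> E (restrict T {..k}, c, \<Delta>)" using \<omega> by (simp add: E_def)
        then show False using J no by blast
      qed
    qed
  qed
qed

section \<open>Size and type of the components\<close>

lemma infnorm_eq_Max: "infnorm (x :: real ^ 'd) = (MAX i. \<bar>x $ i\<bar>)"
proof -
  have "(Basis :: (real ^ 'd) set) = (\<lambda>i. axis i 1) ` UNIV" by (auto simp: Basis_vec_def)
  note B = this
  show ?thesis unfolding infnorm_Max B by (simp add: image_image inner_axis)
qed

lemma torus_norm_small:
  assumes "\<bar>t\<bar> \<le> 1 / 2"
  shows "torus_norm (t + of_int m) = \<bar>t\<bar>"
proof (rule antisym)
  show "torus_norm (t + of_int m) \<le> \<bar>t\<bar>" using torus_norm_le[of "t + of_int m" m] by simp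
  define j where "j = round (t + of_int m) - m"
  have "torus_norm (t + of_int m) = \<bar>t - of_int j\<bar>"
    by (simp add: torus_norm_attained j_def)
  moreover have "\<bar>t\<bar> \<le> \<bar>t - of_int j\<bar>"
  proof (cases "j = 0")
    case False
    then have "1 \<le> \<bar>real_of_int j\<bar>" by linarith
    then show ?thesis using assms by linarith
  qed simp
  ultimately show "\<bar>t\<bar> \<le> torus_norm (t + of_int m)" by simp
qed

lemma strictly_geometric_block:
  fixes x :: "nat \<Rightarrow> real ^ 'd"
  assumes S: "block (torus_graph n \<rho> x) S" and \<rho>: "0 \<le> \<rho>" and card: "card S \<le> k" and small: "4 * real k * \<rho> < 1"
  shows "strictly_geometric TYPE('d) (induced (torus_graph n \<rho> x) S)"
proof -
  let ?G = "torus_graph n \<rho> x"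
  have G: "pair_graph ?G" by (rule pair_graph_torus_graph)
  have SG: "S \<subseteq> {1..n}" using block_subset[OF S] by simp
  then have finS: "finite S" by (rule finite_subset) simp
  obtain v where v: "v \<in> S" using block_nonempty[OF S] by blast
  then have "0 < card S" using finS by (auto simp: card_gt_0_iff)
  then have "card S - 1 < card S" by simp
  then obtain T where T: "inj_on T {..card S - 1}" "T ` {..card S - 1} \<subseteq> S"
    "\<And>i. i \<le> card S - 1 \<Longrightarrow> torus_dist (x v) (x (T i)) \<le> real (card S - 1) * \<rho>"
    using block_enumeration[OF S v _ \<rho>] by blast
  have "card (T ` {..card S - 1}) = card S"
    using T(1) \<open>card S - 1 < card S\<close> by (simp add: card_image)
  then have TS: "T ` {..card S - 1} = S" by (intro card_subset_eq finS T(2))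
  \<comment> \<open>Origin of the 4 in \<open>small\<close>: at distance at most
    \<open>1 / 4\<close> from \<open>v\<close>, lifted coordinates differ by at most
    \<open>1 / 2\<close>, the range in which \<open>torus_norm\<close> is the absolute
    value.\<close>
  have near: "torus_dist (x v) (x u) \<le> 1 / 4" if "u \<in> S" for u
  proof -
    have "u \<in> T ` {..card S - 1}" using that by (simp only: TS)
    then obtain i where "i \<le> card S - 1" "u = T i" by auto
    then have "torus_dist (x v) (x u) \<le> real (card S - 1) * \<rho>" using T(3) by simp
    also have "\<dots> \<le> real k * \<rho>" using card \<rho> by (intro mult_right_mono) auto
    finally show ?thesis using small by linarith
  qed
  \<comment> \<open>The lift of \<open>x u\<close>, seen from \<open>x v\<close>: in each coordinate
    the representative of \<open>x u $ i - x v $ i\<close> modulo 1 that is nearest to 0.\<close>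
  define y where "y u = (\<chi> i. of_int (round (x v $ i - x u $ i)) - (x v $ i - x u $ i))" for u
  have y: "\<bar>y u $ i\<bar> \<le> 1 / 4" if "u \<in> S" for u i
  proof -
    have "torus_norm (x v $ i - x u $ i) \<le> 1 / 4"
      using near[OF that] torus_norm_le_dist order_trans by blast
    then show ?thesis by (simp add: torus_norm_attained y_def abs_minus_commute)
  qed
  define d where "d u w = torus_dist (x u) (x w)" for u w
  have d: "infnorm (y u - y w) = d u w" if "u \<in> S" "w \<in> S" for u w
  proof -
    have "torus_norm (x u $ i - x w $ i) = \<bar>(y u - y w) $ i\<bar>" for i
    proof -
      have "\<bar>(y u - y w) $ i\<bar> \<le> 1 / 2" 
        using y[OF that(1), of i] y[OF that(2), of i] unfolding vector_minus_component by linarith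
      moreover have "x u $ i - x w $ i = (y u - y w) $ i +
          of_int (round (x v $ i - x w $ i) - round (x v $ i - x u $ i))"
        by (simp add: y_def)
      ultimately show ?thesis using torus_norm_small by metis
    qed
    then show ?thesis by (simp add: d_def torus_dist_def infnorm_eq_Max)
  qed
  \<comment> \<open>The least element \<open>\<mu>\<close> of \<open>N\<close> bounds the distances
    of nonadjacent pairs from below; the extra element keeps \<open>N\<close> nonempty when every
    pair is adjacent. The factor \<open>c\<close> below sends the midpoint between
    \<open>\<rho>\<close> and \<open>\<mu>\<close> to 1, which works for \<open>\<rho> = 0\<close>
    as well.\<close>
  define N where "N = insert (\<rho> + 1) ((\<lambda>(u, w). d u w) ` {(u, w) \<in> S \<times> S. \<rho> < d u w})"
  have "finite {(u, w) \<in> S \<times> S. \<rho> < d u w}" using finS by (auto intro: finite_subset[of _ "S \<times> S"])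
  then have finN: "finite N" unfolding N_def by simp
  define \<mu> where "\<mu> = Min N"
  have "\<mu> \<in> N" unfolding \<mu>_def by (rule Min_in[OF finN]) (simp add: N_def)
  then have \<mu>: "\<rho> < \<mu>" by (auto simp: N_def)
  have \<mu>_le: "\<mu> \<le> d u w" if "u \<in> S" "w \<in> S" "\<rho> < d u w" for u w
    unfolding \<mu>_def using that by (intro Min_le finN) (auto simp: N_def)
  define c where "c = 2 / (\<rho> + \<mu>)"
  have c: "0 < c" "c * \<rho> < 1" "1 < c * \<mu>" using \<mu> \<rho> by (auto simp: c_def field_simps)
  have z: "infnorm (c *\<^sub>R y u - c *\<^sub>R y w) = c * d u w" if "u \<in> S" "w \<in> S" for u w
    using c d[OF that] by (simp add: infnorm_mul flip: scaleR_diff_right)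
  have sep: "\<forall>u\<in>S. \<forall>w\<in>S. u \<noteq> w \<longrightarrow>
      ((u, w) \<in> parcs (induced ?G S) \<longrightarrow> infnorm (c *\<^sub>R y u - c *\<^sub>R y w) < 1) \<and>
      ((u, w) \<notin> parcs (induced ?G S) \<longrightarrow> infnorm (c *\<^sub>R y u - c *\<^sub>R y w) > 1)"
  proof (intro ballI impI conjI)
    fix u w assume uw: "u \<in> S" "w \<in> S" "u \<noteq> w"
    {
      assume "(u, w) \<in> parcs (induced ?G S)"
      then have "d u w \<le> \<rho>" by (simp add: torus_graph_arc_iff d_def)
      then have "c * d u w \<le> c * \<rho>" using c by (intro mult_left_mono) auto
      then show "infnorm (c *\<^sub>R y u - c *\<^sub>R y w) < 1" using c z[OF uw(1,2)] by linarith
    next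
      assume "(u, w) \<notin> parcs (induced ?G S)"
      then have "\<rho> < d u w" using uw SG by (auto simp: torus_graph_arc_iff d_def)
      then have "c * \<mu> \<le> c * d u w" using \<mu>_le[OF uw(1,2)] c by (intro mult_left_mono) auto
      then show "infnorm (c *\<^sub>R y u - c *\<^sub>R y w) > 1" using c z[OF uw(1,2)] by linarith
    }
  qed
  have conn: "Digraph_Component.connected (with_proj (induced ?G S))"
  proof -
    have "with_proj (induced ?G S) \<in> graph_components ?G"
      using S by (simp add: graph_components_eq[OF G])
    then show ?thesis by (simp add: graph_components_def pre_digraph.max_subgraph_def)
  qed
  have "pair_graph (induced ?G S)" by (rule pair_graph_induced[OF G block_subset[OF S]])
  then show ?thesis unfolding strictly_geometric_def induced_simps(1)
    by (intro conjI conn disjI2 exI[of _ "\<lambda>u. c *\<^sub>R y u"] sep)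
qed

text \<open>Explains the cube in \<open>radius\<close>: replacing the radius by
  \<open>1 / n ^ 3\<close> makes both growth quantities at most \<open>1 / n\<close>. The conditions
  needed are \<open>k + 2 \<le> 3 * D * k\<close> for \<open>k \<ge> 1\<close> and
  \<open>k + 1 \<le> 3 * D * (k - 1)\<close> for \<open>k \<ge> 2\<close>; in dimension 1 they are
  equalities at \<open>k = 1\<close> and \<open>k = 2\<close>, respectively.\<close>

lemma power_mult_inverse_cube_le:
  assumes "1 \<le> n" "a + 1 \<le> 3 * p"
  shows "real n ^ a * (1 / real n ^ 3) ^ p \<le> 1 / real n"
proof -
  have "(1 / real n ^ 3) ^ p = 1 / real n ^ (3 * p)" by (simp add: power_one_over power_mult)
  moreover have "real n ^ (a + 1) \<le> real n ^ (3 * p)" using assms by (intro power_increasing) auto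
  ultimately show ?thesis using assms(1) by (simp add: field_simps)
qed

lemma tendsto_0_if_power:
  fixes f g :: "nat \<Rightarrow> real"
  assumes "m > 0" "g \<longlonglongrightarrow> 0" "\<And>n. 0 \<le> f n" "\<forall>\<^sub>F n in sequentially. f n ^ m \<le> g n"
  shows "f \<longlonglongrightarrow> 0"
proof -
  have "(\<lambda>n. f n ^ m) \<longlonglongrightarrow> 0"
    using assms by (intro tendsto_sandwich[OF _ assms(4) tendsto_const assms(2)]) auto
  then have "(\<lambda>n. root m (f n ^ m)) \<longlonglongrightarrow> root m 0" by (rule tendsto_real_root)
  then show ?thesis using assms(1,3) by (simp add: real_root_power_cancel)
qed

section \<open>Growth conditions and the bound on component sizes\<close>

locale subcritical_torus_graphs =
  fixes k :: nat and r :: "nat \<Rightarrow> real" and M :: "nat \<Rightarrow> 'w measure"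
    and X :: "nat \<Rightarrow> nat \<Rightarrow> 'w \<Rightarrow> real ^ 'd::finite"
  assumes k: "k \<ge> 1"
    and r: "\<And>n. r n \<in> {0..1/2}"
    and prob: "\<And>n. prob_space (M n)"
    and indep: "\<And>n. prob_space.indep_vars (M n) (\<lambda>_. borel) (X n) {1..n}"
    and uniform: "\<And>n i. i \<in> {1..n} \<Longrightarrow> distr (M n) borel (X n i) = uniform_torus"
    and lower: "filterlim (\<lambda>n. real n ^ k * r n ^ (CARD('d) * (k - 1))) at_top sequentially"
    and upper: "(\<lambda>n. real n ^ (k + 1) * r n ^ (CARD('d) * k)) \<longlonglongrightarrow> 0"
begin

text \<open>
  The radius itself may vanish when \<open>k = 1\<close>; this positive majorant still satisfies both
  growth conditions and agrees with \<open>r\<close> eventually when \<open>k \<ge> 2\<close>.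
\<close>

definition radius :: "nat \<Rightarrow> real" where "radius n = max (r n) (1 / real n ^ 3)"

lemma r_nonneg: "0 \<le> r n" and r_le_radius: "r n \<le> radius n"
  using r[of n] by (auto simp: radius_def)

lemma radius_nonneg: "0 \<le> radius n"
  using r_nonneg[of n] r_le_radius[of n] by linarith

lemma radius_pos: "n \<ge> 1 \<Longrightarrow> 0 < radius n"
  by (simp add: radius_def less_max_iff_disj)

lemma D_pos: "CARD('d) \<ge> 1"
  by (simp add: Suc_leI)

lemma radius_upper: "(\<lambda>n. real n ^ (k + 1) * radius n ^ (CARD('d) * k)) \<longlonglongrightarrow> 0"
proof (rule tendsto_sandwich)
  show "\<forall>\<^sub>F n in sequentially. 0 \<le> real n ^ (k + 1) * radius n ^ (CARD('d) * k)"
    by (simp add: radius_nonneg)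
  show "\<forall>\<^sub>F n in sequentially. real n ^ (k + 1) * radius n ^ (CARD('d) * k)
      \<le> real n ^ (k + 1) * r n ^ (CARD('d) * k) + 1 / real n"
    using eventually_ge_at_top[of 1]
  proof eventually_elim
    case (elim n)
    let ?p = "CARD('d) * k"
    have "k \<le> ?p" using D_pos by simp
    then have "k + 2 \<le> 3 * ?p" using k by linarith
    then have "real n ^ (k + 1) * (1 / real n ^ 3) ^ ?p \<le> 1 / real n"
      using elim by (intro power_mult_inverse_cube_le) auto
    moreover have "radius n ^ ?p \<le> r n ^ ?p + (1 / real n ^ 3) ^ ?p"
      using r_nonneg[of n] by (auto simp: radius_def max_def)
    then have "real n ^ (k + 1) * radius n ^ ?p \<le> real n ^ (k + 1) * (r n ^ ?p + (1 / real n ^ 3) ^ ?p)"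
      by (intro mult_left_mono) auto
    ultimately show ?case by (simp add: distrib_left)
  qed
  show "(\<lambda>n. real n ^ (k + 1) * r n ^ (CARD('d) * k) + 1 / real n) \<longlonglongrightarrow> 0"
    using tendsto_add[OF upper lim_1_over_n] by simp
qed simp

text \<open>The \<open>k\<close>-th power of this quantity is \<open>1 / n\<close> times the one in
  \<open>radius_upper\<close>.\<close>

lemma mean_degree: "(\<lambda>n. real n * radius n ^ CARD('d)) \<longlonglongrightarrow> 0"
proof (rule tendsto_0_if_power[OF _ radius_upper])
  show "\<forall>\<^sub>F n in sequentially. (real n * radius n ^ CARD('d)) ^ k
      \<le> real n ^ (k + 1) * radius n ^ (CARD('d) * k)"
    using eventually_ge_at_top[of 1]
  proof eventually_elim
    case (elim n)
    have "(real n * radius n ^ CARD('d)) ^ k = real n ^ k * radius n ^ (CARD('d) * k)"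
      by (simp add: power_mult_distrib power_mult)
    also have "\<dots> \<le> real n ^ (k + 1) * radius n ^ (CARD('d) * k)"
      using elim by (intro mult_right_mono power_increasing) (auto simp: radius_nonneg)
    finally show ?case .
  qed
qed (use k in \<open>auto simp: radius_nonneg\<close>)

lemma radius_tendsto_0: "radius \<longlonglongrightarrow> 0"
proof (rule tendsto_0_if_power[OF _ mean_degree])
  show "\<forall>\<^sub>F n in sequentially. radius n ^ CARD('d) \<le> real n * radius n ^ CARD('d)"
    using eventually_ge_at_top[of 1]
  proof eventually_elim
    case (elim n)
    then show ?case
      using mult_right_mono[of 1 "real n" "radius n ^ CARD('d)"] radius_nonneg[of n] by simp
  qed
qed (auto simp: radius_nonneg)

text \<open>If \<open>r n\<close> were below \<open>1 / n ^ 3\<close>, the diverging quantity in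
  \<open>lower\<close> would be at most \<open>1 / n\<close>. Patterns with at least two vertices
  are realized at the scale of the true radius, hence the need for equality.\<close>

lemma radius_eq:
  assumes "2 \<le> k"
  shows "\<forall>\<^sub>F n in sequentially. radius n = r n"
proof -
  have "\<forall>\<^sub>F n in sequentially. 1 \<le> real n ^ k * r n ^ (CARD('d) * (k - 1))"
    using lower by (simp add: filterlim_at_top)
  then show ?thesis using eventually_ge_at_top[of 2]
  proof eventually_elim
    case (elim n)
    let ?p = "CARD('d) * (k - 1)"
    have "\<not> r n < 1 / real n ^ 3"
    proof
      assume *: "r n < 1 / real n ^ 3"
      have "k - 1 \<le> ?p" using D_pos by simp
      then have "k + 1 \<le> 3 * ?p" using assms by linarith
      then have 1: "real n ^ k * (1 / real n ^ 3) ^ ?p \<le> 1 / real n"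
        using elim by (intro power_mult_inverse_cube_le) auto
      have "r n ^ ?p \<le> (1 / real n ^ 3) ^ ?p" using * r_nonneg by (intro power_mono) auto
      then have "real n ^ k * r n ^ ?p \<le> real n ^ k * (1 / real n ^ 3) ^ ?p"
        by (intro mult_left_mono) auto
      with 1 elim have "1 \<le> 1 / real n" by linarith
      then show False using elim by simp
    qed
    then show ?case by (simp add: radius_def)
  qed
qed

text \<open>The quantity at size \<open>k\<close> is the one at size \<open>s\<close> times
  \<open>(n * radius n ^ CARD('d)) ^ (k - s)\<close>, and the second factor is eventually at most 1
  by \<open>mean_degree\<close>. So divergence is inherited by the smaller sizes.\<close>

lemma radius_lower:
  assumes s: "1 \<le> s" "s \<le> k"
  shows "filterlim (\<lambda>n. real n ^ s * radius n ^ (CARD('d) * (s - 1))) at_top sequentially"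
proof (rule filterlim_at_top_mono[OF lower])
  have "\<forall>\<^sub>F n in sequentially. real n * radius n ^ CARD('d) < 1"
    using mean_degree by (rule order_tendstoD) simp
  then show "\<forall>\<^sub>F n in sequentially. real n ^ k * r n ^ (CARD('d) * (k - 1))
      \<le> real n ^ s * radius n ^ (CARD('d) * (s - 1))"
  proof eventually_elim
    case (elim n)
    have "r n ^ (CARD('d) * (k - 1)) \<le> radius n ^ (CARD('d) * (k - 1))"
      using r_nonneg r_le_radius by (intro power_mono)
    then have "real n ^ k * r n ^ (CARD('d) * (k - 1)) \<le> real n ^ k * radius n ^ (CARD('d) * (k - 1))"
      by (intro mult_left_mono) auto
    also have "\<dots> = (real n ^ s * radius n ^ (CARD('d) * (s - 1))) * (real n * radius n ^ CARD('d)) ^ (k - s)"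
    proof -
      have "real n ^ k = real n ^ s * real n ^ (k - s)" using s by (simp flip: power_add)
      moreover have "CARD('d) * (k - 1) = CARD('d) * (s - 1) + CARD('d) * (k - s)"
        using s by (simp flip: distrib_left)
      ultimately show ?thesis by (simp add: power_add power_mult power_mult_distrib)
    qed
    also have "\<dots> \<le> (real n ^ s * radius n ^ (CARD('d) * (s - 1))) * 1"
      using elim by (intro mult_left_mono power_le_one) (auto simp: radius_nonneg)
    finally show ?case by simp
  qed
qed

lemma measurable_X: "i \<in> {1..n} \<Longrightarrow> X n i \<in> borel_measurable (M n)"
  using indep[of n] by (simp add: prob_space.indep_vars_def[OF prob])

lemma sets_random_torus_graph: "{\<omega> \<in> space (M n). P (random_torus_graph r X n \<omega>)} \<in> sets (M n)"
  unfolding random_torus_graph_def by (rule sets_torus_graph) (rule measurable_X)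

lemma whp_block_card_le: "whp M (\<lambda>n \<omega>. \<forall>S. block (random_torus_graph r X n \<omega>) S \<longrightarrow> card S \<le> k)"
proof (rule whpI_bad)
  let ?c = "(6 * real k) ^ (CARD('d) * k)"
  show "(\<lambda>n. ?c * (real n ^ (k + 1) * radius n ^ (CARD('d) * k))) \<longlonglongrightarrow> 0"
    using tendsto_mult_left[OF radius_upper, of ?c] by simp
  have "(\<lambda>n. real k * radius n) \<longlonglongrightarrow> 0"
    using tendsto_mult_left[OF radius_tendsto_0, of "real k"] by simp
  then have "\<forall>\<^sub>F n in sequentially. real k * radius n < 1 / 2"
    by (rule order_tendstoD) simp
  then show "\<forall>\<^sub>F n in sequentially. prob_seq M (\<lambda>n \<omega>. \<not> (\<forall>S. block (random_torus_graph r X n \<omega>) S \<longrightarrow> card S \<le> k)) n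
      \<le> ?c * (real n ^ (k + 1) * radius n ^ (CARD('d) * k))"
    using eventually_ge_at_top[of 1]
  proof eventually_elim
    case (elim n)
    interpret prob_space "M n" by (rule prob)
    \<comment> \<open>All \<open>k + 1\<close> points of an oversized block lie within
      \<open>a\<close> of the first one; taking \<open>radius\<close> instead of \<open>r\<close>
      keeps \<open>a\<close> positive. Rounding \<open>1 / a > 2\<close> down to \<open>L\<close>
      loses at most a factor 2, which turns \<open>3 / L\<close> into \<open>6 * a\<close> and
      produces the constant \<open>6 * k\<close>.\<close>
    define a where "a = real k * radius n"
    have a: "0 < a" "a < 1 / 2" using k radius_pos[OF elim(2)] elim(1) by (auto simp: a_def)
    define L where "L = nat \<lfloor>1 / a\<rfloor>"
    have "2 < 1 / a" using a by (simp add: field_simps)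
    then have L: "real L \<le> 1 / a" "1 / a - 1 < real L" unfolding L_def by linarith+
    then have L_ge: "1 / (2 * a) \<le> real L" using \<open>2 < 1 / a\<close> by (simp add: field_simps)
    have "0 < real L" using L \<open>2 < 1 / a\<close> by linarith
    then have Lpos: "L > 0" by simp
    have aL: "a \<le> 1 / L" using L(1) \<open>0 < real L\<close> a by (simp add: field_simps)
    have "3 / real L \<le> 6 * a" using L_ge \<open>0 < real L\<close> a by (simp add: field_simps)
    obtain A where A: "A \<in> events" "prob A \<le> real n ^ (k + 1) * (3 / real L) ^ (CARD('d) * k)"
      "{\<omega> \<in> space (M n). \<exists>T. inj_on T {..k} \<and> T ` {..k} \<subseteq> {1..n} \<and>
        (\<forall>j\<le>k. torus_dist (X n (T 0) \<omega>) (X n (T j) \<omega>) \<le> 1 / L)} \<subseteq> A"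
      using prob_cluster_le[OF indep uniform Lpos] by blast
    have "{\<omega> \<in> space (M n). \<not> (\<forall>S. block (random_torus_graph r X n \<omega>) S \<longrightarrow> card S \<le> k)} \<subseteq> A"
    proof (rule subset_trans[OF _ A(3)], clarify)
      fix \<omega> S assume S: "block (random_torus_graph r X n \<omega>) S" and "\<not> card S \<le> k" and \<omega>: "\<omega> \<in> space (M n)"
      then have S: "block (torus_graph n (r n) (\<lambda>i. X n i \<omega>)) S" "k < card S"
        by (simp_all add: random_torus_graph_def)
      obtain v where v: "v \<in> S" using block_nonempty[OF S(1)] by blast
      obtain T where T: "inj_on T {..k}" "T ` {..k} \<subseteq> S" "T 0 = v"
        "\<And>i. i \<le> k \<Longrightarrow> torus_dist (X n v \<omega>) (X n (T i) \<omega>) \<le> real k * r n"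
        using block_enumeration[OF S(1) v S(2) r_nonneg] by blast
      have "real k * r n \<le> 1 / L"
        using aL mult_left_mono[OF r_le_radius[of n], of "real k"] by (simp add: a_def)
      then have "\<forall>j\<le>k. torus_dist (X n (T 0) \<omega>) (X n (T j) \<omega>) \<le> 1 / L"
        using T(3,4) order_trans by blast
      moreover have "T ` {..k} \<subseteq> {1..n}" using T(2) block_subset[OF S(1)] by simp
      ultimately show "\<exists>T. inj_on T {..k} \<and> T ` {..k} \<subseteq> {1..n} \<and>
          (\<forall>j\<le>k. torus_dist (X n (T 0) \<omega>) (X n (T j) \<omega>) \<le> 1 / L)" using T(1) by blast
    qed
    then have "prob_seq M (\<lambda>n \<omega>. \<not> (\<forall>S. block (random_torus_graph r X n \<omega>) S \<longrightarrow> card S \<le> k)) n \<le> prob A"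
      unfolding prob_seq_def using A(1) by (rule finite_measure_mono)
    also note A(2)
    also have "real n ^ (k + 1) * (3 / real L) ^ (CARD('d) * k) \<le> real n ^ (k + 1) * (6 * a) ^ (CARD('d) * k)"
      using \<open>3 / real L \<le> 6 * a\<close> by (intro mult_left_mono power_mono) auto
    also have "\<dots> = ?c * (real n ^ (k + 1) * radius n ^ (CARD('d) * k))"
      by (simp add: a_def power_mult_distrib)
    finally show ?case .
  qed
  show "{\<omega> \<in> space (M n). \<forall>S. block (random_torus_graph r X n \<omega>) S \<longrightarrow> card S \<le> k} \<in> sets (M n)" for n
    by (rule sets_random_torus_graph)
qed (rule prob)

end

section \<open>Second moment and robust realizations\<close>

text \<open>In the second moment the diagonal contributes at most \<open>\<mu>\<close> and the other
  pairs at most \<open>\<kappa> * \<mu>\<^sup>2\<close>, so the variance is at most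
  \<open>\<mu> + (\<kappa> - 1) * \<mu>\<^sup>2\<close>. Chebyshev at distance
  \<open>\<mu> / 2\<close> gives the factor 4. The bound vanishes when \<open>\<mu>\<close> tends to
  infinity and \<open>\<kappa>\<close> to 1.\<close>

lemma (in prob_space) second_moment_count:
  fixes A :: "'j \<Rightarrow> 'a set"
  assumes J: "finite J" and A: "\<And>j. j \<in> J \<Longrightarrow> A j \<in> events" "\<And>j. j \<in> J \<Longrightarrow> prob (A j) = a"
    and pair: "\<And>i j. i \<in> J \<Longrightarrow> j \<in> J \<Longrightarrow> i \<noteq> j \<Longrightarrow> prob (A i \<inter> A j) \<le> \<kappa> * a\<^sup>2"
    and \<kappa>: "0 \<le> \<kappa>" and \<mu>: "\<mu> = real (card J) * a" "0 < \<mu>"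
  shows "prob {\<omega> \<in> space M. real (card {j \<in> J. \<omega> \<in> A j}) \<le> \<mu> / 2} \<le> 4 / \<mu> + 4 * (\<kappa> - 1)"
    and "{\<omega> \<in> space M. real (card {j \<in> J. \<omega> \<in> A j}) \<le> \<mu> / 2} \<in> events"
proof -
  define N where "N \<omega> = (\<Sum>j\<in>J. indicator (A j) \<omega> :: real)" for \<omega>
  have N: "N \<omega> = real (card {j \<in> J. \<omega> \<in> A j})" for \<omega>
  proof -
    have "J \<inter> {j. \<omega> \<in> A j} = {j \<in> J. \<omega> \<in> A j}" by blast
    then show ?thesis unfolding N_def indicator_def using J by simp
  qed
  have sq: "(N \<omega>)\<^sup>2 = (\<Sum>i\<in>J. \<Sum>j\<in>J. indicator (A i \<inter> A j) \<omega>)" for \<omega>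
    unfolding N_def power2_eq_square sum_product by (simp add: indicator_inter_arith)
  have int1: "integrable M N" unfolding N_def
    using A(1) by (intro Bochner_Integration.integrable_sum integrable_real_indicator) (auto simp: emeasure_eq_measure)
  have int2: "integrable M (\<lambda>\<omega>. (N \<omega>)\<^sup>2)" unfolding sq
    using A(1) by (intro Bochner_Integration.integrable_sum integrable_real_indicator) (auto simp: emeasure_eq_measure)
  have "expectation N = (\<Sum>j\<in>J. prob (A j))" unfolding N_def
    using A(1) by (subst Bochner_Integration.integral_sum) (auto simp: emeasure_eq_measure intro!: integrable_real_indicator)
  then have EN: "expectation N = \<mu>" using A(2) \<mu> by simp
  have "expectation (\<lambda>\<omega>. (N \<omega>)\<^sup>2) = (\<Sum>i\<in>J. \<Sum>j\<in>J. prob (A i \<inter> A j))"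
    unfolding sq using A(1)
    by (subst Bochner_Integration.integral_sum
        | auto simp: emeasure_eq_measure intro!: integrable_real_indicator Bochner_Integration.integrable_sum sum.cong)+
  \<comment> \<open>Allowing \<open>\<kappa> * a\<^sup>2\<close> on the diagonal as well makes this
    part of the double sum constant.\<close>
  also have "\<dots> \<le> (\<Sum>i\<in>J. \<Sum>j\<in>J. (if j = i then a else 0) + \<kappa> * a\<^sup>2)"
  proof (intro sum_mono)
    fix i j assume ij: "i \<in> J" "j \<in> J"
    have "0 \<le> \<kappa> * a\<^sup>2" using \<kappa> by simp
    then show "prob (A i \<inter> A j) \<le> (if j = i then a else 0) + \<kappa> * a\<^sup>2"
      using ij pair[of i j] A(2) by auto
  qed
  also have "\<dots> = \<mu> + \<kappa> * \<mu>\<^sup>2"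
    using J by (simp add: sum.distrib \<mu>(1) power2_eq_square algebra_simps)
  finally have "variance N \<le> \<mu> + (\<kappa> - 1) * \<mu>\<^sup>2"
    using variance_eq[OF int1 int2] EN by (simp add: algebra_simps)
  have measN: "N \<in> borel_measurable M" using int1 by simp
  then have "{\<omega> \<in> space M. N \<omega> \<le> \<mu> / 2} \<in> events" by measurable
  then show "{\<omega> \<in> space M. real (card {j \<in> J. \<omega> \<in> A j}) \<le> \<mu> / 2} \<in> events" by (simp add: N)
  from measN have "prob {\<omega> \<in> space M. \<mu> / 2 \<le> \<bar>N \<omega> - expectation N\<bar>} \<le> variance N / (\<mu> / 2)\<^sup>2"
    using int2 \<mu>(2) by (intro Chebyshev_inequality) auto
  also have "\<dots> \<le> (\<mu> + (\<kappa> - 1) * \<mu>\<^sup>2) / (\<mu> / 2)\<^sup>2"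
    using \<open>variance N \<le> _\<close> by (intro divide_right_mono) auto
  also have "\<dots> = 4 / \<mu> + 4 * (\<kappa> - 1)" using \<mu>(2) by (simp add: field_simps power2_eq_square)
  finally have "prob {\<omega> \<in> space M. \<mu> / 2 \<le> \<bar>N \<omega> - \<mu>\<bar>} \<le> 4 / \<mu> + 4 * (\<kappa> - 1)" unfolding EN .
  moreover have "prob {\<omega> \<in> space M. N \<omega> \<le> \<mu> / 2} \<le> prob {\<omega> \<in> space M. \<mu> / 2 \<le> \<bar>N \<omega> - \<mu>\<bar>}"
    using measN by (intro finite_measure_mono) (auto simp: abs_if)
  ultimately show "prob {\<omega> \<in> space M. real (card {j \<in> J. \<omega> \<in> A j}) \<le> \<mu> / 2} \<le> 4 / \<mu> + 4 * (\<kappa> - 1)"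
    by (simp add: N)
qed

lemma block_if_graph_iso:
  assumes H: "pair_graph H" "Digraph_Component.connected (with_proj H)" and S: "S \<subseteq> pverts G"
    and iso: "graph_iso f H (induced G S)"
    and closed: "\<And>u v. (u, v) \<in> parcs G \<Longrightarrow> u \<in> S \<longleftrightarrow> v \<in> S"
  shows "block G S"
proof -
  note conn = H(2)[unfolded connected_with_proj_iff_cut[OF H(1)]]
  have bij: "bij_betw f (pverts H) S" using iso by (simp add: graph_iso_def)
  then have fS: "f ` pverts H = S" by (simp add: bij_betw_def)
  have cut: "\<exists>u\<in>A. \<exists>v\<in>S - A. (u, v) \<in> parcs G" if A: "A \<subset> S" "A \<noteq> {}" for A
  proof -
    let ?A = "{u \<in> pverts H. f u \<in> A}"
    have "?A \<noteq> {}" using A fS by auto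
    moreover have "?A \<noteq> pverts H" using A fS by auto
    ultimately have "\<exists>u\<in>?A. \<exists>v\<in>pverts H - ?A. (u, v) \<in> parcs H"
      by (intro conjunct2[OF conn, rule_format]) auto
    then obtain u v where uv: "u \<in> ?A" "v \<in> pverts H - ?A" "(u, v) \<in> parcs H" by blast
    have "\<forall>u\<in>pverts H. \<forall>v\<in>pverts H. (u, v) \<in> parcs H \<longleftrightarrow> (f u, f v) \<in> parcs (induced G S)"
      using iso unfolding graph_iso_def by (rule conjunct2)
    then have "(f u, f v) \<in> parcs (induced G S)" using uv by blast
    then have "(f u, f v) \<in> parcs G" "f v \<in> S" by auto
    moreover have "f u \<in> A" "f v \<notin> A" using uv by auto
    ultimately show ?thesis by blast
  qed
  show ?thesis
    unfolding block_def
  proof (intro conjI allI impI)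
    show "S \<noteq> {}" using conjunct1[OF conn] fS by auto
    show "u \<in> S \<longleftrightarrow> v \<in> S" if "(u, v) \<in> parcs G" for u v using that by (rule closed)
  qed (fact S, erule (1) cut)
qed

text \<open>Finitely many strict inequalities leave a common gap \<open>\<delta>\<close> around 1.
  With \<open>\<epsilon> = \<delta> / 4\<close>, moving both points of a pair by
  \<open>\<epsilon>\<close> changes a coordinate difference by at most \<open>\<delta> / 2\<close>.
  Translation by \<open>b + 2\<close>, where \<open>b\<close> bounds all coordinates, together with
  \<open>R = 2 * b + 4\<close> leaves distance 2 to the faces of the cube of side
  \<open>R\<close>.\<close>

lemma strictly_geometric_robust:
  assumes "strictly_geometric TYPE('d::finite) H"
  obtains z :: "nat \<Rightarrow> real ^ 'd" and \<epsilon> R where "0 < \<epsilon>" "\<epsilon> \<le> 1 / 2"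
    "\<And>u i. u \<in> pverts H \<Longrightarrow> 2 \<le> z u $ i \<and> z u $ i \<le> R - 2"
    "\<And>u v i. (u, v) \<in> parcs H \<Longrightarrow> \<bar>z u $ i - z v $ i\<bar> + 2 * \<epsilon> < 1"
    "\<And>u v. u \<in> pverts H \<Longrightarrow> v \<in> pverts H \<Longrightarrow> u \<noteq> v \<Longrightarrow> (u, v) \<notin> parcs H \<Longrightarrow>
       \<exists>i. \<bar>z u $ i - z v $ i\<bar> - 2 * \<epsilon> > 1"
proof -
  let ?V = "pverts H"
  have H: "pair_graph H" using assms by (simp add: strictly_geometric_def)
  then interpret pair_graph H .
  have fin: "finite ?V" by (rule pair_finite_verts)
  have arcV: "u \<in> ?V \<and> v \<in> ?V \<and> u \<noteq> v" if "(u, v) \<in> parcs H" for u v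
    using pair_graph_arc_verts[OF H that] pair_no_loops[OF that] by auto
  have "\<exists>y :: nat \<Rightarrow> real ^ 'd. \<forall>u\<in>?V. \<forall>v\<in>?V. u \<noteq> v \<longrightarrow>
      ((u, v) \<in> parcs H \<longrightarrow> infnorm (y u - y v) < 1) \<and> ((u, v) \<notin> parcs H \<longrightarrow> infnorm (y u - y v) > 1)"
  proof (cases "card ?V = 1")
    case True
    then obtain a where "?V = {a}" by (auto simp: card_1_singleton_iff)
    then show ?thesis by auto
  next
    case False
    then show ?thesis using assms unfolding strictly_geometric_def by blast
  qed
  then obtain y :: "nat \<Rightarrow> real ^ 'd" where
    y: "\<And>u v. u \<in> ?V \<Longrightarrow> v \<in> ?V \<Longrightarrow> u \<noteq> v \<Longrightarrow> (u, v) \<in> parcs H \<Longrightarrow> infnorm (y u - y v) < 1"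
      "\<And>u v. u \<in> ?V \<Longrightarrow> v \<in> ?V \<Longrightarrow> u \<noteq> v \<Longrightarrow> (u, v) \<notin> parcs H \<Longrightarrow> infnorm (y u - y v) > 1"
    by blast
  define b where "b = Max (insert 0 ((\<lambda>u. infnorm (y u)) ` ?V))"
  have b: "\<bar>y u $ i\<bar> \<le> b" if "u \<in> ?V" for u i
  proof -
    have "\<bar>y u $ i\<bar> \<le> infnorm (y u)" by (rule component_le_infnorm_cart)
    also have "\<dots> \<le> b" unfolding b_def using fin that by (intro Max_ge) auto
    finally show ?thesis .
  qed
  define D where "D = insert 1 ((\<lambda>(u, v). \<bar>infnorm (y u - y v) - 1\<bar>) ` {(u, v) \<in> ?V \<times> ?V. u \<noteq> v})"
  have "finite {(u, v) \<in> ?V \<times> ?V. u \<noteq> v}"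
    using fin by (auto intro: finite_subset[of _ "?V \<times> ?V"])
  then have finD: "finite D" unfolding D_def by simp
  define \<delta> where "\<delta> = Min D"
  have "\<delta> \<in> D" unfolding \<delta>_def by (rule Min_in[OF finD]) (simp add: D_def)
  moreover have "0 < e" if "e \<in> D" for e
    using that y by (auto simp: D_def) (metis less_irrefl)+
  ultimately have \<delta>: "0 < \<delta>" by blast
  have \<delta>_le: "\<delta> \<le> e" if "e \<in> D" for e unfolding \<delta>_def by (rule Min_le[OF finD that])
  have "\<delta> \<le> 1" by (rule \<delta>_le) (simp add: D_def)
  have gap: "\<delta> \<le> \<bar>infnorm (y u - y v) - 1\<bar>" if "u \<in> ?V" "v \<in> ?V" "u \<noteq> v" for u v
    by (rule \<delta>_le) (use that in \<open>auto simp: D_def\<close>)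
  show thesis
  proof (rule that[of "\<delta> / 4" "\<lambda>u. y u + (\<chi> i. b + 2)" "2 * b + 4"])
    show "0 < \<delta> / 4" "\<delta> / 4 \<le> 1 / 2" using \<delta> \<open>\<delta> \<le> 1\<close> by auto
    show "2 \<le> (y u + (\<chi> i. b + 2)) $ i \<and> (y u + (\<chi> i. b + 2)) $ i \<le> 2 * b + 4 - 2" if "u \<in> ?V" for u i
      using b[OF that, of i] by (auto simp: abs_le_iff)
    show "\<bar>(y u + (\<chi> i. b + 2)) $ i - (y v + (\<chi> i. b + 2)) $ i\<bar> + 2 * (\<delta> / 4) < 1" if "(u, v) \<in> parcs H" for u v i
    proof -
      note uv = arcV[OF that]
      have "infnorm (y u - y v) < 1" "\<delta> \<le> \<bar>infnorm (y u - y v) - 1\<bar>" using y(1) gap uv that by auto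
      then show ?thesis using component_le_infnorm_cart[of "y u - y v" i] \<delta> by simp
    qed
    show "\<exists>i. \<bar>(y u + (\<chi> i. b + 2)) $ i - (y v + (\<chi> i. b + 2)) $ i\<bar> - 2 * (\<delta> / 4) > 1"
      if uv: "u \<in> ?V" "v \<in> ?V" "u \<noteq> v" "(u, v) \<notin> parcs H" for u v
    proof -
      have *: "infnorm (y u - y v) > 1" "\<delta> \<le> \<bar>infnorm (y u - y v) - 1\<bar>" using y(2) gap uv by auto
      have "infnorm (y u - y v) \<in> range (\<lambda>i. \<bar>(y u - y v) $ i\<bar>)"
        unfolding infnorm_eq_Max by (rule Max_in) auto
      then obtain i where "infnorm (y u - y v) = \<bar>(y u - y v) $ i\<bar>" by auto
      then show ?thesis using * \<delta> by (intro exI[of _ i]) simp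
    qed
  qed
qed

lemma prod_two_values:
  fixes p q :: "'b::comm_semiring_1"
  assumes "finite I" "S \<subseteq> I"
  shows "(\<Prod>i\<in>I. if i \<in> S then q else p) = q ^ card S * p ^ (card I - card S)"
proof -
  have "I \<inter> {i. i \<in> S} = S" "I \<inter> - {i. i \<in> S} = I - S" using assms(2) by auto
  then show ?thesis using assms by (simp add: prod.If_cases card_Diff_subset finite_subset)
qed

text \<open>
  Every vertex of \<open>H\<close> is only realized by points with indices in its own slot, so that
  automorphisms of \<open>H\<close> do not lead to counting a component several times.
\<close>

lemma disjoint_slots:
  assumes "finite V" "card V * m \<le> n"
  obtains B :: "'v \<Rightarrow> nat set" where "\<And>u. u \<in> V \<Longrightarrow> B u \<subseteq> {1..n}" "\<And>u. card (B u) = m"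
    "\<And>u v. u \<in> V \<Longrightarrow> v \<in> V \<Longrightarrow> B u \<inter> B v \<noteq> {} \<Longrightarrow> u = v"
proof -
  obtain h where h: "bij_betw h V {0..<card V}"
    using ex_bij_betw_finite_nat[OF assms(1)] by blast
  define B where "B u = {h u * m <.. h u * m + m}" for u
  show thesis
  proof
    show "card (B u) = m" for u by (simp add: B_def)
    show "B u \<subseteq> {1..n}" if "u \<in> V" for u
    proof -
      have "h u + 1 \<le> card V" using bij_betw_apply[OF h that] by auto
      then have "(h u + 1) * m \<le> card V * m" by (rule mult_le_mono1)
      then show ?thesis using assms(2) by (auto simp: B_def)
    qed
    show "u = v" if uv: "u \<in> V" "v \<in> V" "B u \<inter> B v \<noteq> {}" for u v
    proof -
      obtain i where "i \<in> B u" "i \<in> B v" using uv(3) by blast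
      then have i: "h u * m < i" "i \<le> h u * m + m" "h v * m < i" "i \<le> h v * m + m"
        by (simp_all add: B_def)
      have "h u = h v"
      proof (rule ccontr)
        assume "h u \<noteq> h v"
        then consider "h u + 1 \<le> h v" | "h v + 1 \<le> h u" by linarith
        then show False
        proof cases
          case 1
          then have "(h u + 1) * m \<le> h v * m" by (rule mult_le_mono1)
          then show False using i by simp
        next
          case 2
          then have "(h v + 1) * m \<le> h u * m" by (rule mult_le_mono1)
          then show False using i by simp
        qed
      qed
      then show ?thesis using h uv by (auto simp: bij_betw_def inj_on_def)
    qed
  qed
qed

section \<open>Tiles, and the components forced by a pattern in a tile\<close>

locale geometric_pattern =
  fixes H :: "nat pair_pre_digraph" and z :: "nat \<Rightarrow> real ^ 'd::finite" and \<epsilon> R :: real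
  assumes H: "pair_graph H" "Digraph_Component.connected (with_proj H)"
    and \<epsilon>: "0 < \<epsilon>" "\<epsilon> \<le> 1 / 2"
    and z: "\<And>u i. u \<in> pverts H \<Longrightarrow> 2 \<le> z u $ i \<and> z u $ i \<le> R - 2"
    and edge: "\<And>u v i. (u, v) \<in> parcs H \<Longrightarrow> \<bar>z u $ i - z v $ i\<bar> + 2 * \<epsilon> < 1"
    and nonedge: "\<And>u v. u \<in> pverts H \<Longrightarrow> v \<in> pverts H \<Longrightarrow> u \<noteq> v \<Longrightarrow> (u, v) \<notin> parcs H \<Longrightarrow>
       \<exists>i. \<bar>z u $ i - z v $ i\<bar> - 2 * \<epsilon> > 1"
begin

abbreviation "V \<equiv> pverts H"

lemma finite_V: "finite V"
  using H(1) by (simp add: pair_graph_def pair_digraph_def pair_fin_digraph_def pair_fin_digraph_axioms_def)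

lemma V_nonempty: "V \<noteq> {}"
  using H connected_with_proj_iff_cut by blast

lemma R_ge: "4 \<le> R"
proof -
  obtain u where "u \<in> V" using V_nonempty by blast
  from z[OF this] have "2 \<le> R - 2" using order_trans by blast
  then show ?thesis by simp
qed

text \<open>
  At scale \<open>\<rho>\<close>, the tile \<open>c\<close> is a cube of side \<open>R\<rho>\<close>, and \<open>region \<rho> c T i\<close> is where point \<open>i\<close> has to lie
  so that the points \<open>T u\<close> form a component realizing \<open>H\<close> in this tile.
\<close>

definition tile :: "real \<Rightarrow> ('d \<Rightarrow> int) \<Rightarrow> (real ^ 'd) set" where
  "tile \<rho> c = hbox (\<chi> i. c i * (R * \<rho>)) (\<chi> i. (real_of_int (c i) + 1) * (R * \<rho>))"

definition target :: "real \<Rightarrow> ('d \<Rightarrow> int) \<Rightarrow> nat \<Rightarrow> (real ^ 'd) set" where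
  "target \<rho> c u = hbox (\<chi> i. c i * (R * \<rho>) + \<rho> * (z u $ i - \<epsilon>)) (\<chi> i. c i * (R * \<rho>) + \<rho> * (z u $ i + \<epsilon>))"

definition region :: "real \<Rightarrow> ('d \<Rightarrow> int) \<Rightarrow> (nat \<Rightarrow> nat) \<Rightarrow> nat \<Rightarrow> (real ^ 'd) set" where
  "region \<rho> c T i = (if i \<in> T ` V then target \<rho> c (inv_into V T i) else unit_cube - tile \<rho> c)"

lemma mem_tile: "x \<in> tile \<rho> c \<longleftrightarrow> (\<forall>i. c i * (R * \<rho>) \<le> x $ i \<and> x $ i < (real_of_int (c i) + 1) * (R * \<rho>))"
  by (simp add: tile_def hbox_def)

lemma mem_target: "x \<in> target \<rho> c u \<longleftrightarrow>
    (\<forall>i. c i * (R * \<rho>) + \<rho> * (z u $ i - \<epsilon>) \<le> x $ i \<and> x $ i < c i * (R * \<rho>) + \<rho> * (z u $ i + \<epsilon>))"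
  by (simp add: target_def hbox_def)

lemma sets_region: "region \<rho> c T i \<in> sets borel"
  by (simp add: region_def target_def tile_def sets_hbox sets.Diff)

text \<open>The margin 2 of \<open>z\<close>, less the tolerance
  \<open>\<epsilon> \<le> 1 / 2\<close>. That \<open>3 / 2\<close> exceeds 1 is what separates the
  pattern from every point outside the tile.\<close>

lemma target_margin:
  assumes \<rho>: "0 < \<rho>" and u: "u \<in> V" and x: "x \<in> target \<rho> c u"
  shows "c i * (R * \<rho>) + 3 / 2 * \<rho> \<le> x $ i" "x $ i < (real_of_int (c i) + 1) * (R * \<rho>) - 3 / 2 * \<rho>"
proof -
  have x: "c i * (R * \<rho>) + \<rho> * (z u $ i - \<epsilon>) \<le> x $ i" "x $ i < c i * (R * \<rho>) + \<rho> * (z u $ i + \<epsilon>)"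
    using x by (auto simp: mem_target)
  have "\<rho> * (3 / 2) \<le> \<rho> * (z u $ i - \<epsilon>)" "\<rho> * (z u $ i + \<epsilon>) \<le> \<rho> * (R - 3 / 2)"
    using z[OF u, of i] \<epsilon> \<rho> by (auto intro!: mult_left_mono)
  then show "c i * (R * \<rho>) + 3 / 2 * \<rho> \<le> x $ i" "x $ i < (real_of_int (c i) + 1) * (R * \<rho>) - 3 / 2 * \<rho>"
    using x by (auto simp: algebra_simps)
qed

lemma target_subset_tile:
  assumes "0 < \<rho>" "u \<in> V"
  shows "target \<rho> c u \<subseteq> tile \<rho> c"
proof
  fix x assume x: "x \<in> target \<rho> c u"
  show "x \<in> tile \<rho> c"
    unfolding mem_tile
  proof
    fix i
    show "c i * (R * \<rho>) \<le> x $ i \<and> x $ i < (real_of_int (c i) + 1) * (R * \<rho>)"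
      using target_margin[OF assms x, of i] assms(1) by linarith
  qed
qed

lemma tiles_disjoint:
  assumes "0 < \<rho>" "c \<noteq> c'"
  shows "tile \<rho> c \<inter> tile \<rho> c' = {}"
proof (rule ccontr)
  assume "tile \<rho> c \<inter> tile \<rho> c' \<noteq> {}"
  then obtain x where x: "x \<in> tile \<rho> c" "x \<in> tile \<rho> c'" by blast
  have w: "0 < R * \<rho>" using R_ge assms by simp
  have "c i = c' i" for i
  proof -
    have "c i * (R * \<rho>) < (real_of_int (c' i) + 1) * (R * \<rho>)" "c' i * (R * \<rho>) < (real_of_int (c i) + 1) * (R * \<rho>)"
      using x by (auto simp: mem_tile intro: order.strict_trans1)
    then have "real_of_int (c i) < real_of_int (c' i) + 1" "real_of_int (c' i) < real_of_int (c i) + 1" using w by (auto simp: mult_less_cancel_right)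
    then show ?thesis by linarith
  qed
  then show False using assms by blast
qed

definition tile_index :: "nat \<Rightarrow> ('d \<Rightarrow> int) set" where
  "tile_index L = PiE UNIV (\<lambda>_. {0..<int L})"

lemma card_tile_index: "card (tile_index L) = L ^ CARD('d)" and finite_tile_index: "finite (tile_index L)"
  by (simp_all add: tile_index_def card_PiE finite_PiE)

lemma tile_bounds:
  assumes \<rho>: "0 < \<rho>" and L: "real L * (R * \<rho>) \<le> 1" and c: "c \<in> tile_index L"
  shows "0 \<le> c i * (R * \<rho>)" "(real_of_int (c i) + 1) * (R * \<rho>) \<le> 1"
proof -
  have w: "0 < R * \<rho>" using R_ge \<rho> by simp
  have "c i \<in> {0..<int L}" using c by (auto simp: tile_index_def PiE_iff)
  then have ci: "0 \<le> c i" "c i + 1 \<le> int L" by auto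
  then have "real_of_int (c i) + 1 \<le> real L" by linarith
  then have "(real_of_int (c i) + 1) * (R * \<rho>) \<le> real L * (R * \<rho>)" using w by (intro mult_right_mono) auto
  then show "(real_of_int (c i) + 1) * (R * \<rho>) \<le> 1" using L by simp
  show "0 \<le> c i * (R * \<rho>)" using ci w by simp
qed

lemma measure_tile:
  assumes "0 < \<rho>" "real L * (R * \<rho>) \<le> 1" "c \<in> tile_index L"
  shows "measure uniform_torus (tile \<rho> c) = (R * \<rho>) ^ CARD('d)" "tile \<rho> c \<subseteq> unit_cube"
proof -
  have w: "0 < R * \<rho>" using R_ge assms by simp
  show "tile \<rho> c \<subseteq> unit_cube"
    unfolding tile_def using tile_bounds[OF assms] by (intro hbox_subset_unit_cube) auto
  have "measure uniform_torus (tile \<rho> c) = (\<Prod>i::'d\<in>UNIV. (real_of_int (c i) + 1) * (R * \<rho>) - c i * (R * \<rho>))"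
    unfolding tile_def using tile_bounds[OF assms] w by (subst measure_uniform_torus_hbox) (auto simp: distrib_right)
  also have "\<dots> = (\<Prod>i::'d\<in>UNIV. R * \<rho>)" by (simp add: distrib_right)
  finally show "measure uniform_torus (tile \<rho> c) = (R * \<rho>) ^ CARD('d)" by simp
qed

lemma measure_target:
  assumes "0 < \<rho>" "real L * (R * \<rho>) \<le> 1" "c \<in> tile_index L" "u \<in> V"
  shows "measure uniform_torus (target \<rho> c u) = (2 * \<epsilon> * \<rho>) ^ CARD('d)"
proof -
  have "\<rho> * (z u $ i - \<epsilon>) \<ge> 0" "\<rho> * (z u $ i + \<epsilon>) \<le> \<rho> * R" "\<rho> * (z u $ i - \<epsilon>) \<le> \<rho> * (z u $ i + \<epsilon>)" for i
    using z[OF assms(4), of i] \<epsilon> assms(1) by (auto intro!: mult_left_mono)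
  note b = this tile_bounds[OF assms(1-3)]
  have lo: "0 \<le> c i * (R * \<rho>) + \<rho> * (z u $ i - \<epsilon>)" for i using b(1,4)[of i] by linarith
  have hi: "c i * (R * \<rho>) + \<rho> * (z u $ i + \<epsilon>) \<le> 1" for i using b(2,5)[of i] by (simp add: algebra_simps)
  have "measure uniform_torus (target \<rho> c u) = (\<Prod>i::'d\<in>UNIV. (c i * (R * \<rho>) + \<rho> * (z u $ i + \<epsilon>)) - (c i * (R * \<rho>) + \<rho> * (z u $ i - \<epsilon>)))"
    unfolding target_def using lo hi b(3) by (subst measure_uniform_torus_hbox) auto
  also have "\<dots> = (\<Prod>i::'d\<in>UNIV. 2 * \<epsilon> * \<rho>)" by (intro prod.cong) (auto simp: algebra_simps)
  finally show ?thesis by simp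
qed

lemma measure_outside2:
  assumes \<rho>: "0 < \<rho>" "real L * (R * \<rho>) \<le> 1" and c: "c \<in> tile_index L" "c' \<in> tile_index L" "c \<noteq> c'"
  shows "measure uniform_torus (unit_cube - (tile \<rho> c \<union> tile \<rho> c')) = 1 - 2 * (R * \<rho>) ^ CARD('d)"
proof -
  interpret U: prob_space "uniform_torus :: (real ^ 'd) measure" by (rule prob_space_uniform_torus)
  have st: "sets uniform_torus = sets (borel :: (real^'d) measure)" by (simp add: uniform_torus_def)
  have meas: "unit_cube \<in> U.events" "tile \<rho> c \<in> U.events" "tile \<rho> c' \<in> U.events"
    unfolding st tile_def by (rule sets_hbox)+
  note t = measure_tile[OF \<rho> c(1)] and t' = measure_tile[OF \<rho> c(2)]
  have "measure uniform_torus (tile \<rho> c \<union> tile \<rho> c') = 2 * (R * \<rho>) ^ CARD('d)"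
    using t t' by (subst U.finite_measure_Union[OF meas(2,3) tiles_disjoint[OF \<rho>(1) c(3)]]) auto
  moreover have "tile \<rho> c \<union> tile \<rho> c' \<in> U.events" using meas by auto
  ultimately show "measure uniform_torus (unit_cube - (tile \<rho> c \<union> tile \<rho> c')) = 1 - 2 * (R * \<rho>) ^ CARD('d)"
    using t t' meas by (subst U.finite_measure_Diff) (auto simp: measure_uniform_torus_unit_cube)
qed

lemma measure_outside:
  assumes \<rho>: "0 < \<rho>" "real L * (R * \<rho>) \<le> 1" and c: "c \<in> tile_index L"
  shows "measure uniform_torus (unit_cube - tile \<rho> c) = 1 - (R * \<rho>) ^ CARD('d)"
proof -
  interpret U: prob_space "uniform_torus :: (real ^ 'd) measure" by (rule prob_space_uniform_torus)
  have st: "sets uniform_torus = sets (borel :: (real^'d) measure)" by (simp add: uniform_torus_def)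
  have meas: "unit_cube \<in> U.events" "tile \<rho> c \<in> U.events"
    unfolding st tile_def by (rule sets_hbox)+
  note t = measure_tile[OF \<rho> c]
  show ?thesis
    using t by (subst U.finite_measure_Diff[OF meas]) (auto simp: measure_uniform_torus_unit_cube)
qed

text \<open>Inside the tile the tolerance \<open>2 * \<epsilon>\<close> absorbs the displacements of
  both endpoints, so adjacency is that of \<open>H\<close>; points outside are too far away to be
  adjacent. The alternative in \<open>r\<close> reflects that a single vertex only has to be
  isolated, for which a radius below \<open>\<rho>\<close> will do.\<close>

lemma graph_of_pattern:
  assumes \<rho>: "0 < \<rho>" "real L * (R * \<rho>) \<le> 1" "2 * (R * \<rho>) \<le> 1" and c: "c \<in> tile_index L"
    and T: "inj_on T V" "T ` V \<subseteq> {1..n}"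
    and x: "\<And>i. i \<in> {1..n} \<Longrightarrow> x i \<in> region \<rho> c T i"
    and r: "r \<le> \<rho>" "card V = 1 \<or> r = \<rho>"
  shows "block (torus_graph n r x) (T ` V)" "graph_iso T H (induced (torus_graph n r x) (T ` V))"
proof -
  let ?G = "torus_graph n r x"
  have xt: "x (T u) \<in> target \<rho> c u" if "u \<in> V" for u
    using x[of "T u"] T that by (auto simp: region_def)
  have arc: "(u, v) \<in> parcs H \<longleftrightarrow> torus_dist (x (T u)) (x (T v)) \<le> r" if uv: "u \<in> V" "v \<in> V" "u \<noteq> v" for u v
  proof -
    have "card V \<noteq> 1" using uv by (auto simp: card_1_singleton_iff)
    then have r\<rho>: "r = \<rho>" using r by simp
    \<comment> \<open>The tile has side at most \<open>1 / 2\<close>, so distances inside it do not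
      wrap around.\<close>
    have norm: "torus_norm (x (T u) $ i - x (T v) $ i) = \<bar>x (T u) $ i - x (T v) $ i\<bar>" for i
    proof -
      have "x (T u) \<in> tile \<rho> c" "x (T v) \<in> tile \<rho> c"
        using xt target_subset_tile[OF \<rho>(1)] uv by blast+
      then have "c i * (R * \<rho>) \<le> x (T u) $ i" "x (T u) $ i < c i * (R * \<rho>) + R * \<rho>"
        "c i * (R * \<rho>) \<le> x (T v) $ i" "x (T v) $ i < c i * (R * \<rho>) + R * \<rho>"
        by (auto simp: mem_tile distrib_right)
      then have "\<bar>x (T u) $ i - x (T v) $ i\<bar> \<le> 1 / 2" using \<rho>(3) by linarith
      then show ?thesis using torus_norm_small[of _ 0] by simp
    qed
    have t: "c i * (R * \<rho>) + (\<rho> * z u $ i - \<rho> * \<epsilon>) \<le> x (T u) $ i" "x (T u) $ i < c i * (R * \<rho>) + (\<rho> * z u $ i + \<rho> * \<epsilon>)"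
      "c i * (R * \<rho>) + (\<rho> * z v $ i - \<rho> * \<epsilon>) \<le> x (T v) $ i" "x (T v) $ i < c i * (R * \<rho>) + (\<rho> * z v $ i + \<rho> * \<epsilon>)" for i
      using xt[OF uv(1)] xt[OF uv(2)] by (auto simp: mem_target distrib_left right_diff_distrib)
    have abs\<rho>: "\<bar>\<rho> * z u $ i - \<rho> * z v $ i\<bar> = \<rho> * \<bar>z u $ i - z v $ i\<bar>" for i
      using \<rho>(1) by (simp add: abs_mult flip: right_diff_distrib)
    show ?thesis
    proof
      assume e: "(u, v) \<in> parcs H"
      have "\<bar>x (T u) $ i - x (T v) $ i\<bar> \<le> \<rho>" for i
      proof -
        have "\<rho> * (\<bar>z u $ i - z v $ i\<bar> + 2 * \<epsilon>) \<le> \<rho> * 1"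
          using edge[OF e, of i] \<rho>(1) by (intro mult_left_mono) auto
        then have "\<bar>\<rho> * z u $ i - \<rho> * z v $ i\<bar> + 2 * (\<rho> * \<epsilon>) \<le> \<rho>"
          unfolding abs\<rho> by (simp add: algebra_simps)
        then show ?thesis using t[of i] by linarith
      qed
      then show "torus_dist (x (T u)) (x (T v)) \<le> r" by (simp add: torus_dist_le_iff norm r\<rho>)
    next
      assume d: "torus_dist (x (T u)) (x (T v)) \<le> r"
      show "(u, v) \<in> parcs H"
      proof (rule ccontr)
        assume "(u, v) \<notin> parcs H"
        then obtain i where i: "\<bar>z u $ i - z v $ i\<bar> - 2 * \<epsilon> > 1" using nonedge uv by blast
        then have "\<rho> * 1 < \<rho> * (\<bar>z u $ i - z v $ i\<bar> - 2 * \<epsilon>)"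
          using \<rho>(1) by (intro mult_strict_left_mono) auto
        then have "\<rho> < \<bar>\<rho> * z u $ i - \<rho> * z v $ i\<bar> - 2 * (\<rho> * \<epsilon>)"
          unfolding abs\<rho> by (simp add: algebra_simps)
        then have "\<rho> < \<bar>x (T u) $ i - x (T v) $ i\<bar>" using t[of i] by linarith
        moreover have "torus_norm (x (T u) $ i - x (T v) $ i) \<le> \<rho>"
          using d by (simp add: torus_dist_le_iff r\<rho>)
        then have "\<bar>x (T u) $ i - x (T v) $ i\<bar> \<le> \<rho>" unfolding norm .
        ultimately show False by simp
      qed
    qed
  qed
  have loop: "(u, u) \<notin> parcs H" for u
  proof -
    interpret pair_graph H by (rule H(1))
    show ?thesis using pair_no_loops[of "(u, u)"] by auto
  qed
  show iso: "graph_iso T H (induced ?G (T ` V))"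
    unfolding graph_iso_def induced_simps
  proof (intro conjI ballI)
    show "bij_betw T V (T ` V)" using T(1) by (simp add: bij_betw_def)
    fix u v assume uv: "u \<in> V" "v \<in> V"
    have ends: "T u \<in> {1..n}" "T v \<in> {1..n}" using T(2) uv by auto
    show "(u, v) \<in> parcs H \<longleftrightarrow> (T u, T v) \<in> {(a, b). (a, b) \<in> parcs ?G \<and> a \<in> T ` V \<and> b \<in> T ` V}"
    proof (cases "u = v")
      case True
      then show ?thesis using loop by (simp add: torus_graph_arc_iff)
    next
      case False
      then have "T u \<noteq> T v" using T(1) uv by (auto dest: inj_onD)
      then show ?thesis using arc[OF uv False] uv ends by (simp add: torus_graph_arc_iff)
    qed
  qed
  have far: "r < torus_dist (x (T u)) (x j)" if u: "u \<in> V" and j: "j \<in> {1..n}" "j \<notin> T ` V" for u j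
  proof -
    have xj: "x j \<in> unit_cube" "x j \<notin> tile \<rho> c" using x[OF j(1)] j(2) by (auto simp: region_def)
    then obtain i where i: "\<not> (c i * (R * \<rho>) \<le> x j $ i \<and> x j $ i < (real_of_int (c i) + 1) * (R * \<rho>))"
      unfolding mem_tile by blast
    have y: "0 \<le> x j $ i" "x j $ i < 1" using xj(1) by (auto simp: hbox_def)
    note m = target_margin[OF \<rho>(1) u xt[OF u], of i]
    note b = tile_bounds[OF \<rho>(1,2) c, of i]
    \<comment> \<open>For \<open>n = 0\<close> the coordinate \<open>i\<close> of \<open>x j\<close>
      is outside the range of the tile and the margin applies. For other translates the tile lies in
      the unit cube, so the pattern point stays \<open>3 / 2 * \<rho>\<close> away from 0 and 1,
      while \<open>x j $ i\<close> is in between; this is why \<open>region\<close> keeps the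
      remaining points in \<open>unit_cube\<close>.\<close>
    have "\<rho> < \<bar>x (T u) $ i - x j $ i - of_int n\<bar>" for n :: int
    proof -
      consider "n = 0" | "1 \<le> n" | "n \<le> -1" by linarith
      then show ?thesis
      proof cases
        case 1
        then show ?thesis using i m \<rho>(1) by (simp only: of_int_0) linarith
      next
        case 2
        then have "1 \<le> real_of_int n" by simp
        then show ?thesis using m b y \<rho>(1) by linarith
      next
        case 3
        then have "real_of_int n \<le> -1" by simp
        then show ?thesis using m b y \<rho>(1) by linarith
      qed
    qed
    then have "\<rho> < torus_norm (x (T u) $ i - x j $ i)" by (simp add: torus_norm_attained)
    then show ?thesis using torus_norm_le_dist[of "x (T u)" i "x j"] r(1) by linarith
  qed
  have G: "pair_graph ?G" by (rule pair_graph_torus_graph)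
  have half: "b \<in> T ` V" if "(a, b) \<in> parcs ?G" "a \<in> T ` V" for a b
    using that far[of _ b] by (fastforce simp: torus_graph_arc_iff)
  show "block ?G (T ` V)"
  proof (rule block_if_graph_iso[OF H _ iso])
    show "T ` V \<subseteq> pverts ?G" using T(2) by simp
    show "a \<in> T ` V \<longleftrightarrow> b \<in> T ` V" if "(a, b) \<in> parcs ?G" for a b
      using half[OF that] half[OF pair_graph_sym[OF G that]] by blast
  qed
qed

end

text \<open>The events are indexed by a tile \<open>c\<close> and a choice \<open>T\<close> of one
  index from the slot of each vertex. Different occurring events yield different components, so
  their number is a lower bound for the component count; \<open>\<mu>\<close> is its mean.\<close>

lemma (in geometric_pattern) prob_few_components:
  fixes M :: "'w measure" and X :: "nat \<Rightarrow> 'w \<Rightarrow> real ^ 'd"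
  assumes M: "prob_space M" and indep: "prob_space.indep_vars M (\<lambda>_. borel) X {1..n}"
    and uniform: "\<And>i. i \<in> {1..n} \<Longrightarrow> distr M borel (X i) = uniform_torus"
    and \<rho>: "0 < \<rho>" "real L * (R * \<rho>) \<le> 1" "2 * (R * \<rho>) \<le> 1" and r: "r \<le> \<rho>" "card V = 1 \<or> r = \<rho>"
    and n: "2 * card V \<le> n" and p: "p = (R * \<rho>) ^ CARD('d)"
    and \<mu>: "\<mu> = real L ^ CARD('d) * real (n div card V) ^ card V *
      ((2 * \<epsilon> * \<rho>) ^ (CARD('d) * card V) * (1 - p) ^ (n - card V))" "0 < \<mu>"
  shows "measure M {\<omega> \<in> space M. real (num_components_iso (torus_graph n r (\<lambda>i. X i \<omega>)) H) \<le> \<mu> / 2}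
    \<le> 4 / \<mu> + 4 * ((1 / (1 - p)) ^ (2 * card V) - 1)"
proof -
  interpret prob_space M by (rule M)
  interpret U: prob_space "uniform_torus :: (real ^ 'd) measure" by (rule prob_space_uniform_torus)
  have st: "sets uniform_torus = sets (borel :: (real^'d) measure)" by (simp add: uniform_torus_def)
  let ?s = "card V" and ?m = "n div card V"
  define q where "q = (2 * \<epsilon> * \<rho>) ^ CARD('d)"
  define a where "a = q ^ ?s * (1 - p) ^ (n - ?s)"
  have q: "0 \<le> q" using \<epsilon> \<rho>(1) by (simp add: q_def)
  have w: "0 < R * \<rho>" using R_ge \<rho>(1) by simp
  have p_bounds: "0 \<le> p" "p \<le> 1 / 2"
  proof -
    have "(R * \<rho>) ^ CARD('d) \<le> (R * \<rho>) ^ 1"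
      using w \<rho>(3) by (intro power_decreasing) (auto simp: Suc_leI)
    then show "p \<le> 1 / 2" using \<rho>(3) by (simp add: p)
    show "0 \<le> p" using w by (simp add: p)
  qed
  have "?s * ?m \<le> n" by simp
  then obtain B :: "nat \<Rightarrow> nat set" where B: "\<And>u. u \<in> V \<Longrightarrow> B u \<subseteq> {1..n}" "\<And>u. card (B u) = ?m"
    "\<And>u v. u \<in> V \<Longrightarrow> v \<in> V \<Longrightarrow> B u \<inter> B v \<noteq> {} \<Longrightarrow> u = v"
    using disjoint_slots[OF finite_V] by blast
  define J where "J = tile_index L \<times> PiE V B"
  define A where "A = (\<lambda>(c, T). {\<omega> \<in> space M. \<forall>i\<in>{1..n}. X i \<omega> \<in> region \<rho> c T i})"
  have "finite (PiE V B)" using finite_V B(1) by (auto intro!: finite_PiE dest: finite_subset)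
  then have finJ: "finite J" by (simp add: J_def finite_tile_index)
  have cardJ: "card J = L ^ CARD('d) * ?m ^ ?s"
    unfolding J_def using finite_V B(2) by (simp add: card_cartesian_product card_tile_index card_PiE)
  have same_slot: "u = v" if "T \<in> PiE V B" "T' \<in> PiE V B" "u \<in> V" "v \<in> V" "T u = T' v" for T T' u v
  proof -
    have "T u \<in> B u" "T' v \<in> B v"
      by (rule PiE_mem[OF that(1,3)], rule PiE_mem[OF that(2,4)])
    then show ?thesis using B(3)[OF that(3,4)] that(5) by auto
  qed
  have inj: "inj_on T V" if "T \<in> PiE V B" for T using same_slot[OF that that] by (auto intro: inj_onI)
  have range: "T ` V \<subseteq> {1..n}" if T: "T \<in> PiE V B" for T
  proof
    fix i assume "i \<in> T ` V"
    then obtain u where "u \<in> V" "i = T u" by auto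
    then show "i \<in> {1..n}" using B(1) PiE_mem[OF T] by blast
  qed
  have card_range: "card (T ` V) = ?s" if "T \<in> PiE V B" for T using inj[OF that] by (rule card_image)
  have ev: "A j \<in> events" for j
  proof (cases j)
    case (Pair c T)
    then show ?thesis unfolding A_def
      using prob_indep_all(2)[OF indep subset_refl _ uniform sets_region] by simp
  qed
  have meas_region: "measure uniform_torus (region \<rho> c T i) = (if i \<in> T ` V then q else 1 - p)"
    if "c \<in> tile_index L" for c T i
  proof (cases "i \<in> T ` V")
    case True
    then show ?thesis
      using measure_target[OF \<rho>(1,2) that inv_into_into[OF True]] by (simp add: region_def q_def)
  next
    case False
    then show ?thesis using measure_outside[OF \<rho>(1,2) that] by (simp add: region_def p)
  qed
  have prA: "prob (A j) = a" if jJ: "j \<in> J" for j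
  proof -
    obtain c T where j: "j = (c, T)" "c \<in> tile_index L" "T \<in> PiE V B" using jJ by (auto simp: J_def)
    have "prob (A j) = (\<Prod>i\<in>{1..n}. measure uniform_torus (region \<rho> c T i))"
      unfolding A_def j prod.case by (rule prob_indep_all(1)[OF indep subset_refl _ uniform sets_region]) auto
    also have "\<dots> = (\<Prod>i\<in>{1..n}. if i \<in> T ` V then q else 1 - p)"
      by (simp only: meas_region[OF j(2)])
    also have "\<dots> = a"
      by (subst prod_two_values) (use range[OF j(3)] card_range[OF j(3)] in \<open>auto simp: a_def\<close>)
    finally show ?thesis .
  qed
  have in_target: "X (T u) \<omega> \<in> target \<rho> c u" if "(c, T) \<in> J" "\<omega> \<in> A (c, T)" "u \<in> V" for c T u \<omega>
  proof -
    have T: "T \<in> PiE V B" using that(1) by (simp add: J_def)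
    have "T u \<in> {1..n}" using range[OF T] that(3) by blast
    then have "X (T u) \<omega> \<in> region \<rho> c T (T u)" using that(2) unfolding A_def by blast
    then show ?thesis using inj[OF T] that(3) by (simp add: region_def)
  qed
  have in_tile: "X (T u) \<omega> \<in> tile \<rho> c" if "(c, T) \<in> J" "\<omega> \<in> A (c, T)" "u \<in> V" for c T u \<omega>
    using in_target[OF that] target_subset_tile[OF \<rho>(1) that(3)] by blast
  \<comment> \<open>A shared index puts one point into both tiles, so the tiles coincide. In a
    common tile each pattern accounts for all the points present, so the index sets coincide, and
    the slots tell which vertex an index stands for.\<close>
  have same: "(c, T) = (c', T')"
    if j: "(c, T) \<in> J" "\<omega> \<in> A (c, T)" and j': "(c', T') \<in> J" "\<omega> \<in> A (c', T')"
      and or: "c = c' \<or> T ` V \<inter> T' ` V \<noteq> {}" for c T c' T' \<omega>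
  proof -
    have T: "T \<in> PiE V B" "T' \<in> PiE V B" using j j' by (auto simp: J_def)
    have "c = c'"
    proof (rule ccontr)
      assume "c \<noteq> c'"
      with or obtain u v where uv: "u \<in> V" "v \<in> V" "T u = T' v" by auto
      have "X (T u) \<omega> \<in> tile \<rho> c \<inter> tile \<rho> c'"
        using in_tile[OF j uv(1)] in_tile[OF j' uv(2)] uv(3) by simp
      then show False using tiles_disjoint[OF \<rho>(1) \<open>c \<noteq> c'\<close>] by blast
    qed
    moreover have "T u = T' u" if u: "u \<in> V" for u
    proof -
      have n: "T u \<in> {1..n}" using range[OF T(1)] u by blast
      have "T u \<in> T' ` V"
      proof (rule ccontr)
        assume "T u \<notin> T' ` V"
        moreover have "X (T u) \<omega> \<in> region \<rho> c' T' (T u)" using j'(2) n unfolding A_def by blast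
        ultimately show False using in_tile[OF j u] \<open>c = c'\<close> by (simp add: region_def)
      qed
      then obtain v where v: "v \<in> V" "T u = T' v" by auto
      then have "u = v" using same_slot[OF T u] by blast
      then show ?thesis using v by simp
    qed
    then have "T = T'" using T by (intro PiE_ext) auto
    ultimately show ?thesis by simp
  qed
  \<comment> \<open>Two compatible patterns fix \<open>2 * card V\<close> indices and leave
    \<open>n - 2 * card V\<close> outside both tiles, whereas \<open>a\<^sup>2\<close> contains
    \<open>2 * (n - card V)\<close> factors \<open>1 - p\<close>. As
    \<open>1 - 2 * p \<le> (1 - p)\<^sup>2\<close>, the only loss is the surplus of
    \<open>2 * card V\<close> factors, and \<open>\<kappa>\<close> makes up for it.\<close>
  define \<kappa> where "\<kappa> = (1 / (1 - p)) ^ (2 * ?s)"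
  have pair: "prob (A j \<inter> A j') \<le> \<kappa> * a\<^sup>2" if jj: "j \<in> J" "j' \<in> J" "j \<noteq> j'" for j j'
  proof -
    obtain c T where j: "j = (c, T)" by fastforce
    obtain c' T' where j': "j' = (c', T')" by fastforce
    have c: "c \<in> tile_index L" "c' \<in> tile_index L" and T: "T \<in> PiE V B" "T' \<in> PiE V B"
      using jj by (auto simp: j j' J_def)
    show ?thesis
    proof (cases "c = c' \<or> T ` V \<inter> T' ` V \<noteq> {}")
      case True
      then have "A j \<inter> A j' = {}" using same[of c T _ c' T'] jj unfolding j j' by blast
      moreover have "0 \<le> \<kappa> * a\<^sup>2" using p_bounds by (simp add: \<kappa>_def)
      ultimately show ?thesis by simp
    next
      case False
      let ?S = "T ` V \<union> T' ` V"
      let ?F = "\<lambda>i. region \<rho> c T i \<inter> region \<rho> c' T' i"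
      have S: "?S \<subseteq> {1..n}" "card ?S = 2 * ?s"
        using range[OF T(1)] range[OF T(2)] False finite_V card_range[OF T(1)] card_range[OF T(2)]
        by (auto simp: card_Un_disjoint)
      have "A j \<inter> A j' = {\<omega> \<in> space M. \<forall>i\<in>{1..n}. X i \<omega> \<in> ?F i}" unfolding A_def j j' by auto
      then have "prob (A j \<inter> A j') = (\<Prod>i\<in>{1..n}. measure uniform_torus (?F i))"
        using prob_indep_all(1)[OF indep subset_refl _ uniform sets.Int[OF sets_region sets_region]] by simp
      also have "\<dots> \<le> (\<Prod>i\<in>{1..n}. if i \<in> ?S then q else 1 - 2 * p)"
      proof (intro prod_mono conjI)
        fix i assume "i \<in> {1..n}"
        show "measure uniform_torus (?F i) \<le> (if i \<in> ?S then q else 1 - 2 * p)"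
        proof (cases "i \<in> ?S")
          case True
          have "measure uniform_torus (?F i) \<le> measure uniform_torus (region \<rho> c T i)"
            "measure uniform_torus (?F i) \<le> measure uniform_torus (region \<rho> c' T' i)"
            by (intro U.finite_measure_mono; simp add: st sets_region)+
          then show ?thesis using True meas_region[OF c(1)] meas_region[OF c(2)] by (auto split: if_splits)
        next
          case out: False
          then have "?F i = unit_cube - (tile \<rho> c \<union> tile \<rho> c')" by (auto simp: region_def)
          then show ?thesis using out measure_outside2[OF \<rho>(1,2) c] False by (simp add: p)
        qed
      qed simp
      also have "\<dots> = q ^ (2 * ?s) * (1 - 2 * p) ^ (n - 2 * ?s)"
        by (subst prod_two_values) (use S in auto)
      also have "\<dots> \<le> q ^ (2 * ?s) * ((1 - p)\<^sup>2) ^ (n - 2 * ?s)"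
        using p_bounds q by (intro mult_left_mono power_mono) (auto simp: power2_eq_square algebra_simps)
      also have "\<dots> = \<kappa> * a\<^sup>2"
      proof -
        have "2 * (n - ?s) = 2 * (n - 2 * ?s) + 2 * ?s" using n by simp
        then have "((1 - p) ^ (n - ?s))\<^sup>2 = ((1 - p)\<^sup>2) ^ (n - 2 * ?s) * (1 - p) ^ (2 * ?s)"
          by (metis power_add power_mult mult.commute)
        moreover have "(1 / (1 - p)) ^ (2 * ?s) * (1 - p) ^ (2 * ?s) = 1"
          using p_bounds by (simp flip: power_mult_distrib)
        moreover have "(q ^ ?s)\<^sup>2 = q ^ (2 * ?s)" by (metis power_mult mult.commute)
        ultimately show ?thesis by (simp add: \<kappa>_def a_def power_mult_distrib)
      qed
      finally show ?thesis .
    qed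
  qed
  have \<mu>': "\<mu> = real (card J) * a" unfolding \<mu>(1) cardJ a_def q_def by (simp add: power_mult)
  have \<kappa>0: "0 \<le> \<kappa>" using p_bounds by (simp add: \<kappa>_def)
  note sm = second_moment_count[OF finJ ev prA pair \<kappa>0 \<mu>' \<mu>(2)]
  have count: "card {j \<in> J. \<omega> \<in> A j} \<le> num_components_iso (torus_graph n r (\<lambda>i. X i \<omega>)) H" for \<omega>
  proof -
    let ?G = "torus_graph n r (\<lambda>i. X i \<omega>)"
    have G: "pair_graph ?G" by (rule pair_graph_torus_graph)
    let ?C = "\<lambda>S. with_proj (induced ?G S)"
    have "{S. block ?G S} \<subseteq> Pow {1..n}" using block_subset by fastforce
    then have "finite {S. block ?G S}" by (rule finite_subset) simp
    then have fin: "finite {C \<in> graph_components ?G. digraph_iso C (with_proj H)}"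
      by (simp add: graph_components_eq[OF G])
    have pattern: "block ?G (T ` V)" "graph_iso T H (induced ?G (T ` V))"
      if "(c, T) \<in> J" "\<omega> \<in> A (c, T)" for c T
    proof -
      have cT: "c \<in> tile_index L" "T \<in> PiE V B" using that(1) by (auto simp: J_def)
      have x: "X i \<omega> \<in> region \<rho> c T i" if "i \<in> {1..n}" for i using \<open>\<omega> \<in> A (c, T)\<close> that unfolding A_def by blast
      show "block ?G (T ` V)" "graph_iso T H (induced ?G (T ` V))"
        using graph_of_pattern[OF \<rho> cT(1) inj[OF cT(2)] range[OF cT(2)] x r] by auto
    qed
    have "inj_on (\<lambda>(c, T). ?C (T ` V)) {j \<in> J. \<omega> \<in> A j}"
    proof (rule inj_onI, clarify)
      fix c T c' T' assume *: "(c, T) \<in> J" "\<omega> \<in> A (c, T)" "(c', T') \<in> J" "\<omega> \<in> A (c', T')"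
        and "?C (T ` V) = ?C (T' ` V)"
      then have "T ` V = T' ` V" by (metis induced_simps(1) with_proj_simps(1))
      then have "T ` V \<inter> T' ` V \<noteq> {}" using V_nonempty by simp
      then show "c = c' \<and> T = T'" using same[OF *] by simp
    qed
    moreover have "(\<lambda>(c, T). ?C (T ` V)) ` {j \<in> J. \<omega> \<in> A j}
        \<subseteq> {C \<in> graph_components ?G. digraph_iso C (with_proj H)}"
    proof clarify
      fix c T assume *: "(c, T) \<in> J" "\<omega> \<in> A (c, T)"
      have "digraph_iso (?C (T ` V)) (with_proj H)"
        using graph_iso_inv[OF pattern(2)[OF *]]
        by (subst digraph_iso_with_proj_iff[OF pair_wf_induced pair_graph_imp_pair_wf[OF H(1)]]) blast
      then show "?C (T ` V) \<in> graph_components ?G \<and> digraph_iso (?C (T ` V)) (with_proj H)"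
        using pattern(1)[OF *] by (simp add: graph_components_eq[OF G])
    qed
    ultimately show ?thesis unfolding num_components_iso_def using fin by (rule card_inj_on_le)
  qed
  have "prob {\<omega> \<in> space M. real (num_components_iso (torus_graph n r (\<lambda>i. X i \<omega>)) H) \<le> \<mu> / 2}
      \<le> prob {\<omega> \<in> space M. real (card {j \<in> J. \<omega> \<in> A j}) \<le> \<mu> / 2}"
  proof (rule finite_measure_mono)
    show "{\<omega> \<in> space M. real (num_components_iso (torus_graph n r (\<lambda>i. X i \<omega>)) H) \<le> \<mu> / 2}
      \<subseteq> {\<omega> \<in> space M. real (card {j \<in> J. \<omega> \<in> A j}) \<le> \<mu> / 2}"
    proof clarify
      fix \<omega> assume "real (num_components_iso (torus_graph n r (\<lambda>i. X i \<omega>)) H) \<le> \<mu> / 2"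
      then show "real (card {j \<in> J. \<omega> \<in> A j}) \<le> \<mu> / 2" using count[of \<omega>] by linarith
    qed
  qed (rule sm(2))
  also have "\<dots> \<le> 4 / \<mu> + 4 * (\<kappa> - 1)" by (rule sm(1))
  finally show ?thesis unfolding \<kappa>_def .
qed

section \<open>Abundance of components and the zero-one law\<close>

text \<open>Relabelled on \<open>{..<s}\<close>, a representative becomes one of finitely many arc
  sets; equal arc sets mean isomorphic, hence equal, representatives. Finiteness matters because
  statements holding with high probability are only combined finitely often.\<close>

lemma finite_geometric_representatives:
  assumes "geometric_representatives d s R"
  shows "finite R"
proof -
  have R: "\<And>H. H \<in> R \<Longrightarrow> strictly_geometric d H \<and> card (pverts H) = s"
    and ex1: "\<And>K :: nat pair_pre_digraph. strictly_geometric d K \<Longrightarrow> card (pverts K) = s \<Longrightarrow>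
      \<exists>!H. H \<in> R \<and> digraph_iso (with_proj K) (with_proj H)"
    using assms by (auto simp: geometric_representatives_def)
  have pg: "pair_graph H" if "H \<in> R" for H using R[OF that] by (simp add: strictly_geometric_def)
  have "\<exists>E \<subseteq> {..<s} \<times> {..<s}. \<exists>f. graph_iso f H \<lparr>pverts = {..<s}, parcs = E\<rparr>" if H: "H \<in> R" for H
  proof -
    interpret pair_graph H by (rule pg[OF H])
    have "finite (pverts H)" by (rule pair_finite_verts)
    then obtain f where f: "bij_betw f (pverts H) {..<s}"
      using ex_bij_betw_finite_nat[of "pverts H"] R[OF H] by (auto simp: atLeast0LessThan)
    let ?E = "(\<lambda>(u, v). (f u, f v)) ` parcs H"
    have "?E \<subseteq> {..<s} \<times> {..<s}"
      using bij_betw_apply[OF f] in_arcsD1 in_arcsD2 by auto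
    moreover have "(f u, f v) \<in> ?E \<longleftrightarrow> (u, v) \<in> parcs H" if "u \<in> pverts H" "v \<in> pverts H" for u v
    proof
      assume "(f u, f v) \<in> ?E"
      then obtain a b where ab: "(a, b) \<in> parcs H" "f u = f a" "f v = f b" by auto
      have "u = a" "v = b"
        using inj_onD[OF bij_betw_imp_inj_on[OF f]] ab(2,3) that in_arcsD1[OF ab(1)] in_arcsD2[OF ab(1)]
        by blast+
      then show "(u, v) \<in> parcs H" using ab by simp
    qed force
    ultimately show ?thesis using f by (intro exI[of _ ?E] exI[of _ f] conjI) (simp_all add: graph_iso_def)
  qed
  then obtain E where E: "\<And>H. H \<in> R \<Longrightarrow> E H \<subseteq> {..<s} \<times> {..<s}"
    "\<And>H. H \<in> R \<Longrightarrow> \<exists>f. graph_iso f H \<lparr>pverts = {..<s}, parcs = E H\<rparr>" by metis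
  have "inj_on E R"
  proof (rule inj_onI)
    fix H H' assume H: "H \<in> R" "H' \<in> R" "E H = E H'"
    obtain f g where f: "graph_iso f H \<lparr>pverts = {..<s}, parcs = E H\<rparr>"
      and g: "graph_iso g H' \<lparr>pverts = {..<s}, parcs = E H\<rparr>"
      using E(2)[OF H(1)] E(2)[OF H(2)] H(3) by auto
    have iso: "digraph_iso (with_proj H) (with_proj H'')" if "H'' \<in> R" "graph_iso h H H''" for H'' h
      using digraph_iso_with_proj_iff[OF pair_graph_imp_pair_wf pair_graph_imp_pair_wf] pg H(1) that by blast
    have "graph_iso id H H" by (simp add: graph_iso_def)
    then have "digraph_iso (with_proj H) (with_proj H)" using iso H by blast
    moreover have "digraph_iso (with_proj H) (with_proj H')"
      using iso[OF H(2) graph_iso_comp[OF f graph_iso_inv[OF g]]] .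
    ultimately show "H = H'" using ex1[of H] R[OF H(1)] H(1,2) by blast
  qed
  moreover have "E ` R \<subseteq> Pow ({..<s} \<times> {..<s})" using E(1) by blast
  then have "finite (E ` R)" by (rule finite_subset) simp
  ultimately show ?thesis using finite_imageD by blast
qed

context subcritical_torus_graphs
begin

lemma whp_num_components_ge:
  fixes H :: "nat pair_pre_digraph"
  assumes H: "strictly_geometric TYPE('d) H" and s: "1 \<le> card (pverts H)" "card (pverts H) \<le> k"
  shows "whp M (\<lambda>n \<omega>. B \<le> num_components_iso (random_torus_graph r X n \<omega>) H)"
proof -
  let ?s = "card (pverts H)"
  obtain z :: "nat \<Rightarrow> real ^ 'd" and \<epsilon> R where z: "0 < \<epsilon>" "\<epsilon> \<le> 1 / 2"
    "\<And>u i. u \<in> pverts H \<Longrightarrow> 2 \<le> z u $ i \<and> z u $ i \<le> R - 2"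
    "\<And>u v i. (u, v) \<in> parcs H \<Longrightarrow> \<bar>z u $ i - z v $ i\<bar> + 2 * \<epsilon> < 1"
    "\<And>u v. u \<in> pverts H \<Longrightarrow> v \<in> pverts H \<Longrightarrow> u \<noteq> v \<Longrightarrow> (u, v) \<notin> parcs H \<Longrightarrow>
       \<exists>i. \<bar>z u $ i - z v $ i\<bar> - 2 * \<epsilon> > 1"
    using strictly_geometric_robust[OF H] by metis
  have "pair_graph H" "Digraph_Component.connected (with_proj H)"
    using H by (simp_all add: strictly_geometric_def)
  then interpret P: geometric_pattern H z \<epsilon> R
    by (rule geometric_pattern.intro[OF _ _ z])
  have R: "0 < R" using P.R_ge by simp
  define w where "w n = R * radius n" for n
  define p where "p n = w n ^ CARD('d)" for n
  define L where "L n = nat \<lfloor>1 / w n\<rfloor>" for n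
  define \<mu> where "\<mu> n = real (L n) ^ CARD('d) * real (n div ?s) ^ ?s *
      ((2 * \<epsilon> * radius n) ^ (CARD('d) * ?s) * (1 - p n) ^ (n - ?s))" for n
  \<comment> \<open>\<open>K\<close> collects the losses in bounding \<open>\<mu>\<close> from
    below: a factor 2 each in rounding \<open>1 / w n\<close> and \<open>n / ?s\<close> down, and
    the factor \<open>1 / 2\<close> for the absence of further points. The number of tiles uses up
    one factor \<open>radius n ^ CARD('d)\<close>, which leaves the exponent \<open>?s - 1\<close>
    in \<open>\<nu>\<close>.\<close>
  define K where "K = (1 / (2 * R)) ^ CARD('d) * (1 / (2 * real ?s)) ^ ?s * (2 * \<epsilon>) ^ (CARD('d) * ?s) / 2"
  have K: "0 < K" using R z(1) s by (simp add: K_def)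
  define \<nu> where "\<nu> n = K * (real n ^ ?s * radius n ^ (CARD('d) * (?s - 1)))" for n
  have \<nu>: "filterlim \<nu> at_top sequentially"
    unfolding \<nu>_def by (rule filterlim_tendsto_pos_mult_at_top[OF tendsto_const K radius_lower[OF s]])
  have w0: "w \<longlonglongrightarrow> 0" unfolding w_def using tendsto_mult_left[OF radius_tendsto_0, of R] by simp
  have p0: "p \<longlonglongrightarrow> 0" unfolding p_def using tendsto_power[OF w0, of "CARD('d)"] by (simp add: power_0_left)
  have np: "(\<lambda>n. real n * p n) \<longlonglongrightarrow> 0"
    using tendsto_mult_left[OF mean_degree, of "R ^ CARD('d)"]
    by (simp add: p_def w_def power_mult_distrib mult.left_commute)
  have "\<forall>\<^sub>F n in sequentially. w n < 1 / 2" using w0 by (rule order_tendstoD) simp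
  moreover have "\<forall>\<^sub>F n in sequentially. real n * p n < 1 / 2" using np by (rule order_tendstoD) simp
  moreover have "\<forall>\<^sub>F n in sequentially. p n < 1" using p0 by (rule order_tendstoD) simp
  \<comment> \<open>If \<open>k = 1\<close>, the radius may stay below its majorant, but then
    \<open>H\<close> has a single vertex and \<open>r n \<le> radius n\<close> is enough.\<close>
  moreover have "\<forall>\<^sub>F n in sequentially. ?s = 1 \<or> r n = radius n"
  proof (cases "?s = 1")
    case False
    then have "2 \<le> k" using s by linarith
    then show ?thesis by (rule eventually_mono[OF radius_eq]) simp
  qed simp
  \<comment> \<open>The 1 keeps \<open>\<mu>\<close> positive; \<open>2 * B\<close> ensures that
    fewer than \<open>B\<close> components means at most \<open>\<mu> / 2\<close> of them.\<close>
  moreover have "\<forall>\<^sub>F n in sequentially. max 1 (2 * real B) \<le> \<nu> n"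
    using \<nu> unfolding filterlim_at_top by (rule allE)
  moreover have "\<forall>\<^sub>F n in sequentially. 2 * ?s \<le> n" by (rule eventually_ge_at_top)
  ultimately have bound: "\<forall>\<^sub>F n in sequentially.
      prob_seq M (\<lambda>n \<omega>. \<not> B \<le> num_components_iso (random_torus_graph r X n \<omega>) H) n
      \<le> 4 / \<nu> n + 4 * ((1 / (1 - p n)) ^ (2 * ?s) - 1)"
  proof eventually_elim
    case (elim n)
    interpret prob_space "M n" by (rule prob)
    have n: "1 \<le> n" using elim(6) s by linarith
    have \<rho>: "0 < radius n" by (rule radius_pos[OF n])
    have w: "0 < w n" using R \<rho> by (simp add: w_def)
    have w2: "2 < 1 / w n" using elim(1) w by (simp add: field_simps)
    then have L: "real (L n) \<le> 1 / w n" "1 / w n - 1 < real (L n)" unfolding L_def by linarith+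
    then have Lw: "real (L n) * w n \<le> 1" using w by (simp add: field_simps)
    have L_ge: "1 / (2 * w n) \<le> real (L n)" using L(2) w2 by (simp add: field_simps)
    have div_ge: "real n / (2 * real ?s) \<le> real (n div ?s)"
    proof -
      have "?s * 1 \<le> ?s * (n div ?s)" using elim(6) s by (intro mult_le_mono2) (simp add: less_eq_div_iff_mult_less_eq)
      moreover have "n < ?s * (n div ?s) + ?s" using s by (metis add_less_cancel_left mult_div_mod_eq mod_less_divisor less_le_trans zero_less_one)
      ultimately have "n \<le> 2 * (?s * (n div ?s))" by linarith
      then have "real n \<le> 2 * (real ?s * real (n div ?s))" by (metis of_nat_le_iff of_nat_mult of_nat_numeral)
      then show ?thesis using s by (simp add: field_simps)
    qed
    have p: "0 \<le> p n" using w by (simp add: p_def)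
    \<comment> \<open>Bernoulli's inequality together with \<open>n * p n < 1 / 2\<close>: with
      probability at least \<open>1 / 2\<close>, the remaining points avoid the tile.\<close>
    have "1 / 2 \<le> 1 + real (n - ?s) * (- p n)"
    proof -
      have "real (n - ?s) * p n \<le> real n * p n" using p by (intro mult_right_mono) auto
      then show ?thesis using elim(2) by simp
    qed
    also have "\<dots> \<le> (1 + (- p n)) ^ (n - ?s)"
      using elim(3) by (intro Bernoulli_inequality) simp
    finally have bern: "1 / 2 \<le> (1 - p n) ^ (n - ?s)" by simp
    have "\<nu> n = (1 / (2 * w n)) ^ CARD('d) * (real n / (2 * real ?s)) ^ ?s *
        ((2 * \<epsilon> * radius n) ^ (CARD('d) * ?s) * (1 / 2))"
    proof -
      have "CARD('d) * ?s = CARD('d) * (?s - 1) + CARD('d)"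
        using s by (metis mult_Suc_right Suc_diff_le add.commute diff_Suc_1 One_nat_def)
      then have "radius n ^ (CARD('d) * ?s) = radius n ^ (CARD('d) * (?s - 1)) * radius n ^ CARD('d)"
        by (simp add: power_add)
      then show ?thesis using \<rho> unfolding \<nu>_def K_def w_def
        by (simp add: power_mult_distrib power_divide ac_simps)
    qed
    also have "\<dots> \<le> \<mu> n"
      unfolding \<mu>_def using L_ge div_ge bern w z(1) \<rho>
      by (intro mult_mono power_mono mult_nonneg_nonneg zero_le_power) auto
    finally have \<nu>\<mu>: "\<nu> n \<le> \<mu> n" .
    have "1 \<le> \<nu> n" "2 * real B \<le> \<nu> n" using elim(5) by auto
    then have "0 < \<mu> n" using \<nu>\<mu> by linarith
    have "prob_seq M (\<lambda>n \<omega>. \<not> B \<le> num_components_iso (random_torus_graph r X n \<omega>) H) n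
        \<le> prob {\<omega> \<in> space (M n). real (num_components_iso (torus_graph n (r n) (\<lambda>i. X n i \<omega>)) H) \<le> \<mu> n / 2}"
      unfolding prob_seq_def random_torus_graph_def
    proof (rule finite_measure_mono)
      show "{\<omega> \<in> space (M n). \<not> B \<le> num_components_iso (torus_graph n (r n) (\<lambda>i. X n i \<omega>)) H}
        \<subseteq> {\<omega> \<in> space (M n). real (num_components_iso (torus_graph n (r n) (\<lambda>i. X n i \<omega>)) H) \<le> \<mu> n / 2}"
        using \<open>2 * real B \<le> \<nu> n\<close> \<nu>\<mu> by auto
      show "{\<omega> \<in> space (M n). real (num_components_iso (torus_graph n (r n) (\<lambda>i. X n i \<omega>)) H) \<le> \<mu> n / 2} \<in> events"
        by (rule sets_torus_graph[OF measurable_X])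
    qed
    also have "\<dots> \<le> 4 / \<mu> n + 4 * ((1 / (1 - p n)) ^ (2 * ?s) - 1)"
    proof (rule P.prob_few_components[OF prob indep uniform \<rho>])
      show "real (L n) * (R * radius n) \<le> 1" "2 * (R * radius n) \<le> 1"
        using Lw elim(1) by (simp_all add: w_def)
      show "r n \<le> radius n" by (rule r_le_radius)
      show "?s = 1 \<or> r n = radius n" by (rule elim(4))
      show "2 * ?s \<le> n" by (rule elim(6))
      show "p n = (R * radius n) ^ CARD('d)" by (simp add: p_def w_def)
      show "0 < \<mu> n" by fact
    qed (simp_all add: \<mu>_def)
    also have "4 / \<mu> n \<le> 4 / \<nu> n" using \<nu>\<mu> \<open>1 \<le> \<nu> n\<close> by (intro divide_left_mono) auto
    finally show ?case by simp
  qed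
  show ?thesis
  proof (rule whpI_bad[OF prob _ bound])
    show "{\<omega> \<in> space (M n). B \<le> num_components_iso (random_torus_graph r X n \<omega>) H} \<in> sets (M n)" for n
      by (rule sets_random_torus_graph)
    have "(\<lambda>n. 4 / \<nu> n) \<longlonglongrightarrow> 0"
      by (rule tendsto_divide_0[OF tendsto_const filterlim_at_top_imp_at_infinity[OF \<nu>]])
    moreover have "(\<lambda>n. 4 * ((1 / (1 - p n)) ^ (2 * ?s) - 1)) \<longlonglongrightarrow> 4 * ((1 / (1 - 0)) ^ (2 * ?s) - 1)"
      by (intro tendsto_intros p0) simp
    ultimately show "(\<lambda>n. 4 / \<nu> n + 4 * ((1 / (1 - p n)) ^ (2 * ?s) - 1)) \<longlonglongrightarrow> 0"
      using tendsto_add by fastforce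
  qed
qed

end

theorem theorem1p6:
  fixes k :: nat
    and r :: "nat \<Rightarrow> real"
    and M :: "nat \<Rightarrow> 'w measure"
    and X :: "nat \<Rightarrow> nat \<Rightarrow> 'w \<Rightarrow> real ^ 'd::finite"
    and \<H> :: "nat \<Rightarrow> nat pair_pre_digraph set"
  assumes k: "k \<ge> 1"
    and r: "\<And>n. r n \<in> {0..1/2}"
    and prob: "\<And>n. prob_space (M n)"
    and indep: "\<And>n. prob_space.indep_vars (M n) (\<lambda>_. borel) (X n) {1..n}"
    and uniform: "\<And>n i. i \<in> {1..n} \<Longrightarrow> distr (M n) borel (X n i) = uniform_torus"
    and reps: "\<And>s. s \<ge> 1 \<Longrightarrow> geometric_representatives TYPE('d) s (\<H> s)"
    and lower: "filterlim (\<lambda>n. real n ^ k * r n ^ (CARD('d) * (k - 1))) at_top sequentially"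
    and upper: "(\<lambda>n. real n ^ (k + 1) * r n ^ (CARD('d) * k)) \<longlonglongrightarrow> 0"
  shows "fo_zero_one_law M (random_torus_graph r X)
    \<and> whp M (\<lambda>n \<omega>. \<forall>C \<in> graph_components (random_torus_graph r X n \<omega>). card (verts C) \<le> k)
    \<and> whp M (\<lambda>n \<omega>. \<forall>C \<in> graph_components (random_torus_graph r X n \<omega>).
           \<exists>H \<in> (\<Union>s\<in>{1..k}. \<H> s). digraph_iso C (with_proj H))
    \<and> (\<forall>H \<in> (\<Union>s\<in>{1..k}. \<H> s). tends_to_infinity_in_probability M
           (\<lambda>n \<omega>. num_components_iso (random_torus_graph r X n \<omega>) H))
    \<and> fo_converges_to_theory_of M (random_torus_graph r X) (infinite_copies (\<Union>s\<in>{1..k}. \<H> s))"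
proof -
  interpret subcritical_torus_graphs k r M X
    by (intro subcritical_torus_graphs.intro k r prob indep uniform lower upper)
  let ?G = "random_torus_graph r X"
  let ?\<H> = "\<Union>s\<in>{1..k}. \<H> s"
  have G: "pair_graph (?G n \<omega>)" for n \<omega>
    unfolding random_torus_graph_def by (rule pair_graph_torus_graph)
  have \<H>: "strictly_geometric TYPE('d) H \<and> 1 \<le> card (pverts H) \<and> card (pverts H) \<le> k" if H: "H \<in> ?\<H>" for H
  proof -
    obtain s where "s \<in> {1..k}" "H \<in> \<H> s" using H by blast
    then show ?thesis using reps[of s] by (auto simp: geometric_representatives_def)
  qed
  have \<H>_graph: "pair_graph H" if "H \<in> ?\<H>" for H
    using \<H>[OF that] by (simp add: strictly_geometric_def)
  have fin: "finite ?\<H>"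
  proof (intro finite_UN_I)
    show "finite (\<H> s)" if "s \<in> {1..k}" for s
      by (rule finite_geometric_representatives[OF reps]) (use that in simp)
  qed simp
  have size: "whp M (\<lambda>n \<omega>. \<forall>C \<in> graph_components (?G n \<omega>). card (verts C) \<le> k)"
    using whp_block_card_le by (simp add: graph_components_eq[OF G])
  have types: "whp M (\<lambda>n \<omega>. \<forall>C \<in> graph_components (?G n \<omega>). \<exists>H \<in> ?\<H>. digraph_iso C (with_proj H))"
  proof (rule whp_mono[OF prob sets_random_torus_graph whp_block_card_le])
    have "(\<lambda>n. 4 * real k * radius n) \<longlonglongrightarrow> 0"
      using tendsto_mult_left[OF radius_tendsto_0, of "4 * real k"] by simp
    then have "\<forall>\<^sub>F n in sequentially. 4 * real k * radius n < 1" by (rule order_tendstoD) simp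
    then show "\<forall>\<^sub>F n in sequentially. \<forall>\<omega>\<in>space (M n).
        (\<forall>S. block (?G n \<omega>) S \<longrightarrow> card S \<le> k) \<longrightarrow>
        (\<forall>C \<in> graph_components (?G n \<omega>). \<exists>H \<in> ?\<H>. digraph_iso C (with_proj H))"
    proof eventually_elim
      case (elim n)
      have small: "4 * real k * r n < 1"
        using elim mult_left_mono[OF r_le_radius[of n], of "4 * real k"] by simp
      show ?case
      proof (intro ballI impI)
        fix \<omega> C assume card: "\<forall>S. block (?G n \<omega>) S \<longrightarrow> card S \<le> k" and "C \<in> graph_components (?G n \<omega>)"
        then obtain S where S: "block (?G n \<omega>) S" and C: "C = with_proj (induced (?G n \<omega>) S)"
          by (auto simp: graph_components_eq[OF G])
        have geo: "strictly_geometric TYPE('d) (induced (?G n \<omega>) S)"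
          using S card small r_nonneg unfolding random_torus_graph_def
          by (intro strictly_geometric_block) auto
        have "finite S" using block_subset[OF S] by (auto simp: random_torus_graph_def intro: finite_subset)
        then have s: "1 \<le> card S" "card S \<le> k"
          using block_nonempty[OF S] card S by (auto simp: Suc_le_eq card_gt_0_iff)
        have "\<exists>!H. H \<in> \<H> (card S) \<and> digraph_iso C (with_proj H)"
          using reps[OF s(1)] geo unfolding geometric_representatives_def C by simp
        then show "\<exists>H \<in> ?\<H>. digraph_iso C (with_proj H)" using s by auto
      qed
    qed
  qed
  have many: "whp M (\<lambda>n \<omega>. B \<le> num_components_iso (?G n \<omega>) H)" if "H \<in> ?\<H>" for H B
    using \<H>[OF that] by (intro whp_num_components_ge) auto
  have conv: "prob_seq M (\<lambda>n \<omega>. models (?G n \<omega>) \<phi>) \<longlonglongrightarrow> (if models (infinite_copies ?\<H>) \<phi> then 1 else 0)"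
    if \<phi>: "sentence \<phi>" for \<phi>
  proof -
    \<comment> \<open>For a fixed sentence its quantifier rank is enough, so only finitely many
      events enter, even though the number of copies tends to infinity.\<close>
    let ?B = "quantifier_rank \<phi>" and ?U = "infinite_copies ?\<H>"
    have "\<exists>\<C>. rich ?B ?U ?\<H> \<C>"
    proof (rule rich_infinite_copies)
      fix H assume "H \<in> ?\<H>"
      then show "pair_wf_digraph H \<and> pverts H \<noteq> {}"
        using \<H>_graph[THEN pair_graph_imp_pair_wf] \<H> by fastforce
    qed
    then obtain \<C> where U: "rich ?B ?U ?\<H> \<C>" by blast
    have "whp M (\<lambda>n \<omega>. (\<forall>C \<in> graph_components (?G n \<omega>). \<exists>H \<in> ?\<H>. digraph_iso C (with_proj H)) \<and>
        (\<forall>H\<in>?\<H>. ?B \<le> num_components_iso (?G n \<omega>) H))"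
      by (rule whp_conj[OF prob sets_random_torus_graph types])
        (rule sets_random_torus_graph, rule whp_finite_all[OF prob fin sets_random_torus_graph many])
    then have "whp M (\<lambda>n \<omega>. models (?G n \<omega>) \<phi> \<longleftrightarrow> models ?U \<phi>)"
    proof (rule whp_mono[OF prob sets_random_torus_graph], intro always_eventually allI ballI impI)
      fix n \<omega>
      assume "(\<forall>C \<in> graph_components (?G n \<omega>). \<exists>H \<in> ?\<H>. digraph_iso C (with_proj H)) \<and>
        (\<forall>H\<in>?\<H>. ?B \<le> num_components_iso (?G n \<omega>) H)"
      then have "rich ?B (?G n \<omega>) ?\<H> {S. block (?G n \<omega>) S}"
        by (intro rich_pair_graph[OF G \<H>_graph]) auto
      then show "models (?G n \<omega>) \<phi> \<longleftrightarrow> models ?U \<phi>"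
        by (rule models_eq_if_rich[OF _ U \<phi>]) simp
    qed
    then have *: "prob_seq M (\<lambda>n \<omega>. models (?G n \<omega>) \<phi> \<longleftrightarrow> models ?U \<phi>) \<longlonglongrightarrow> 1" by (simp add: whp_def)
    show ?thesis
    proof (cases "models ?U \<phi>")
      case True
      then show ?thesis using * by simp
    next
      case False
      \<comment> \<open>When the limit structure refutes \<open>\<phi>\<close>, agreement with it is
        the event that \<open>\<phi>\<close> fails, so the limit 1 passes to the complement as
        0.\<close>
      have "prob_seq M (\<lambda>n \<omega>. \<not> models (?G n \<omega>) \<phi>) n = 1 - prob_seq M (\<lambda>n \<omega>. models (?G n \<omega>) \<phi>) n" for n
        by (rule prob_seq_not[OF prob sets_random_torus_graph])
      then have "prob_seq M (\<lambda>n \<omega>. models (?G n \<omega>) \<phi>) = (\<lambda>n. 1 - prob_seq M (\<lambda>n \<omega>. \<not> models (?G n \<omega>) \<phi>) n)"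
        by simp
      moreover have "(\<lambda>n. 1 - prob_seq M (\<lambda>n \<omega>. \<not> models (?G n \<omega>) \<phi>) n) \<longlonglongrightarrow> 1 - 1"
        using * False by (intro tendsto_intros) simp
      ultimately show ?thesis using False by simp
    qed
  qed
  have "prob_seq M (\<lambda>n \<omega>. models (?G n \<omega>) \<phi>) \<longlonglongrightarrow> 0 \<or> prob_seq M (\<lambda>n \<omega>. models (?G n \<omega>) \<phi>) \<longlonglongrightarrow> 1"
    if "sentence \<phi>" for \<phi>
    using conv[OF that] by (cases "models (infinite_copies ?\<H>) \<phi>") auto
  then show ?thesis
    unfolding fo_zero_one_law_def fo_converges_to_theory_of_def tends_to_infinity_in_probability_def
    using size types many conv by blast
qed

end
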